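(* Assume all non-trivial zeros of $\zeta$ are simple, and fix $\beta,n\in\mathbb{N}$. The limit defining $\varpi^{(\beta)}_n(z)$ exists for $z\in\mathbb{H}$, the function $\varpi^{(\beta)}_n$ is holomorphic on $\mathbb{H}$, and for $z\in\mathbb{H}$ $$2\pi i\,\varpi^{(\beta)}_n(z)=\varpi^{(\beta)}_{1,n}(z)+\varpi^{(\beta)}_{2,n}(z)-e^{3z/2}\sum_{q=1}^\infty\frac{c_q^{(\beta)}(n)}{q^{3/2}(z-\log q)},$$ where $$\varpi^{(\beta)}_{1,n}(z)=\int_{-1/2+i\infty}^{-1/2}\frac{\sigma^{(\beta)}_{1-s/\beta}(n)}{\zeta(s)}e^{sz}\,ds$$ (integral along the vertical line $\operatorname{Re}s=-1/2$, downward) is analytic on $\mathbb{H}$, $$\varpi^{(\beta)}_{2,n}(z)=\int_{-1/2}^{3/2}\frac{\sigma^{(\beta)}_{1-s/\beta}(n)}{\zeta(s)}e^{sz}\,ds$$ (integral along the real segment) is entire, and the last term is a meromorphic function on all of $\mathbb{C}$ whose poles are at the points $z=\log q$ with $c_q^{(\beta)}(n)\neq0$.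
   Context: For $\beta,q,n\in\mathbb{N}$, $c_q^{(\beta)}(n)=\sum e^{2\pi i nh/q^\beta}$, the sum over integers $0\le h<q^\beta$ such that $h$ and $q^\beta$ have no common divisor of the form $d^\beta$ with $d>1$. For $z\in\mathbb{C}$, $\sigma_z^{(\beta)}(n)=\sum_{d\in\mathbb{N},\ d^\beta\mid n}d^{\beta z}$. $\mathbb{H}=\{z\in\mathbb{C}:\operatorname{Im}z>0\}$. Fix a sequence $(T_m)_{m\ge1}$ with $m\le T_m\le m+1$ and $|\zeta(\sigma\pm iT_m)|^{-1}<T_m^{c_1}$ for $-1\le\sigma\le2$, for an absolute constant $c_1$ (such a sequence exists). For $z\in\mathbb{H}$, $\varpi^{(\beta)}_n(z)=\lim_{m\to\infty}\sum_{\rho:\,0<\operatorname{Im}\rho<T_m}\frac{\sigma^{(\beta)}_{1-\rho/\beta}(n)}{\zeta'(\rho)}e^{\rho z}$, the sum over non-trivial zeros $\rho$ of $\zeta$. *)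

theory Defs
  imports "HOL-Analysis.Analysis"
begin

text \<open>Riemann zeta function: the unique holomorphic function on the complex plane minus 1
  that agrees with the Dirichlet series for Re s > 1 (analytic continuation).
  At the pole s = 1 we use the convention value 0 (irrelevant for the statement).\<close>
definition zeta :: "complex \<Rightarrow> complex" where
  "zeta = (THE f. f holomorphic_on (- {1}) \<and> f 1 = 0 \<and>
      (\<forall>s. 1 < Re s \<longrightarrow> (\<lambda>k. 1 / (of_nat (Suc k)) powr s) sums f s))"

definition nontrivial_zero :: "complex \<Rightarrow> bool" where
  "nontrivial_zero \<rho> \<longleftrightarrow> zeta \<rho> = 0 \<and> 0 < Re \<rho> \<and> Re \<rho> < 1"

definition cq :: "nat \<Rightarrow> nat \<Rightarrow> nat \<Rightarrow> complex" where
  "cq \<beta> q n = (\<Sum>h \<in> {h. h < q ^ \<beta> \<and> \<not> (\<exists>d>1. d ^ \<beta> dvd h \<and> d ^ \<beta> dvd q ^ \<beta>)}.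
       exp (2 * pi * \<i> * of_nat n * of_nat h / of_nat (q ^ \<beta>)))"

definition sigmab :: "nat \<Rightarrow> complex \<Rightarrow> nat \<Rightarrow> complex" where
  "sigmab \<beta> z n = (\<Sum>d \<in> {d. 1 \<le> d \<and> d ^ \<beta> dvd n}. (of_nat d) powr (of_nat \<beta> * z))"

definition varpi_partial :: "nat \<Rightarrow> nat \<Rightarrow> real \<Rightarrow> complex \<Rightarrow> complex" where
  "varpi_partial \<beta> n T z = (\<Sum>\<rho> \<in> {\<rho>. nontrivial_zero \<rho> \<and> 0 < Im \<rho> \<and> Im \<rho> < T}.
       sigmab \<beta> (1 - \<rho> / of_nat \<beta>) n / deriv zeta \<rho> * exp (\<rho> * z))"

definition varpi :: "(nat \<Rightarrow> real) \<Rightarrow> nat \<Rightarrow> nat \<Rightarrow> complex \<Rightarrow> complex" where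
  "varpi T \<beta> n z = lim (\<lambda>m. varpi_partial \<beta> n (T m) z)"

definition integrand :: "nat \<Rightarrow> nat \<Rightarrow> complex \<Rightarrow> complex \<Rightarrow> complex" where
  "integrand \<beta> n z s = sigmab \<beta> (1 - s / of_nat \<beta>) n / zeta s * exp (s * z)"

text \<open>Integral from -1/2 + i infinity down to -1/2 along Re s = -1/2:
  with s = -1/2 + i t, ds = i dt, t from infinity to 0.\<close>
definition varpi1 :: "nat \<Rightarrow> nat \<Rightarrow> complex \<Rightarrow> complex" where
  "varpi1 \<beta> n z = - (\<i> * integral {0..} (\<lambda>t::real. integrand \<beta> n z (- 1/2 + \<i> * of_real t)))"

definition varpi2 :: "nat \<Rightarrow> nat \<Rightarrow> complex \<Rightarrow> complex" where
  "varpi2 \<beta> n z = integral {-1/2..3/2} (\<lambda>x::real. integrand \<beta> n z (of_real x))"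

definition cq_series :: "nat \<Rightarrow> nat \<Rightarrow> complex \<Rightarrow> complex" where
  "cq_series \<beta> n z = (\<Sum>k. cq \<beta> (Suc k) n /
       (of_real (real (Suc k) powr (3/2)) * (z - of_real (ln (real (Suc k))))))"

definition meromorphic_with_poles :: "(complex \<Rightarrow> complex) \<Rightarrow> complex set \<Rightarrow> bool" where
  "meromorphic_with_poles f P \<longleftrightarrow>
     (\<forall>p. \<not> p islimpt P) \<and> f holomorphic_on (- P) \<and>
     (\<forall>p\<in>P. filterlim f at_infinity (at p))"

end

theory Submission
  imports Defs "HOL-Complex_Analysis.Complex_Analysis" "HOL-Computational_Algebra.Squarefree"
    "HOL-Number_Theory.Prime_Powers" "HOL-Real_Asymp.Real_Asymp"
begin

text \<open>
  Integrate \<open>\<sigma>(s) e^(sz) / \<zeta>(s)\<close>, where \<open>\<sigma>(s)\<close> is the divisor sum at \<open>1 - s/\<beta>\<close>, around the rectangle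
  with corners \<open>-1/2\<close>, \<open>3/2\<close>, \<open>3/2 + i T\<close> and \<open>-1/2 + i T\<close> for \<open>T = T_m\<close>. The residues at the zeros of
  \<open>\<zeta>\<close> give the partial sums of \<open>\<varpi>\<close>; the lower side is \<open>\<varpi>_2\<close>; the upper side tends to \<open>0\<close> because
  \<open>e^(-T Im z)\<close> beats the assumed polynomial bound for \<open>1/\<zeta>\<close>; the left side tends to \<open>\<varpi>_1\<close> because
  \<open>1/\<zeta>\<close> is bounded on \<open>Re s = -1/2\<close>; and on the right side \<open>\<sigma>/\<zeta>\<close> is the Dirichlet series with
  coefficients \<open>c_q(n)\<close>, bounded by Moebius inversion, so that termwise integration yields the last series.

  The zeta function is continued to \<open>Re s > -1\<close> by the trapezoidal rule. For \<open>-1 < s < 0\<close> the Mellin transform of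
  \<open>1/(e^x - 1) - 1/x + 1/2\<close> is computed twice, from the geometric series and from the partial fractions of
  the hyperbolic cotangent; every term is nonnegative, so sums and integrals may be interchanged. This gives the functional equation,
  hence the continuation to the whole plane, the bound on the left side and, with the inequality
  \<open>3 + 4 cos \<theta> + cos 2\<theta> \<ge> 0\<close>, that there are no zeros in \<open>Re s > -1\<close> other than non-real ones with \<open>0 < Re s < 1\<close>.
\<close>

section \<open>Dirichlet series and the sums \<open>c_q\<close>\<close>

text \<open>The description that defines \<open>zeta\<close> ranges over functions on the whole
  plane without 1, so nothing can be said about \<open>zeta\<close> before a full continuation
  exists, although the contour stays inside \<open>Re s > -1\<close>. Until then the work is done
  with \<open>zeta_reg\<close>, which has no pole. The range \<open>-1 < s < 0\<close> is exactly
  where the Mellin integral converges: the transformed function behaves like \<open>x / 12\<close>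
  at 0 and tends to \<open>1 / 2\<close> at infinity. The zero-free statements serve the contour. A
  zero on the real segment or on the left side would spoil the integrals, and a zero on
  \<open>Re s = 1\<close>, or by reflection on \<open>Re s = 0\<close>, would contribute a residue
  that \<open>varpi\<close> omits, since \<open>nontrivial_zero\<close> demands
  \<open>0 < Re \<rho> < 1\<close>. The abscissas fit together: \<open>1 - s\<close> maps the line
  \<open>-1/2\<close> to the line \<open>3/2\<close>, where the Dirichlet series converge
  absolutely. There the q-th term of the integrand is a multiple of
  \<open>exp (s * (z - ln q))\<close>, and its primitive brings in the denominator
  \<open>z - ln q\<close>, the origin of the poles.\<close>

definition mobius_mu :: "nat \<Rightarrow> int" where
  "mobius_mu n = (if squarefree n then (- 1) ^ card (prime_factors n) else 0)"

lemma abs_mobius_mu_le_1: "\<bar>mobius_mu n\<bar> \<le> 1"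
  by (simp add: mobius_mu_def)

lemma mobius_mu_prime_times:
  assumes p: "prime p" and d: "\<not> p dvd d" "squarefree d"
  shows "mobius_mu (p * d) = - mobius_mu d" "squarefree (p * d)"
proof -
  have d0: "d \<noteq> 0" using d by (metis dvd_0_right)
  have cop: "coprime p d" using p d(1) by (simp add: prime_imp_coprime)
  have "squarefree p" using p by (simp add: squarefree_prime)
  then show sq: "squarefree (p * d)"
    using cop d(2) by (simp add: squarefree_mult_coprime)
  have "prime_factors (p * d) = insert p (prime_factors d)"
    using p d0 by (subst prime_factors_product) (auto simp: prime_prime_factors)
  moreover have "p \<notin> prime_factors d" using d(1) by auto
  ultimately show "mobius_mu (p * d) = - mobius_mu d"
    using d(2) sq by (simp add: mobius_mu_def)
qed

text \<open>For a prime \<open>p\<close> dividing \<open>n\<close>, multiplication by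
  \<open>p\<close> pairs the squarefree divisors prime to \<open>p\<close> with those divisible by
  \<open>p\<close>, and the members of a pair have opposite signs.\<close>

lemma sum_mobius_mu_divisors:
  assumes n: "n > 0"
  shows "(\<Sum>d | d dvd n. mobius_mu d) = (if n = 1 then 1 else 0)"
proof (cases "n = 1")
  case True
  then show ?thesis by (simp add: mobius_mu_def)
next
  case False
  then obtain p where p: "prime p" "p dvd n" using prime_factor_nat by blast
  let ?A = "{d. d dvd n \<and> squarefree d \<and> \<not> p dvd d}"
  let ?B = "{d. d dvd n \<and> squarefree d \<and> p dvd d}"
  have fin: "finite {d. d dvd n}" using n by simp
  have "(\<Sum>d | d dvd n. mobius_mu d) = (\<Sum>d\<in>?A \<union> ?B. mobius_mu d)"
    using fin by (intro sum.mono_neutral_right) (auto simp: mobius_mu_def)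
  also have "\<dots> = (\<Sum>d\<in>?A. mobius_mu d) + (\<Sum>d\<in>?B. mobius_mu d)"
    using fin by (intro sum.union_disjoint) auto
  also have "(\<Sum>d\<in>?B. mobius_mu d) = (\<Sum>d\<in>?A. mobius_mu (p * d))"
  proof (rule sum.reindex_bij_witness[where i = "\<lambda>d. p * d" and j = "\<lambda>d. d div p"])
    fix d assume d: "d \<in> ?B"
    then show "p * (d div p) = d" by auto
    then show "mobius_mu (p * (d div p)) = mobius_mu d" by simp
    obtain e where e: "d = p * e" using d by auto
    have "\<not> p dvd e"
    proof
      assume "p dvd e"
      then have "p\<^sup>2 dvd d" by (simp add: e power2_eq_square)
      then show False using d p(1) squarefreeD[of d p] by auto
    qed
    moreover have "squarefree e" using d e by (metis (mono_tags, lifting) dvd_triv_right mem_Collect_eq squarefree_mono)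
    moreover have "e dvd n" using d e by (metis (mono_tags, lifting) dvd_mult_right mem_Collect_eq)
    ultimately show "d div p \<in> ?A" using e p(1) by (auto simp: prime_gt_0_nat)
  next
    fix d assume d: "d \<in> ?A"
    show "p * d div p = d" using p(1) by (auto simp: prime_gt_0_nat)
    have "coprime p d" using p(1) d by (simp add: prime_imp_coprime)
    then show "p * d \<in> ?B" using d p mobius_mu_prime_times(2)[of p d] by (auto intro: divides_mult)
  qed
  also have "\<dots> = (\<Sum>d\<in>?A. - mobius_mu d)"
    using p(1) by (intro sum.cong) (auto simp: mobius_mu_prime_times(1))
  finally show ?thesis using False by (simp add: sum_negf)
qed

text \<open>Over the complex numbers \<open>has_sum\<close> is already absolute convergence, so the
  product is a sum over all pairs \<open>(m, l)\<close>, which may be regrouped by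
  \<open>k = m * l\<close>.\<close>

lemma has_sum_dirichlet_product:
  fixes a b :: "nat \<Rightarrow> complex"
  assumes a: "((\<lambda>m. a m * of_nat m powr - s) has_sum A) {1..}"
    and b: "((\<lambda>m. b m * of_nat m powr - s) has_sum B) {1..}"
  shows "((\<lambda>k. (\<Sum>d | d dvd k. a d * b (k div d)) * of_nat k powr - s) has_sum A * B) {1..}"
proof -
  let ?f = "\<lambda>m. a m * of_nat m powr - s" and ?g = "\<lambda>m. b m * of_nat m powr - s"
  let ?h = "\<lambda>(m, l). ?f m * ?g l"
  have na: "(\<lambda>m. norm (?f m)) summable_on {1..}" and nb: "(\<lambda>m. norm (?g m)) summable_on {1..}"
    using a b by (auto simp: summable_on_iff_abs_summable_on_complex[symmetric] has_sum_imp_summable)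
  have "(\<lambda>x. norm (?h x)) summable_on ({1..} \<times> {1..})"
    unfolding Infinite_Sum.abs_summable_on_Sigma_iff
  proof (intro conjI ballI)
    fix m
    show "(\<lambda>l. norm (?h (m, l))) summable_on {1..}"
      using summable_on_cmult_right[OF nb, of "norm (?f m)"] by (simp add: norm_mult)
    have "(\<lambda>m. norm (norm (?f m) * (\<Sum>\<^sub>\<infinity>l\<in>{1..}. norm (?g l)))) summable_on {1..}"
      using summable_on_cmult_left[OF na, of "\<Sum>\<^sub>\<infinity>l\<in>{1..}. norm (?g l)"]
      by (simp add: abs_mult infsum_nonneg)
    moreover have "(\<Sum>\<^sub>\<infinity>l\<in>{1..}. norm (?h (m, l))) = norm (?f m) * (\<Sum>\<^sub>\<infinity>l\<in>{1..}. norm (?g l))" for m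
      by (simp only: prod.case norm_mult infsum_cmult_right')
    ultimately show "(\<lambda>m. norm (\<Sum>\<^sub>\<infinity>l\<in>{1..}. norm (?h (m, l)))) summable_on {1..}"
      by (simp only:)
  qed
  then have sm: "?h summable_on ({1..} \<times> {1..})" by (rule Infinite_Sum.abs_summable_summable)
  have *: "(?h has_sum A * B) ({1..} \<times> {1..})"
  proof (rule has_sum_SigmaI[where g = "\<lambda>m. ?f m * B"])
    show "((\<lambda>y. ?h (x, y)) has_sum ?f x * B) {1..}" for x
      using has_sum_cmult_right[OF b, of "?f x"] by (simp add: mult.assoc)
    show "((\<lambda>m. ?f m * B) has_sum A * B) {1..}"
      using has_sum_cmult_left[OF a] by simp
  qed (use sm in auto)
  let ?S = "SIGMA k:{1::nat..}. {d. d dvd k}"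
  let ?h' = "\<lambda>(k, d). a d * b (k div d) * of_nat k powr - s"
  have "(?h' has_sum A * B) ?S \<longleftrightarrow> (?h has_sum A * B) ({1..} \<times> {1..})"
  proof (rule has_sum_reindex_bij_witness[where i = "\<lambda>(m, l). (m * l, m)" and j = "\<lambda>(k, d). (d, k div d)"])
    fix x assume x: "x \<in> ?S"
    obtain k d where kd: "x = (k, d)" by (cases x)
    obtain l where l: "k = d * l" using x kd by auto
    have pos: "d > 0" "l > 0" using x kd l by (auto intro: Nat.gr0I)
    show "(case case x of (k, d) \<Rightarrow> (d, k div d) of (m, l) \<Rightarrow> (m * l, m)) = x"
      using kd l pos by simp
    show "(case x of (k, d) \<Rightarrow> (d, k div d)) \<in> {1..} \<times> {1..}"
      using kd l pos by auto
    have "(of_nat (d * l) :: complex) powr - s = of_nat d powr - s * of_nat l powr - s"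
      using pos powr_times_real[of "of_nat d" "of_nat l" "- s"] by simp
    then show "?h (case x of (k, d) \<Rightarrow> (d, k div d)) = ?h' x"
      using kd l pos by simp
  qed (auto simp: Suc_le_eq)
  with * have **: "(?h' has_sum A * B) ?S" by simp
  show ?thesis
  proof (rule has_sum_Sigma'[OF **])
    fix k :: nat assume "k \<in> {1..}"
    then have "finite {d. d dvd k}" by simp
    then show "((\<lambda>d. ?h' (k, d)) has_sum (\<Sum>d | d dvd k. a d * b (k div d)) * of_nat k powr - s) {d. d dvd k}"
      using has_sum_finite[of "{d. d dvd k}" "\<lambda>d. ?h' (k, d)"] by (simp add: sum_distrib_right)
  qed
qed

lemma summable_on_bounded_dirichlet:
  fixes a :: "nat \<Rightarrow> complex"
  assumes s: "Re s > 1" and C: "\<And>k. k \<ge> 1 \<Longrightarrow> norm (a k) \<le> C"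
  shows "(\<lambda>k. norm (a k * of_nat k powr - s)) summable_on {1..}"
proof (rule Infinite_Sum.abs_summable_on_comparison_test')
  have "summable (\<lambda>k. real (Suc k) powr - Re s)"
    using s by (subst summable_Suc_iff) (simp add: summable_real_powr_iff)
  then have "(\<lambda>k. real (Suc k) powr - Re s) summable_on UNIV"
    by (intro norm_summable_imp_summable_on) simp
  then have "(\<lambda>k. real k powr - Re s) summable_on {1..}"
    by (rule summable_on_reindex_bij_betw[THEN iffD1, rotated])
       (rule bij_betwI[where g = "\<lambda>n. n - 1"], auto)
  then show "(\<lambda>k. C * real k powr - Re s) summable_on {1..}" by (rule summable_on_cmult_right)
  fix k :: nat assume "k \<in> {1..}"
  then show "norm (a k * of_nat k powr - s) \<le> C * real k powr - Re s"
    using C[of k] by (auto simp: norm_mult norm_powr_real_powr intro!: mult_right_mono)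
qed

section \<open>Divisor sums of \<open>cq\<close>: roots of unity and Moebius inversion\<close>

lemma finite_cq_index: "finite {h. h < (q::nat) ^ \<beta> \<and> P h}"
  by (rule finite_subset[of _ "{..<q ^ \<beta>}"]) auto

text \<open>This makes the divisors of \<open>q\<close> whose \<beta>-th power divides
  \<open>h\<close> closed under \<open>lcm\<close>, so that the largest of them is a multiple of all
  others.\<close>

lemma lcm_power_nat: "lcm (a ^ n) (b ^ n) = lcm a (b::nat) ^ n"
proof (cases "a = 0 \<or> n = 0")
  case True
  then show ?thesis by (cases "n = 0") (auto simp: power_0_left)
next
  case False
  have "lcm (a ^ n) (b ^ n) * gcd a b ^ n = lcm a b ^ n * gcd a b ^ n"
    using prod_gcd_lcm_nat[of "a ^ n" "b ^ n"] prod_gcd_lcm_nat[of a b]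
    by (metis gcd_exp mult.commute power_mult_distrib)
  then show ?thesis using False by auto
qed

text \<open>Every \<open>h < q ^ \<beta>\<close> is \<open>(q div d) ^ \<beta> * h'\<close> for
  exactly one divisor \<open>d\<close> of \<open>q\<close> and one \<open>h'\<close> admissible in
  \<open>cq \<beta> d n\<close>. The sums for all \<open>d\<close> together therefore form one
  complete exponential sum modulo \<open>q ^ \<beta>\<close>.\<close>

lemma sum_cq_divisors:
  assumes \<beta>: "\<beta> \<ge> 1" and q: "q \<ge> 1"
  shows "(\<Sum>d | d dvd q. cq \<beta> d n) = (if q ^ \<beta> dvd n then of_nat (q ^ \<beta>) else 0)"
proof -
  let ?e = "\<lambda>h::nat. exp (2 * pi * \<i> * of_nat n * of_nat h / of_nat (q ^ \<beta>)) :: complex"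
  let ?R = "\<lambda>q. {h::nat. h < q ^ \<beta> \<and> \<not> (\<exists>d>1. d ^ \<beta> dvd h \<and> d ^ \<beta> dvd q ^ \<beta>)}"
  have dvd_pow: "d ^ \<beta> dvd e ^ \<beta> \<longleftrightarrow> d dvd e" for d e :: nat using \<beta> by simp
  \<comment> \<open>Each \<open>h < q^\<beta>\<close> is sorted by the largest divisor \<open>M h\<close> of \<open>q\<close> whose \<open>\<beta>\<close>-th power divides it.\<close>
  define M where "M h = Max {e. e dvd q \<and> e ^ \<beta> dvd h}" for h :: nat
  have fin: "finite {e. e dvd q \<and> e ^ \<beta> dvd h}" for h :: nat
    by (rule finite_subset[of _ "{e. e dvd q}"]) (use q in auto)
  have M_in: "M h \<in> {e. e dvd q \<and> e ^ \<beta> dvd h}" for h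
    unfolding M_def by (rule Max_in[OF fin]) (auto intro!: exI[of _ 1])
  have M: "M h dvd q" "M h ^ \<beta> dvd h" for h using M_in[of h] by auto
  have M_ge: "e \<le> M h" if "e dvd q" "e ^ \<beta> dvd h" for e h
    unfolding M_def by (rule Max_ge[OF fin]) (use that in simp)
  have Mmax: "e dvd M h" if e: "e dvd q" "e ^ \<beta> dvd h" for e h
  proof -
    have "lcm e (M h) ^ \<beta> dvd h"
      using e M(2)[of h] by (simp flip: lcm_power_nat)
    note pow = this
    have dv: "lcm e (M h) dvd q" by (rule lcm_least[OF e(1) M(1)])
    have le: "lcm e (M h) \<le> M h" by (rule M_ge[OF dv pow])
    have "q > 0" using q by simp
    then have "lcm e (M h) > 0" by (rule dvd_pos_nat[OF _ dv])
    then have "M h \<le> lcm e (M h)" by (rule dvd_imp_le[OF dvd_lcm2])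
    then have eq: "lcm e (M h) = M h" by (rule order.antisym[OF le])
    have "e dvd lcm e (M h)" by (rule dvd_lcm1)
    then show ?thesis by (simp only: eq)
  qed
  have "(\<Sum>h<q ^ \<beta>. ?e h) = (\<Sum>h\<in>(\<Union>d\<in>{d. d dvd q}. (\<lambda>h. (q div d) ^ \<beta> * h) ` ?R d). ?e h)"
  proof (rule sum.cong[OF _ refl], intro equalityI subsetI)
    fix h assume h: "h \<in> {..<q ^ \<beta>}"
    obtain h' where h': "h = M h ^ \<beta> * h'" using M(2)[of h] by blast
    obtain d where d: "q = M h * d" using M(1)[of h] by blast
    have pos: "M h > 0" "d > 0" using d q by (auto intro: Nat.gr0I)
    have "h' \<in> ?R d"
    proof (safe)
      have "M h ^ \<beta> * h' < (M h * d) ^ \<beta>"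
        using h by (simp only: h'[symmetric] d[symmetric] lessThan_iff)
      then show "h' < d ^ \<beta>" by (simp add: power_mult_distrib)
      fix e :: nat assume e: "e > 1" "e ^ \<beta> dvd h'" "e ^ \<beta> dvd d ^ \<beta>"
      have "(M h * e) ^ \<beta> dvd M h ^ \<beta> * h'" using e by (simp add: power_mult_distrib)
      then have "(M h * e) ^ \<beta> dvd h" by (simp only: h'[symmetric])
      moreover have "M h * e dvd M h * d" using e(3) dvd_pow by simp
      then have "M h * e dvd q" using d by simp
      ultimately have "M h * e dvd M h" using Mmax by blast
      then show False using pos e by auto
    qed
    moreover have "q div d = M h" using d pos(2) by (metis nonzero_mult_div_cancel_right less_not_refl)
    then have "h = (q div d) ^ \<beta> * h'" by (simp only: h'[symmetric])
    moreover have "d dvd q" using d by (metis dvd_triv_right)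
    ultimately show "h \<in> (\<Union>d\<in>{d. d dvd q}. (\<lambda>h. (q div d) ^ \<beta> * h) ` ?R d)"
      by (intro UN_I[of d] image_eqI[of _ _ h']) simp_all
  next
    fix h assume "h \<in> (\<Union>d\<in>{d. d dvd q}. (\<lambda>h. (q div d) ^ \<beta> * h) ` ?R d)"
    then obtain d h' where d: "d dvd q" "h' < d ^ \<beta>" "h = (q div d) ^ \<beta> * h'" by blast
    then have "q div d > 0" using q by (metis One_nat_def Suc_le_eq dvd_div_eq_0_iff gr0I less_numeral_extra(3))
    then have "h < (q div d) ^ \<beta> * d ^ \<beta>" using d by simp
    then show "h \<in> {..<q ^ \<beta>}" using d(1) by (simp flip: power_mult_distrib)
  qed
  also have "\<dots> = (\<Sum>d | d dvd q. \<Sum>h\<in>(\<lambda>h. (q div d) ^ \<beta> * h) ` ?R d. ?e h)"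
  proof (rule sum.UNION_disjoint)
    show "finite {d. d dvd q}" using q by simp
    show "\<forall>d\<in>{d. d dvd q}. finite ((\<lambda>h. (q div d) ^ \<beta> * h) ` ?R d)"
      by (intro ballI finite_imageI finite_cq_index)
    \<comment> \<open>\<open>h\<close> determines its divisor \<open>d\<close> through
      \<open>M h\<close>; this is what makes the classes disjoint.\<close>
    have key: "M h = q div d" if d: "d dvd q" and h: "h \<in> (\<lambda>h. (q div d) ^ \<beta> * h) ` ?R d" for d h
    proof -
      obtain h' where h': "h = (q div d) ^ \<beta> * h'" "h' \<in> ?R d" using h by blast
      have "q div d dvd M h" using d h' by (intro Mmax) auto
      then obtain e where e: "M h = q div d * e" by blast
      have pos: "q div d > 0" using d q by (metis One_nat_def Suc_le_eq dvd_div_eq_0_iff gr0I less_numeral_extra(3))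
      have "(q div d) ^ \<beta> * e ^ \<beta> dvd (q div d) ^ \<beta> * h'"
        using M(2)[of h] e h'(1) by (simp add: power_mult_distrib)
      then have 1: "e ^ \<beta> dvd h'" using pos by simp
      have "q div d * e dvd q div d * d" using M(1)[of h] e d by simp
      then have 2: "e dvd d" using pos by simp
      have "\<not> e > 1" using 1 2 h'(2) dvd_pow by blast
      moreover have "e \<noteq> 0"
      proof
        assume "e = 0"
        then show False using e M(1)[of h] q by simp
      qed
      ultimately have "e = 1" by linarith
      then show ?thesis using e by simp
    qed
    show "\<forall>i\<in>{d. d dvd q}. \<forall>j\<in>{d. d dvd q}. i \<noteq> j \<longrightarrow>
        (\<lambda>h. (q div i) ^ \<beta> * h) ` ?R i \<inter> (\<lambda>h. (q div j) ^ \<beta> * h) ` ?R j = {}"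
    proof (intro ballI impI, rule ccontr)
      fix i j assume ij: "i \<in> {d. d dvd q}" "j \<in> {d. d dvd q}" "i \<noteq> j"
        "(\<lambda>h. (q div i) ^ \<beta> * h) ` ?R i \<inter> (\<lambda>h. (q div j) ^ \<beta> * h) ` ?R j \<noteq> {}"
      then obtain h where "h \<in> (\<lambda>h. (q div i) ^ \<beta> * h) ` ?R i" "h \<in> (\<lambda>h. (q div j) ^ \<beta> * h) ` ?R j"
        by blast
      then have "q div i = q div j" using key[of i h] key[of j h] ij(1,2) by simp
      moreover have "q div i * i = q div j * j" "q div i * i \<noteq> 0" using ij q by auto
      ultimately show False using ij(3) by simp
    qed
  qed
  also have "\<dots> = (\<Sum>d | d dvd q. cq \<beta> d n)"
  proof (rule sum.cong[OF refl])
    fix d assume d: "d \<in> {d. d dvd q}"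
    then obtain e where e: "q = d * e" by blast
    have pos: "d > 0" "e > 0" using e q by (auto intro: Nat.gr0I)
    have qd: "q div d = e" using e pos by simp
    have inj: "inj_on (\<lambda>h. e ^ \<beta> * h) (?R d)" using pos by (auto intro: inj_onI)
    show "(\<Sum>h\<in>(\<lambda>h. (q div d) ^ \<beta> * h) ` ?R d. ?e h) = cq \<beta> d n"
      unfolding cq_def qd
    proof (subst sum.reindex[OF inj], rule sum.cong[OF refl])
      fix h
      show "(?e \<circ> (\<lambda>h. e ^ \<beta> * h)) h = exp (2 * pi * \<i> * of_nat n * of_nat h / of_nat (d ^ \<beta>))"
        using pos by (simp add: e power_mult_distrib mult_ac)
    qed
  qed
  finally have 1: "(\<Sum>d | d dvd q. cq \<beta> d n) = (\<Sum>h<q ^ \<beta>. ?e h)" by simp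
  \<comment> \<open>The complete sum is geometric in the root of unity \<open>w\<close>, hence 0
    unless \<open>w = 1\<close>.\<close>
  define w where "w = (exp (2 * pi * \<i> * of_nat n / of_nat (q ^ \<beta>)) :: complex)"
  have pow: "?e h = w ^ h" for h
    by (simp add: w_def flip: exp_of_nat_mult) (simp add: algebra_simps)
  have Qpos: "q ^ \<beta> > 0" using q by simp
  have w1: "w = 1 \<longleftrightarrow> q ^ \<beta> dvd n"
  proof -
    have "w = 1 \<longleftrightarrow> (\<exists>m::int. 2 * pi * real n / real (q ^ \<beta>) = of_int (2 * m) * pi)"
      unfolding w_def exp_eq_1 by simp
    also have "\<dots> \<longleftrightarrow> (\<exists>m::int. real n = of_int m * real (q ^ \<beta>))"
      using Qpos by (intro ex_cong1) (auto simp: field_simps)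
    also have "\<dots> \<longleftrightarrow> (\<exists>m::int. int n = m * int (q ^ \<beta>))"
    proof (intro ex_cong1)
      fix m :: int
      have "real n = of_int m * real (q ^ \<beta>) \<longleftrightarrow> real_of_int (int n) = real_of_int (m * int (q ^ \<beta>))" by simp
      then show "real n = of_int m * real (q ^ \<beta>) \<longleftrightarrow> int n = m * int (q ^ \<beta>)"
        unfolding of_int_eq_iff .
    qed
    also have "\<dots> \<longleftrightarrow> int (q ^ \<beta>) dvd int n" by (auto simp: dvd_def mult.commute)
    also have "\<dots> \<longleftrightarrow> q ^ \<beta> dvd n" by (rule of_nat_dvd_iff)
    finally show ?thesis .
  qed
  have "(\<Sum>h<q ^ \<beta>. ?e h) = (\<Sum>h<q ^ \<beta>. w ^ h)" by (simp only: pow)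
  also have "\<dots> = (if q ^ \<beta> dvd n then of_nat (q ^ \<beta>) else 0)"
  proof (cases "q ^ \<beta> dvd n")
    case True
    then show ?thesis using w1 by simp
  next
    case False
    have "w ^ (q ^ \<beta>) = exp (2 * of_real pi * \<i> * of_nat n)"
      using Qpos unfolding w_def by (simp flip: exp_of_nat_mult)
    also have "\<dots> = 1"
      unfolding exp_eq_1 by (auto intro: exI[of _ "int n"])
    finally show ?thesis using False w1 geometric_sum[of w "q ^ \<beta>"] by simp
  qed
  finally show ?thesis using 1 by simp
qed

text \<open>The chains \<open>e dvd d dvd q\<close> are regrouped by \<open>e\<close> and
  \<open>k = q div d\<close>; the inner Moebius sum then survives only for
  \<open>e = q\<close>.\<close>

lemma mobius_inversion:
  fixes f g :: "nat \<Rightarrow> complex"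
  assumes g: "\<And>q. q \<ge> 1 \<Longrightarrow> (\<Sum>d | d dvd q. f d) = g q" and q: "q \<ge> 1"
  shows "f q = (\<Sum>d | d dvd q. of_int (mobius_mu (q div d)) * g d)"
proof -
  have "(\<Sum>d | d dvd q. of_int (mobius_mu (q div d)) * g d)
      = (\<Sum>d | d dvd q. \<Sum>e | e dvd d. of_int (mobius_mu (q div d)) * f e)"
    using q g by (intro sum.cong refl) (auto simp: sum_distrib_left[symmetric] Suc_le_eq intro: Nat.gr0I)
  also have "\<dots> = (\<Sum>(d, e)\<in>(SIGMA d:{d. d dvd q}. {e. e dvd d}). of_int (mobius_mu (q div d)) * f e)"
    using q by (subst sum.Sigma) (auto intro!: finite_divisors_nat intro: Nat.gr0I)
  also have "\<dots> = (\<Sum>(e, k)\<in>(SIGMA e:{e. e dvd q}. {k. k dvd q div e}). of_int (mobius_mu k) * f e)"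
  proof (rule sum.reindex_bij_witness[where i = "\<lambda>(e, k). (q div k, e)" and j = "\<lambda>(d, e). (e, q div d)"])
    fix x assume x: "x \<in> (SIGMA d:{d. d dvd q}. {e. e dvd d})"
    obtain d e where de: "x = (d, e)" by (cases x)
    obtain b where b: "d = e * b" using x de by auto
    obtain a where "q = d * a" using x de by auto
    note ab = this b
    have pos: "a > 0" "b > 0" "e > 0" using ab q by (auto intro: Nat.gr0I)
    show "(case case x of (d, e) \<Rightarrow> (e, q div d) of (e, k) \<Rightarrow> (q div k, e)) = x"
      using de ab pos by simp
    show "(case x of (d, e) \<Rightarrow> (e, q div d)) \<in> (SIGMA e:{e. e dvd q}. {k. k dvd q div e})"
      using de ab pos by (simp add: mult.assoc)
    show "(case case x of (d, e) \<Rightarrow> (e, q div d) of (e, k) \<Rightarrow> of_int (mobius_mu k) * f e)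
        = (case x of (d, e) \<Rightarrow> of_int (mobius_mu (q div d)) * f e)"
      using de by simp
  next
    fix x assume x: "x \<in> (SIGMA e:{e. e dvd q}. {k. k dvd q div e})"
    obtain e k where ek: "x = (e, k)" by (cases x)
    obtain a where ab: "q = e * a" using x ek by auto
    have pos: "a > 0" "e > 0" using ab q by (auto intro: Nat.gr0I)
    obtain b where b: "a = k * b" using x ek ab pos by auto
    have pos': "k > 0" "b > 0" using b pos by (auto intro: Nat.gr0I)
    have eq: "q div k = e * b" using ab b pos' by simp
    show "(case case x of (e, k) \<Rightarrow> (q div k, e) of (d, e) \<Rightarrow> (e, q div d)) = x"
      using ek ab b pos pos' by (simp add: eq)
    show "(case x of (e, k) \<Rightarrow> (q div k, e)) \<in> (SIGMA d:{d. d dvd q}. {e. e dvd d})"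
      using ek ab b pos pos' by (simp add: eq)
  qed
  also have "\<dots> = (\<Sum>e | e dvd q. \<Sum>k | k dvd q div e. of_int (mobius_mu k) * f e)"
    using q by (subst sum.Sigma) (auto intro!: finite_divisors_nat intro: Nat.gr0I)
  also have "\<dots> = (\<Sum>e | e dvd q. of_int (\<Sum>k | k dvd q div e. mobius_mu k) * f e)"
    by (simp add: sum_distrib_right)
  also have "\<dots> = (\<Sum>e | e dvd q. if e = q then f e else 0)"
  proof (intro sum.cong refl)
    fix e assume "e \<in> {e. e dvd q}"
    then obtain a where a: "q = e * a" by auto
    have pos: "a > 0" "e > 0" using a q by (auto intro: Nat.gr0I)
    then show "of_int (\<Sum>k | k dvd q div e. mobius_mu k) * f e = (if e = q then f e else 0)"
      using sum_mobius_mu_divisors[of a] a by auto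
  qed
  also have "\<dots> = f q" using q by simp
  finally show ?thesis by simp
qed

lemma finite_power_dvd:
  fixes n \<beta> :: nat
  assumes \<beta>: "\<beta> \<ge> 1" and n: "n \<ge> 1"
  shows "finite {d. d ^ \<beta> dvd n}"
proof (rule finite_subset)
  show "{d. d ^ \<beta> dvd n} \<subseteq> {..n}"
  proof
    fix d assume "d \<in> {d. d ^ \<beta> dvd n}"
    then have "d ^ \<beta> \<le> n" using n by (auto dest: dvd_imp_le)
    moreover have "d \<le> d ^ \<beta>" using \<beta> by (cases "d = 0") (simp_all add: self_le_power)
    ultimately show "d \<in> {..n}" by simp
  qed
qed simp

text \<open>After Moebius inversion only those divisors \<open>d\<close> of \<open>q\<close>
  contribute for which \<open>d ^ \<beta>\<close> divides \<open>n\<close>. There are finitely many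
  such \<open>d\<close> altogether, so the bound does not depend on \<open>q\<close>.\<close>

lemma cq_bounded:
  assumes \<beta>: "\<beta> \<ge> 1" and n: "n \<ge> 1"
  obtains C where "C \<ge> 0" "\<And>q. q \<ge> 1 \<Longrightarrow> norm (cq \<beta> q n) \<le> C"
proof
  let ?g = "\<lambda>q. (if q ^ \<beta> dvd n then of_nat (q ^ \<beta>) else 0 :: complex)"
  have fin: "finite {d. d ^ \<beta> dvd n}" by (rule finite_power_dvd[OF \<beta> n])
  show "0 \<le> (\<Sum>d | d ^ \<beta> dvd n. real (d ^ \<beta>))" by (simp add: sum_nonneg)
  fix q :: nat assume q: "q \<ge> 1"
  have "cq \<beta> q n = (\<Sum>d | d dvd q. of_int (mobius_mu (q div d)) * ?g d)"
    by (rule mobius_inversion[OF sum_cq_divisors[OF \<beta>] q])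
  also have "norm \<dots> \<le> (\<Sum>d | d dvd q. norm (?g d))"
  proof (rule sum_norm_le)
    fix d
    have "norm (of_int (mobius_mu (q div d)) :: complex) \<le> 1"
      using abs_mobius_mu_le_1[of "q div d"] by (simp only: norm_of_int of_int_le_1_iff flip: of_int_abs)
    then show "norm (of_int (mobius_mu (q div d)) * ?g d) \<le> norm (?g d)"
      unfolding norm_mult by (rule mult_left_le_one_le[OF norm_ge_zero norm_ge_zero])
  qed
  also have "\<dots> = (\<Sum>d\<in>{d. d dvd q} \<inter> {d. d ^ \<beta> dvd n}. real (d ^ \<beta>))"
  proof (subst sum.inter_restrict)
    show "finite {d. d dvd q}" using q by simp
    show "(\<Sum>d | d dvd q. norm (?g d)) = (\<Sum>d | d dvd q. if d \<in> {d. d ^ \<beta> dvd n} then real (d ^ \<beta>) else 0)"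
      by (rule sum.cong) (simp_all add: norm_power)
  qed
  also have "\<dots> \<le> (\<Sum>d | d ^ \<beta> dvd n. real (d ^ \<beta>))"
    by (rule sum_mono2) (use fin in auto)
  finally show "norm (cq \<beta> q n) \<le> (\<Sum>d | d ^ \<beta> dvd n. real (d ^ \<beta>))" .
qed

text \<open>Stated for the sum \<open>A\<close> of the series rather than for \<open>zeta\<close>,
  whose defining description is resolved only after the functional equation.\<close>

lemma zeta_series_mult_mobius_mu:
  assumes s: "Re s > 1" and A: "((\<lambda>k. 1 * of_nat k powr - s) has_sum (A::complex)) {1..}"
  shows "A * (\<Sum>\<^sub>\<infinity>k\<in>{1..}. of_int (mobius_mu k) * of_nat k powr - s) = 1"
proof -
  let ?B = "\<Sum>\<^sub>\<infinity>k\<in>{1..}. of_int (mobius_mu k) * of_nat k powr - s :: complex"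
  have "norm (of_int (mobius_mu k) :: complex) \<le> 1" for k
    using abs_mobius_mu_le_1[of k] by (simp only: norm_of_int of_int_le_1_iff flip: of_int_abs)
  then have B: "((\<lambda>k. of_int (mobius_mu k) * of_nat k powr - s) has_sum ?B) {1..}"
    by (rule has_sum_infsum[OF Infinite_Sum.abs_summable_summable[OF summable_on_bounded_dirichlet[OF s]]])
  have "((\<lambda>k. (\<Sum>d | d dvd k. of_int (mobius_mu d) * 1) * of_nat k powr - s) has_sum ?B * A) {1..}"
    by (rule has_sum_dirichlet_product[OF B A])
  also have "?this \<longleftrightarrow> ((\<lambda>k. if k = 1 then 1 else (0::complex)) has_sum ?B * A) {1::nat..}"
  proof (rule has_sum_cong)
    fix k :: nat assume "k \<in> {1..}"
    then show "(\<Sum>d | d dvd k. of_int (mobius_mu d) * 1) * of_nat k powr - s = (if k = 1 then 1 else (0::complex))"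
      using sum_mobius_mu_divisors[of k] by (auto simp flip: of_int_sum)
  qed
  finally have "((\<lambda>k. if k = 1 then 1 else (0::complex)) has_sum ?B * A) {1::nat..}" .
  moreover have "((\<lambda>k. if k = 1 then 1 else (0::complex)) has_sum 1) {1::nat..}"
    using has_sum_finite_neutralI[of "{1::nat}" "{1..}" "\<lambda>k. if k = 1 then 1 else (0::complex)" 1] by simp
  ultimately have "?B * A = 1" by (rule has_sum_unique)
  then show ?thesis by (simp add: mult.commute)
qed

text \<open>By \<open>sum_cq_divisors\<close> the convolution of \<open>cq\<close> with the constant
  1 is supported on the finitely many \<open>k\<close> with \<open>k ^ \<beta>\<close> dividing
  \<open>n\<close>, where it equals \<open>k ^ \<beta>\<close>. So the product of the two series is
  a finite Dirichlet polynomial, and this is \<open>sigmab\<close>.\<close>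

lemma zeta_series_mult_cq:
  assumes s: "Re s > 1" and A: "((\<lambda>k. 1 * of_nat k powr - s) has_sum (A::complex)) {1..}"
    and \<beta>: "\<beta> \<ge> 1" and n: "n \<ge> 1"
  shows "A * (\<Sum>\<^sub>\<infinity>k\<in>{1..}. cq \<beta> k n * of_nat k powr - s) = sigmab \<beta> (1 - s / of_nat \<beta>) n"
proof -
  let ?B = "\<Sum>\<^sub>\<infinity>k\<in>{1..}. cq \<beta> k n * of_nat k powr - s"
  obtain C where C: "C \<ge> 0" "\<And>q. q \<ge> 1 \<Longrightarrow> norm (cq \<beta> q n) \<le> C"
    using cq_bounded[OF \<beta> n] by blast
  have B: "((\<lambda>k. cq \<beta> k n * of_nat k powr - s) has_sum ?B) {1..}"
    by (rule has_sum_infsum[OF Infinite_Sum.abs_summable_summable[OF summable_on_bounded_dirichlet[OF s C(2)]]])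
  have "((\<lambda>k. (\<Sum>d | d dvd k. cq \<beta> d n * 1) * of_nat k powr - s) has_sum ?B * A) {1..}"
    by (rule has_sum_dirichlet_product[OF B A])
  also have "?this \<longleftrightarrow> ((\<lambda>k. (if k ^ \<beta> dvd n then of_nat (k ^ \<beta>) else 0) * of_nat k powr - s) has_sum ?B * A) {1..}"
    by (rule has_sum_cong) (use sum_cq_divisors[OF \<beta>] in auto)
  finally have 1: "((\<lambda>k. (if k ^ \<beta> dvd n then of_nat (k ^ \<beta>) else 0) * of_nat k powr - s) has_sum ?B * A) {1..}" .
  let ?D = "{d. 1 \<le> d \<and> d ^ \<beta> dvd n}"
  have fin: "finite ?D"
    by (rule finite_subset[OF _ finite_power_dvd[OF \<beta> n]]) auto
  have eq: "(of_nat k :: complex) powr (of_nat \<beta> * (1 - s / of_nat \<beta>)) = of_nat (k ^ \<beta>) * of_nat k powr - s"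
    if "k \<ge> 1" for k
  proof -
    have "of_nat \<beta> * (1 - s / of_nat \<beta>) = of_nat \<beta> + - s" using \<beta> by (simp add: field_simps)
    then have "(of_nat k :: complex) powr (of_nat \<beta> * (1 - s / of_nat \<beta>)) = of_nat k powr of_nat \<beta> * of_nat k powr - s"
      by (simp only: powr_add)
    then show ?thesis using that by (simp add: powr_nat')
  qed
  have "((\<lambda>k. (if k ^ \<beta> dvd n then of_nat (k ^ \<beta>) else 0) * of_nat k powr - s)
     has_sum sigmab \<beta> (1 - s / of_nat \<beta>) n) {1..}"
  proof (rule has_sum_finite_neutralI[of ?D])
    show "sigmab \<beta> (1 - s / of_nat \<beta>) n
       = (\<Sum>k\<in>?D. (if k ^ \<beta> dvd n then of_nat (k ^ \<beta>) else 0) * of_nat k powr - s)"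
      unfolding sigmab_def using eq by (intro sum.cong) auto
  qed (use fin in auto)
  then have "?B * A = sigmab \<beta> (1 - s / of_nat \<beta>) n" by (rule has_sum_unique[OF 1])
  then show ?thesis by (simp add: mult.commute)
qed

section \<open>Continuation of zeta by the trapezoidal rule\<close>

lemma holomorphic_on_suminf_local:
  fixes f :: "nat \<Rightarrow> complex \<Rightarrow> complex"
  assumes S: "open S" and hol: "\<And>k. f k holomorphic_on S"
    and bd: "\<And>x. x \<in> S \<Longrightarrow> \<exists>d>0. \<exists>M. cball x d \<subseteq> S \<and> summable M \<and> (\<forall>k. \<forall>y\<in>cball x d. norm (f k y) \<le> M k)"
  shows "(\<lambda>s. \<Sum>k. f k s) holomorphic_on S"
proof (rule holomorphic_uniform_sequence[OF S])
  show "(\<lambda>s. \<Sum>k<n. f k s) holomorphic_on S" for n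
    by (intro holomorphic_intros hol)
  fix x assume "x \<in> S"
  then obtain d M where d: "d > 0" "cball x d \<subseteq> S" "summable M"
    and M: "\<And>k y. y \<in> cball x d \<Longrightarrow> norm (f k y) \<le> M k" using bd by meson
  have "uniform_limit (cball x d) (\<lambda>n s. \<Sum>k<n. f k s) (\<lambda>s. \<Sum>k. f k s) sequentially"
    by (rule Weierstrass_m_test[OF M d(3)])
  then show "\<exists>d>0. cball x d \<subseteq> S \<and> uniform_limit (cball x d) (\<lambda>n s. \<Sum>k<n. f k s) (\<lambda>s. \<Sum>k. f k s) sequentially"
    using d by blast
qed

lemma norm_increment_le:
  fixes f :: "real \<Rightarrow> complex"
  assumes "a \<le> b"
    and der: "\<And>x. a \<le> x \<Longrightarrow> x \<le> b \<Longrightarrow> (f has_vector_derivative f' x) (at x)"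
    and bd: "\<And>x. a \<le> x \<Longrightarrow> x \<le> b \<Longrightarrow> norm (f' x) \<le> B"
  shows "norm (f b - f a) \<le> B * (b - a)"
proof (cases "a = b")
  case False
  then have ab: "a < b" using assms by simp
  have "\<exists>x\<in>{a<..<b}. norm (f b - f a) \<le> norm ((b - a) *\<^sub>R f' x)"
  proof (rule mvt_general[OF ab])
    show "continuous_on {a..b} f"
    proof (rule continuous_at_imp_continuous_on, rule ballI)
      fix x assume "x \<in> {a..b}"
      then show "isCont f x" using has_vector_derivative_continuous[OF der[of x]] by simp
    qed
    show "\<And>x. \<lbrakk>a < x; x < b\<rbrakk> \<Longrightarrow> (f has_derivative (\<lambda>t. t *\<^sub>R f' x)) (at x)"
      using der by (simp add: has_vector_derivative_def)
  qed
  then obtain x where x: "a < x" "x < b" "norm (f b - f a) \<le> (b - a) * norm (f' x)"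
    using ab by auto
  note x(3)
  also have "(b - a) * norm (f' x) \<le> (b - a) * B"
    using bd[of x] x ab by (intro mult_left_mono) auto
  finally show ?thesis by (simp only: mult.commute)
qed simp

text \<open>The error of the trapezoidal rule for the function \<open>t powr - s\<close> on the
  interval from \<open>n\<close> to \<open>n + 1\<close>, multiplied by \<open>s - 1\<close> to
  clear the denominator of the integral.\<close>

definition trapezoid_term :: "nat \<Rightarrow> complex \<Rightarrow> complex" where
  "trapezoid_term n s = (s - 1) * (of_nat n powr - s + of_nat (Suc n) powr - s) / 2
     - (of_nat n powr (1 - s) - of_nat (Suc n) powr (1 - s))"

text \<open>The length \<open>x\<close> of the interval grows from 0 to 1. The error
  \<open>h\<close> and its derivative \<open>h1\<close> vanish at \<open>x = 0\<close>, and the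
  second derivative \<open>h2\<close> has gained two powers of \<open>n\<close>; two applications of
  the mean value inequality finish. The exponent \<open>- Re s - 2\<close> is summable exactly for
  \<open>Re s > -1\<close>, which fixes the half plane of \<open>zeta_reg\<close>.\<close>

lemma norm_trapezoid_term_le:
  assumes n: "n \<ge> 1" and s: "Re s > - 1"
  shows "norm (trapezoid_term n s) \<le> (norm s + 1) ^ 3 * real n powr (- Re s - 2)"
proof -
  define N where "N = (of_nat n :: complex)"
  define h where "h = (\<lambda>x. (s - 1) * (N powr - s + (N + x) powr - s) * x / 2 - (N powr (1 - s) - (N + x) powr (1 - s)))"
  define h1 where "h1 = (\<lambda>x. (s - 1) * (N powr - s + (N + x) powr - s) / 2
      - (s - 1) * s * x / 2 * (N + x) powr (- s - 1) - (s - 1) * (N + x) powr - s)"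
  define h2 where "h2 = (\<lambda>x. (s - 1) * s * (s + 1) * x / 2 * (N + x) powr (- 2 - s))"
  define B where "B = (norm s + 1) ^ 3 * real n powr (- Re s - 2)"
  have nonpos: "N + of_real x \<notin> \<real>\<^sub>\<le>\<^sub>0" if "0 \<le> x" for x :: real
    using n that by (auto simp: N_def complex_nonpos_Reals_iff)
  have d1: "((\<lambda>x. h (of_real x)) has_vector_derivative h1 (of_real x)) (at x)" if x: "0 \<le> x" for x :: real
  proof (rule has_vector_derivative_real_field)
    have "(N + of_real x) powr (1 - s - 1) = (N + of_real x) powr - s" by simp
    then show "(h has_field_derivative h1 (of_real x)) (at (of_real x))"
      unfolding h_def h1_def
      by (auto intro!: derivative_eq_intros nonpos[OF x]) (simp add: field_simps)
  qed
  have d2: "((\<lambda>x. h1 (of_real x)) has_vector_derivative h2 (of_real x)) (at x)" if x: "0 \<le> x" for x :: real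
  proof (rule has_vector_derivative_real_field)
    show "(h1 has_field_derivative h2 (of_real x)) (at (of_real x))"
      unfolding h1_def h2_def
      by (auto intro!: derivative_eq_intros nonpos[OF x]) (simp add: field_simps)
  qed
  have b2: "norm (h2 (of_real x)) \<le> B" if x: "0 \<le> x" "x \<le> 1" for x :: real
  proof -
    have 1: "norm ((N + of_real x) powr (- 2 - s)) = (real n + x) powr (- Re s - 2)"
    proof -
      have "N + of_real x = of_real (real n + x)" by (simp add: N_def)
      then have "norm ((N + of_real x) powr (- 2 - s)) = (real n + x) powr (- 2 - Re s)"
        using n x by (simp add: norm_powr_real_powr)
      also have "- 2 - Re s = - Re s - 2" by simp
      finally show ?thesis .
    qed
    have 2: "(real n + x) powr (- Re s - 2) \<le> real n powr (- Re s - 2)"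
      using n x s by (intro powr_mono2') auto
    have a: "norm (s - 1) \<le> norm s + 1" "norm (s + 1) \<le> norm s + 1" "norm s \<le> norm s + 1"
      using norm_triangle_ineq4[of s 1] norm_triangle_ineq[of s 1] by simp_all
    have "norm (s - 1) * norm s * norm (s + 1) \<le> (norm s + 1) * (norm s + 1) * (norm s + 1)"
      by (intro mult_mono a) auto
    then have 3: "norm (s - 1) * norm s * norm (s + 1) \<le> (norm s + 1) ^ 3" by (simp add: power3_eq_cube)
    have "norm (h2 (of_real x)) = norm (s - 1) * norm s * norm (s + 1) * (x / 2) * (real n + x) powr (- Re s - 2)"
      unfolding h2_def using x by (simp add: norm_mult norm_divide 1)
    also have "\<dots> \<le> (norm s + 1) ^ 3 * 1 * real n powr (- Re s - 2)"
      by (intro mult_mono 2 3) (use x in auto)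
    finally show ?thesis by (simp add: B_def)
  qed
  have h0: "h 0 = 0" "h1 0 = 0" by (simp_all add: h_def h1_def)
  have B0: "B \<ge> 0" by (simp add: B_def)
  have b1: "norm (h1 (of_real x)) \<le> B" if x: "0 \<le> x" "x \<le> 1" for x :: real
  proof -
    have "norm (h1 (of_real x) - h1 (of_real 0)) \<le> B * (x - 0)"
      by (rule norm_increment_le[OF x(1) d2 b2]) (use x in auto)
    also have "\<dots> \<le> B * 1" using x B0 by (intro mult_left_mono) auto
    finally show ?thesis using h0 by simp
  qed
  have "norm (h (of_real 1) - h (of_real 0)) \<le> B * (1 - 0)"
    by (rule norm_increment_le[OF _ d1 b1]) auto
  moreover have "h 1 = trapezoid_term n s"
    by (simp add: h_def trapezoid_term_def N_def add.commute)
  ultimately show ?thesis using h0 by (simp add: B_def)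
qed

lemma summable_Suc_powr: "a < - 1 \<Longrightarrow> summable (\<lambda>k. real (Suc k) powr a)"
  by (subst summable_Suc_iff) (simp add: summable_real_powr_iff)

lemma summable_trapezoid_term:
  assumes s: "Re s > - 1"
  shows "summable (\<lambda>k. trapezoid_term (Suc k) s)"
proof (rule summable_comparison_test')
  show "summable (\<lambda>k. (norm s + 1) ^ 3 * real (Suc k) powr (- Re s - 2))"
    by (intro summable_mult summable_Suc_powr) (use s in auto)
  show "norm (trapezoid_term (Suc k) s) \<le> (norm s + 1) ^ 3 * real (Suc k) powr (- Re s - 2)" for k
    by (rule norm_trapezoid_term_le[OF _ s]) simp
qed

text \<open>By the trapezoidal rule, this is \<open>(s - 1) \<zeta>(s)\<close> for \<open>Re s > -1\<close>.\<close>
definition zeta_reg :: "complex \<Rightarrow> complex" where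
  "zeta_reg s = 1 + (s - 1) / 2 + (\<Sum>k. trapezoid_term (Suc k) s)"

lemma holomorphic_trapezoid_term: "trapezoid_term (Suc n) holomorphic_on A"
  unfolding trapezoid_term_def by (intro holomorphic_intros) (auto simp: complex_nonpos_Reals_iff)

lemma open_Re_gt_minus_1: "open {s. Re s > - 1}"
  by (rule open_halfspace_Re_gt)

lemma holomorphic_zeta_reg: "zeta_reg holomorphic_on {s. Re s > - 1}"
proof -
  have "(\<lambda>s. \<Sum>k. trapezoid_term (Suc k) s) holomorphic_on {s. Re s > - 1}"
  proof (rule holomorphic_on_suminf_local[OF open_Re_gt_minus_1 holomorphic_trapezoid_term])
    fix x assume "x \<in> {s. Re s > - 1}"
    then have x: "Re x > - 1" by simp
    define d where "d = (Re x + 1) / 2"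
    let ?M = "\<lambda>k. (norm x + d + 1) ^ 3 * real (Suc k) powr (- (Re x - d) - 2)"
    have d: "d > 0" "Re x - d > - 1" using x by (auto simp: d_def field_simps)
    have Re: "Re y \<ge> Re x - d" "norm y \<le> norm x + d" if "y \<in> cball x d" for y
    proof -
      have "\<bar>Re (x - y)\<bar> \<le> norm (x - y)" by (rule abs_Re_le_cmod)
      then show "Re y \<ge> Re x - d" using that by (auto simp: dist_norm)
      show "norm y \<le> norm x + d"
        using that norm_triangle_ineq2[of y x] by (auto simp: dist_norm norm_minus_commute)
    qed
    have "summable ?M" by (intro summable_mult summable_Suc_powr) (use d in auto)
    moreover have "norm (trapezoid_term (Suc k) y) \<le> ?M k" if y: "y \<in> cball x d" for k y
    proof -
      have "norm (trapezoid_term (Suc k) y) \<le> (norm y + 1) ^ 3 * real (Suc k) powr (- Re y - 2)"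
        by (rule norm_trapezoid_term_le) (use Re[OF y] d in auto)
      also have "\<dots> \<le> ?M k"
        by (intro mult_mono power_mono powr_mono) (use Re[OF y] d in auto)
      finally show ?thesis .
    qed
    moreover have "cball x d \<subseteq> {s. Re s > - 1}" using Re d by fastforce
    ultimately show "\<exists>d>0. \<exists>M. cball x d \<subseteq> {s. Re s > - 1} \<and> summable M \<and>
        (\<forall>k. \<forall>y\<in>cball x d. norm (trapezoid_term (Suc k) y) \<le> M k)"
      using d(1) by blast
  qed
  then show ?thesis unfolding zeta_reg_def by (intro holomorphic_intros) auto
qed

lemma tendsto_Suc_powr_zero:
  assumes "Re w < 0"
  shows "(\<lambda>k. of_nat (Suc k) powr w :: complex) \<longlonglongrightarrow> 0"
proof (rule tendsto_norm_zero_cancel)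
  have "(\<lambda>k. real (Suc k) powr Re w) \<longlonglongrightarrow> 0"
    using assms by (intro tendsto_neg_powr filterlim_compose[OF filterlim_real_sequentially filterlim_Suc])
  then show "(\<lambda>k. norm (of_nat (Suc k) powr w :: complex)) \<longlonglongrightarrow> 0"
    by (simp add: norm_powr_real_powr del: of_nat_Suc)
qed

lemma summable_norm_Suc_powr:
  assumes "Re s > 1"
  shows "summable (\<lambda>k. norm (of_nat (Suc k) powr - s :: complex))"
  using summable_Suc_powr[of "- Re s"] assms by (simp add: norm_powr_real_powr del: of_nat_Suc)

text \<open>The integrals telescope to -1, which the leading 1 in \<open>zeta_reg\<close> cancels;
  the averages give the whole series except half of its first term, which \<open>(s - 1) / 2\<close>
  restores.\<close>

lemma zeta_reg_eq_dirichlet_series: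
  assumes s: "Re s > 1"
  shows "zeta_reg s = (s - 1) * (\<Sum>k. of_nat (Suc k) powr - s)"
proof -
  let ?a = "\<lambda>k. of_nat (Suc k) powr - s :: complex"
  have sm: "summable ?a" by (rule summable_norm_cancel[OF summable_norm_Suc_powr[OF s]])
  have S: "?a sums suminf ?a" using sm by (rule summable_sums)
  have S': "(\<lambda>k. ?a (Suc k)) sums (suminf ?a - 1)"
    using sums_Suc_iff[of ?a "suminf ?a - 1"] S by simp
  have T: "(\<lambda>k. of_nat (Suc (Suc k)) powr (1 - s) - of_nat (Suc k) powr (1 - s)) sums (0 - of_nat (Suc 0) powr (1 - s) :: complex)"
    by (intro telescope_sums tendsto_Suc_powr_zero) (use s in auto)
  have "(\<lambda>k. (s - 1) / 2 * (?a k + ?a (Suc k)) + (of_nat (Suc (Suc k)) powr (1 - s) - of_nat (Suc k) powr (1 - s)))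
     sums ((s - 1) / 2 * (suminf ?a + (suminf ?a - 1)) + (0 - of_nat (Suc 0) powr (1 - s)))"
    by (intro sums_add sums_mult S S' T)
  also have "(\<lambda>k. (s - 1) / 2 * (?a k + ?a (Suc k)) + (of_nat (Suc (Suc k)) powr (1 - s) - of_nat (Suc k) powr (1 - s)))
     = (\<lambda>k. trapezoid_term (Suc k) s)"
    by (simp add: trapezoid_term_def fun_eq_iff)
  finally have "(\<Sum>k. trapezoid_term (Suc k) s) = (s - 1) / 2 * (suminf ?a + (suminf ?a - 1)) - 1"
    by (simp add: sums_iff)
  then show ?thesis by (simp add: zeta_reg_def field_simps)
qed

lemma zeta_reg_1: "zeta_reg 1 = 1"
  by (simp add: zeta_reg_def trapezoid_term_def del: of_nat_Suc)

lemma zeta_reg_0: "zeta_reg 0 = 1 / 2"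
proof -
  have "trapezoid_term (Suc k) 0 = 0" for k
    by (simp add: trapezoid_term_def del: of_nat_Suc) simp
  then show ?thesis by (simp add: zeta_reg_def)
qed

lemma of_nat_powr_of_real: "(of_nat (Suc n) :: complex) powr of_real x = of_real (real (Suc n) powr x)"
  by (metis of_nat_0_le_iff of_real_of_nat_eq powr_of_real)

text \<open>Since \<open>t powr - x\<close> decreases, its integral over a unit interval is at least
  its value at the right end, so each trapezoidal term is at least \<open>- (1 - x) / 2\<close>
  times the drop of \<open>t powr - x\<close>. The drops add up to 1, and this leaves the lower
  bound \<open>1 + (x - 1) / 2 - (1 - x) / 2 = x > 0\<close>.\<close>

lemma zeta_reg_real_nonzero:
  fixes x :: real
  assumes x: "0 < x" "x < 1"
  shows "zeta_reg (of_real x) \<noteq> 0"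
proof -
  let ?u = "\<lambda>k. (x - 1) * (real (Suc k) powr - x + real (Suc (Suc k)) powr - x) / 2
    - (real (Suc k) powr (1 - x) - real (Suc (Suc k)) powr (1 - x))"
  have u: "trapezoid_term (Suc k) (of_real x) = of_real (?u k)" for k
    using of_nat_powr_of_real[of k "- x"] of_nat_powr_of_real[of "Suc k" "- x"]
      of_nat_powr_of_real[of k "1 - x"] of_nat_powr_of_real[of "Suc k" "1 - x"]
    by (simp add: trapezoid_term_def del: of_nat_Suc)
  have smu: "summable ?u"
    using summable_trapezoid_term[of "of_real x"] x unfolding u by (simp add: summable_of_real_iff del: of_nat_Suc of_real_diff of_real_mult of_real_divide)
  have le: "- (1 - x) / 2 * (real (Suc k) powr - x - real (Suc (Suc k)) powr - x) \<le> ?u k" for k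
  proof -
    have "\<exists>z>real (Suc k). z < real (Suc (Suc k)) \<and>
        real (Suc (Suc k)) powr (1 - x) - real (Suc k) powr (1 - x)
          = (real (Suc (Suc k)) - real (Suc k)) * ((1 - x) * z powr - x)"
    proof (rule MVT2)
      fix z assume "real (Suc k) \<le> z" "z \<le> real (Suc (Suc k))"
      then have "z > 0" by linarith
      then show "((\<lambda>z. z powr (1 - x)) has_real_derivative (1 - x) * z powr - x) (at z)"
        using has_real_derivative_powr[of z "1 - x"] by simp
    qed simp
    then obtain z where z: "real (Suc k) < z" "z < real (Suc (Suc k))"
      and eq: "real (Suc (Suc k)) powr (1 - x) - real (Suc k) powr (1 - x) = (1 - x) * z powr - x"
      by auto
    have "real (Suc (Suc k)) powr - x \<le> z powr - x"
      using z x by (intro powr_mono2') auto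
    then have "(1 - x) * real (Suc (Suc k)) powr - x \<le> real (Suc (Suc k)) powr (1 - x) - real (Suc k) powr (1 - x)"
      unfolding eq using x by (intro mult_left_mono) auto
    moreover have "- (1 - x) / 2 * (real (Suc k) powr - x - real (Suc (Suc k)) powr - x)
      = (x - 1) * (real (Suc k) powr - x + real (Suc (Suc k)) powr - x) / 2 + (1 - x) * real (Suc (Suc k)) powr - x"
      by (simp add: field_simps del: of_nat_Suc)
    ultimately show ?thesis by linarith
  qed
  have "(\<lambda>k. real (Suc (Suc k)) powr - x - real (Suc k) powr - x) sums (0 - real (Suc 0) powr - x)"
    by (intro telescope_sums tendsto_neg_powr filterlim_compose[OF filterlim_real_sequentially filterlim_Suc]) (use x in auto)
  then have "(\<lambda>k. (1 - x) / 2 * (real (Suc (Suc k)) powr - x - real (Suc k) powr - x)) sums ((1 - x) / 2 * (0 - real (Suc 0) powr - x))"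
    by (rule sums_mult)
  also have "(\<lambda>k. (1 - x) / 2 * (real (Suc (Suc k)) powr - x - real (Suc k) powr - x))
    = (\<lambda>k. - (1 - x) / 2 * (real (Suc k) powr - x - real (Suc (Suc k)) powr - x))"
    by (rule ext) (simp add: field_simps del: of_nat_Suc)
  also have "(1 - x) / 2 * (0 - real (Suc 0) powr - x) = - (1 - x) / 2" by (simp add: field_simps)
  finally have "(\<lambda>k. - (1 - x) / 2 * (real (Suc k) powr - x - real (Suc (Suc k)) powr - x)) sums (- (1 - x) / 2)" .
  then have "- (1 - x) / 2 \<le> suminf ?u" (is "_ \<le> ?U")
    by (intro sums_le[OF le _ summable_sums[OF smu]])
  note lower = this
  have "0 < 1 + (x - 1) / 2 + U" if "- (1 - x) / 2 \<le> U" for U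
    using that x by (simp add: field_simps)
  from this[OF lower] have nz: "1 + (x - 1) / 2 + ?U \<noteq> 0" by (rule less_imp_neq[THEN not_sym])
  have "zeta_reg (of_real x) = of_real (1 + (x - 1) / 2 + ?U)"
    by (simp only: zeta_reg_def u suminf_of_real[OF smu, symmetric]) simp
  then show ?thesis using nz by (simp only: of_real_eq_0_iff not_False_eq_True)
qed

section \<open>The functional equation\<close>

lemma nn_integral_Gamma_scaled:
  fixes a y :: real
  assumes a: "a > 0" and y: "y > 0"
  shows "(\<integral>\<^sup>+x\<in>{0<..}. ennreal (x powr (a - 1) * exp (- (x * y))) \<partial>lborel) = ennreal (Gamma a * y powr - a)"
proof -
  let ?f = "\<lambda>t::real. ennreal (indicator {0..} t * t powr (a - 1) / exp t)"
  have [measurable]: "?f \<in> borel_measurable borel" by measurable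
  have eq: "ennreal (x powr (a - 1) * exp (- (x * y))) * indicator {0<..} x
      = ennreal (y powr - a) * (ennreal y * ?f (0 + y * x))" for x
  proof (cases "x > 0")
    case True
    have "y powr - a * (y * (y powr (a - 1) * x powr (a - 1) * exp (- (x * y)))) 
        = (y powr - a * y powr 1 * y powr (a - 1)) * (x powr (a - 1) * exp (- (x * y)))"
      using y by simp
    also have "y powr - a * y powr 1 * y powr (a - 1) = y powr (- a + 1 + (a - 1))"
      by (simp only: powr_add)
    also have "\<dots> = 1" using y by simp
    finally show ?thesis
      using True y by (simp add: powr_mult exp_minus field_simps flip: ennreal_mult)
  next
    case False
    then have "x = 0 \<or> y * x < 0" using y by (auto simp: mult_less_0_iff)
    then show ?thesis using False by auto
  qed
  have "(\<integral>\<^sup>+x\<in>{0<..}. ennreal (x powr (a - 1) * exp (- (x * y))) \<partial>lborel)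
      = ennreal (y powr - a) * (ennreal y * (\<integral>\<^sup>+x. ?f (0 + y * x) \<partial>lborel))"
    unfolding eq by (subst nn_integral_cmult, simp)+ simp
  also have "ennreal y * (\<integral>\<^sup>+x. ?f (0 + y * x) \<partial>lborel) = (\<integral>\<^sup>+x. ?f x \<partial>lborel)"
    using nn_integral_real_affine[of ?f y 0] y by simp
  also have "\<dots> = ennreal (Gamma a)" using Gamma_conv_nn_integral_real[OF a] by simp
  finally show ?thesis using a by (simp add: ennreal_mult mult.commute Gamma_real_pos less_imp_le)
qed

text \<open>The error of the trapezoidal rule for \<open>\<lambda>t. e^(-x t)\<close> on \<open>[n, n + 1]\<close>; its Mellin transform is \<open>\<Gamma>(s)\<close>
  times the corresponding error for \<open>\<lambda>t. t^(-s)\<close>.\<close>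
definition bracket :: "nat \<Rightarrow> real \<Rightarrow> real" where
  "bracket n x = (exp (- (x * real n)) + exp (- (x * (real n + 1)))) / 2
     - (exp (- (x * real n)) - exp (- (x * (real n + 1)))) / x"

text \<open>The trapezoidal error is the integral of the Peano kernel \<open>u * (1 - u) / 2\<close>
  against the second derivative, here \<open>x ^ 2 * exp (- x t)\<close>. This form shows that it is
  nonnegative.\<close>

lemma has_integral_bracket:
  assumes x: "x > 0"
  shows "((\<lambda>u. u * (1 - u) / 2 * x ^ 2 * exp (- (x * (real n + u)))) has_integral bracket n x) {0..1}"
proof -
  define F where "F u = exp (- (x * (real n + u))) * (- (u * (1 - u) / 2 * x) - (1 - 2 * u) / 2 + 1 / x)" for u
  have "((\<lambda>u. u * (1 - u) / 2 * x ^ 2 * exp (- (x * (real n + u)))) has_integral (F 1 - F 0)) {0..1}"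
  proof (rule fundamental_theorem_of_calculus)
    fix u :: real
    have "(F has_real_derivative u * (1 - u) / 2 * x ^ 2 * exp (- (x * (real n + u)))) (at u within {0..1})"
      unfolding F_def using x
      by (auto intro!: derivative_eq_intros simp: field_simps power2_eq_square)
    then show "(F has_vector_derivative u * (1 - u) / 2 * x ^ 2 * exp (- (x * (real n + u)))) (at u within {0..1})"
      by (simp add: has_real_derivative_iff_has_vector_derivative)
  qed simp
  moreover have "F 1 - F 0 = bracket n x"
    using x by (simp add: F_def bracket_def field_simps)
  ultimately show ?thesis by simp
qed

lemma bracket_nonneg:
  assumes "x > 0"
  shows "bracket n x \<ge> 0"
  by (rule has_integral_nonneg[OF has_integral_bracket[OF assms]]) auto

text \<open>The real counterpart of \<open>trapezoid_term\<close> divided by \<open>s - 1\<close>.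
  It is used for \<open>n = 0\<close> as well; the value \<open>0 powr - s = 0\<close> is the right
  boundary value there because \<open>s\<close> is negative.\<close>

definition trapezoid_real :: "nat \<Rightarrow> real \<Rightarrow> real" where
  "trapezoid_real n s = (real n powr - s + (real n + 1) powr - s) / 2
     - ((real n + 1) powr (1 - s) - real n powr (1 - s)) / (1 - s)"

text \<open>The same Peano kernel, now against the second derivative
  \<open>s * (s + 1) * t powr (- s - 2)\<close>. The factor \<open>s * (s + 1)\<close> is negative
  in this range; it is divided out so that the integrand is nonnegative.\<close>

lemma has_integral_trapezoid_real:
  assumes s: "- 1 < s" "s < 0"
  shows "((\<lambda>u. u * (1 - u) / 2 * (real n + u) powr (- s - 2)) has_integral trapezoid_real n s / (s * (s + 1))) {0..1}"
proof -
  define A B D where "A = 1 / (s + 1)" and "B = 1 / (s * (s + 1))" and "D = B / (1 - s)"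
  have a1: "(s + 1) * A = 1" and a2: "s * B = A" and a3: "(1 - s) * D = B"
    using s by (simp_all add: A_def B_def D_def)
  \<comment> \<open>The integrand is unbounded at \<open>u = 0\<close> when \<open>n = 0\<close>, so
    \<open>F\<close> is differentiated only in the interior and must be continuous up to the ends.
    Writing the product as \<open>u powr - s\<close> in that case makes this continuity
    visible.\<close>
  define F where "F u = - ((1 - u) / 2 * (if n = 0 then u powr - s else u * (real n + u) powr (- s - 1)) * A)
      - (1 - 2 * u) / 2 * (real n + u) powr - s * B - (real n + u) powr (1 - s) * D" for u
  have "((\<lambda>u. u * (1 - u) / 2 * (real n + u) powr (- s - 2)) has_integral (F 1 - F 0)) {0..1}"
  proof (rule fundamental_theorem_of_calculus_interior)
    have 1: "continuous_on {0..1} (\<lambda>u::real. if n = 0 then u powr - s else u * (real n + u) powr (- s - 1))"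
    proof (cases "n = 0")
      case True
      have "continuous_on {0..1} (\<lambda>u::real. u powr - s)"
        by (rule continuous_on_powr'[OF continuous_on_id continuous_on_const]) (use s in auto)
      then show ?thesis using True by simp
    next
      case False
      have "continuous_on {0..1} (\<lambda>u::real. u * (real n + u) powr (- s - 1))"
        by (rule continuous_on_mult[OF continuous_on_id continuous_on_powr']) (use False in \<open>auto intro: continuous_intros\<close>)
      then show ?thesis using False by simp
    qed
    show "continuous_on {0..1} F" unfolding F_def
      by (intro continuous_on_diff continuous_on_minus continuous_on_mult 1 continuous_on_powr' continuous_on_divide
           continuous_on_add continuous_on_const continuous_on_id) (use s in auto)
    fix u :: real assume u: "u \<in> {0<..<1}"
    define y where "y = real n + u"
    have y: "y > 0" using u by (simp add: y_def add_nonneg_pos)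
    define p where "p = y powr (- s - 2)"
    have e: "- s - 1 = (- s - 2) + 1" "- s = (- s - 2) + 2" by simp_all
    have p1: "y powr (- s - 1) = y * p" unfolding p_def by (subst e(1), subst powr_add) (use y in simp)
    have p2: "y powr - s = y\<^sup>2 * p" unfolding p_def by (subst e(2), subst powr_add) (use y in simp)
    define G where "G u = - ((1 - u) / 2 * (u * (real n + u) powr (- s - 1)) * A)
      - (1 - 2 * u) / 2 * (real n + u) powr - s * B - (real n + u) powr (1 - s) * D" for u
    have d: "((\<lambda>u. (real n + u) powr r) has_real_derivative r * y powr (r - 1)) (at u)" for r
      using y by (auto intro!: derivative_eq_intros simp: y_def[symmetric])
    have e': "- s - 1 - 1 = - s - 2" "1 - s - 1 = - s" by simp_all
    have "(G has_real_derivative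
       - ((- 1 / 2 * (u * (y * p)) + (1 - u) / 2 * (y * p + u * ((- s - 1) * p))) * A)
      - (- 1 * (y\<^sup>2 * p) + (1 - 2 * u) / 2 * (- s * (y * p))) * B - (1 - s) * (y\<^sup>2 * p) * D) (at u)"
      unfolding G_def
      by (rule DERIV_cong, (rule d DERIV_ident DERIV_const DERIV_diff DERIV_minus DERIV_cmult_right DERIV_cmult DERIV_mult DERIV_cdivide)+)
         (simp only: y_def[symmetric] e' p1 p2 p_def[symmetric], simp add: field_simps)
    also have "- ((- 1 / 2 * (u * (y * p)) + (1 - u) / 2 * (y * p + u * ((- s - 1) * p))) * A)
      - (- 1 * (y\<^sup>2 * p) + (1 - 2 * u) / 2 * (- s * (y * p))) * B - (1 - s) * (y\<^sup>2 * p) * D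
      = u * (1 - u) / 2 * p * ((s + 1) * A) + (u - 1 / 2) * (y * p) * A + (1 - 2 * u) / 2 * (y * p) * (s * B)
        + y\<^sup>2 * p * B - y\<^sup>2 * p * ((1 - s) * D)"
      by (simp add: field_simps)
    also have "\<dots> = u * (1 - u) / 2 * p"
      unfolding a1 a2 a3 by (simp add: field_simps)
    finally have "(G has_real_derivative u * (1 - u) / 2 * p) (at u)" .
    moreover have "\<forall>\<^sub>F v in nhds u. G v = F v"
    proof -
      have "\<forall>\<^sub>F v in nhds u. v \<in> {0<..}" using u by (intro eventually_nhds_in_open) auto
      then show ?thesis
      proof eventually_elim
        case (elim v)
        have "v * v powr (- s - 1) = v powr (1 + (- s - 1))" using elim by (simp only: powr_add) simp
        then show ?case by (simp add: F_def G_def)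
      qed
    qed
    ultimately have "(F has_real_derivative u * (1 - u) / 2 * p) (at u)"
      using DERIV_cong_ev[of u u G F] by blast
    then show "(F has_vector_derivative u * (1 - u) / 2 * (real n + u) powr (- s - 2)) (at u)"
      by (simp add: has_real_derivative_iff_has_vector_derivative p_def y_def)
  qed simp
  moreover have "F 1 - F 0 = trapezoid_real n s * B"
    by (simp add: F_def trapezoid_real_def D_def algebra_simps add_divide_distrib diff_divide_distrib)
  ultimately show ?thesis by (simp add: B_def)
qed

lemma not_nonpos_Int:
  fixes s :: real
  assumes s: "- 1 < s" "s < 0"
  shows "s \<notin> \<int>\<^sub>\<le>\<^sub>0"
proof
  assume "s \<in> \<int>\<^sub>\<le>\<^sub>0"
  then obtain n where "s = of_int n" by (elim nonpos_Ints_cases)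
  then show False using s by auto
qed

lemma Gamma_plus_2_real:
  assumes s: "- 1 < s" "s < (0::real)"
  shows "Gamma (s + 2) = s * (s + 1) * Gamma s"
proof -
  have "s \<notin> \<int>\<^sub>\<le>\<^sub>0" using s by (rule not_nonpos_Int)
  moreover have "s + 1 \<notin> \<int>\<^sub>\<le>\<^sub>0" using s by (auto elim!: nonpos_Ints_cases)
  ultimately show ?thesis using Gamma_plus1[of s] Gamma_plus1[of "s + 1"] by (simp add: add.assoc)
qed

text \<open>With \<open>bracket\<close> written through the Peano kernel the integrand is
  nonnegative in both variables, so the integrals may be exchanged. The inner one is a Gamma
  integral, and \<open>Gamma (s + 2) = s * (s + 1) * Gamma s\<close> removes the denominator left by
  \<open>has_integral_trapezoid_real\<close>.\<close>

lemma nn_integral_powr_bracket: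
  assumes s: "- 1 < s" "s < 0"
  shows "(\<integral>\<^sup>+x\<in>{0<..}. ennreal (x powr (s - 1) * bracket n x) \<partial>lborel) = ennreal (Gamma s * trapezoid_real n s)"
proof -
  let ?w = "\<lambda>u. u * (1 - u) / 2"
  let ?h = "\<lambda>(u::real) (x::real). ennreal (?w u * x powr (s + 1) * exp (- (x * (real n + u)))) * indicator {0..1} u * indicator {0<..} x"
  have 1: "ennreal (x powr (s - 1) * bracket n x) * indicator {0<..} x = (\<integral>\<^sup>+u. ?h u x \<partial>lborel)" for x
  proof (cases "x > 0")
    case True
    have "x powr ((s - 1) + 2) = x powr (s - 1) * x powr 2" by (rule powr_add)
    moreover have "(s - 1) + 2 = s + 1" by simp
    ultimately have px: "x powr (s + 1) = x powr (s - 1) * x ^ 2" using True by simp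
    have "((\<lambda>u. x powr (s - 1) * (?w u * x ^ 2 * exp (- (x * (real n + u))))) has_integral x powr (s - 1) * bracket n x) {0..1}"
      by (rule has_integral_mult_right[OF has_integral_bracket[OF True]])
    also have "(\<lambda>u. x powr (s - 1) * (?w u * x ^ 2 * exp (- (x * (real n + u)))))
       = (\<lambda>u. ?w u * x powr (s + 1) * exp (- (x * (real n + u))))"
      unfolding px by (simp add: fun_eq_iff mult_ac)
    finally have "(\<integral>\<^sup>+u\<in>{0..1}. ennreal (?w u * x powr (s + 1) * exp (- (x * (real n + u)))) \<partial>lborel)
       = ennreal (x powr (s - 1) * bracket n x)"
      by (intro nn_integral_has_integral_lebesgue') auto
    then show ?thesis using True by simp
  qed simp
  have 2: "(\<integral>\<^sup>+x. ?h u x \<partial>lborel) = ennreal (Gamma (s + 2)) * (ennreal (?w u * (real n + u) powr (- s - 2)) * indicator {0..1} u)" for u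
  proof (cases "u \<in> {0<..1}")
    case True
    then have y: "real n + u > 0" by (simp add: add_nonneg_pos)
    have c: "?w u \<ge> 0" using True by simp
    have "(\<integral>\<^sup>+x. ?h u x \<partial>lborel)
       = (\<integral>\<^sup>+x. ennreal (?w u) * (ennreal (x powr (s + 2 - 1) * exp (- (x * (real n + u)))) * indicator {0<..} x) \<partial>lborel)"
    proof (rule nn_integral_cong)
      fix x
      have e: "s + 2 - 1 = s + 1" by simp
      show "?h u x = ennreal (?w u) * (ennreal (x powr (s + 2 - 1) * exp (- (x * (real n + u)))) * indicator {0<..} x)"
        by (simp only: e mult.assoc ennreal_mult'[OF c]) (use True in simp)
    qed
    also have "\<dots> = ennreal (?w u) * ennreal (Gamma (s + 2) * (real n + u) powr - (s + 2))"
      using s y by (subst nn_integral_cmult) (simp_all only: nn_integral_Gamma_scaled, measurable)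
    also have "\<dots> = ennreal (?w u * (Gamma (s + 2) * (real n + u) powr - (s + 2)))"
      by (rule ennreal_mult'[symmetric, OF c])
    also have "?w u * (Gamma (s + 2) * (real n + u) powr - (s + 2))
       = Gamma (s + 2) * (?w u * (real n + u) powr (- s - 2))"
      by (simp add: algebra_simps)
    also have "ennreal \<dots> = ennreal (Gamma (s + 2)) * ennreal (?w u * (real n + u) powr (- s - 2))"
      using s by (intro ennreal_mult') (simp add: Gamma_real_pos less_imp_le)
    finally show ?thesis using True by simp
  next
    case False
    then show ?thesis by (cases "u = 0") (auto simp: indicator_def)
  qed
  have "(\<integral>\<^sup>+x\<in>{0<..}. ennreal (x powr (s - 1) * bracket n x) \<partial>lborel) = (\<integral>\<^sup>+x. \<integral>\<^sup>+u. ?h u x \<partial>lborel \<partial>lborel)"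
    unfolding 1 ..
  also have "\<dots> = (\<integral>\<^sup>+u. \<integral>\<^sup>+x. ?h u x \<partial>lborel \<partial>lborel)"
    by (rule lborel_pair.Fubini') measurable
  also have "\<dots> = ennreal (Gamma (s + 2)) * (\<integral>\<^sup>+u\<in>{0..1}. ennreal (?w u * (real n + u) powr (- s - 2)) \<partial>lborel)"
    unfolding 2 by (rule nn_integral_cmult) measurable
  also have "(\<integral>\<^sup>+u\<in>{0..1}. ennreal (?w u * (real n + u) powr (- s - 2)) \<partial>lborel)
      = ennreal (trapezoid_real n s / (s * (s + 1)))"
    by (rule nn_integral_has_integral_lebesgue'[OF _ has_integral_trapezoid_real[OF s]]) auto
  also have "ennreal (Gamma (s + 2)) * \<dots> = ennreal (Gamma (s + 2) * (trapezoid_real n s / (s * (s + 1))))"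
    using s by (intro ennreal_mult'[symmetric]) (simp add: Gamma_real_pos less_imp_le)
  also have "Gamma (s + 2) * (trapezoid_real n s / (s * (s + 1))) = Gamma s * trapezoid_real n s"
    unfolding Gamma_plus_2_real[OF s] using s by simp
  finally show ?thesis .
qed

lemma bracket_sums:
  assumes x: "x > 0"
  shows "(\<lambda>n. bracket n x) sums (1 / (exp x - 1) + 1 / 2 - 1 / x)"
proof -
  define r where "r = exp (- x)"
  have r: "0 < r" "r < 1" using x by (auto simp: r_def)
  have "(\<lambda>n. r ^ n * ((1 + r) / 2 - (1 - r) / x)) sums (1 / (1 - r) * ((1 + r) / 2 - (1 - r) / x))"
    by (rule sums_mult2[OF geometric_sums]) (use r in auto)
  also have "(\<lambda>n. r ^ n * ((1 + r) / 2 - (1 - r) / x)) = (\<lambda>n. bracket n x)"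
  proof
    fix n
    have "exp (- (x * real n)) = r ^ n" by (simp add: r_def exp_of_nat_mult[symmetric] mult.commute)
    moreover have "exp (- (x * (real n + 1))) = r ^ n * r"
      by (simp add: r_def exp_of_nat_mult[symmetric] algebra_simps exp_add[symmetric] exp_diff exp_minus field_simps)
    ultimately show "r ^ n * ((1 + r) / 2 - (1 - r) / x) = bracket n x"
      unfolding bracket_def by (simp add: algebra_simps diff_divide_distrib add_divide_distrib)
  qed
  also have "1 / (1 - r) * ((1 + r) / 2 - (1 - r) / x) = 1 / (exp x - 1) + 1 / 2 - 1 / x"
  proof -
    have er: "exp x = 1 / r" by (simp add: r_def exp_minus field_simps)
    show ?thesis unfolding er using r x by (simp add: field_simps)
  qed
  finally show ?thesis .
qed

text \<open>Differentiate the reflection formula for Gamma and divide by it. This brings in the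
  cotangent, whose partial fractions are then the difference of two Digamma series.\<close>

lemma Digamma_reflection_complex:
  fixes z :: complex
  assumes z: "z \<notin> \<int>"
  shows "Digamma (1 - z) - Digamma z = of_real pi * cos (of_real pi * z) / sin (of_real pi * z)"
proof -
  have z1: "z \<notin> \<int>\<^sub>\<le>\<^sub>0" "1 - z \<notin> \<int>\<^sub>\<le>\<^sub>0"
  proof -
    show "z \<notin> \<int>\<^sub>\<le>\<^sub>0" using z nonpos_Ints_subset_Ints by blast
    have "1 - z \<notin> \<int>" using z by (metis Ints_1 Ints_diff diff_diff_eq2 add_diff_cancel_left' diff_add_cancel)
    then show "1 - z \<notin> \<int>\<^sub>\<le>\<^sub>0" using nonpos_Ints_subset_Ints by blast
  qed
  let ?S = "sin (of_real pi * z)" and ?C = "cos (of_real pi * z)"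
  have refl: "Gamma z * Gamma (1 - z) = of_real pi / ?S" by (rule Gamma_reflection_complex)
  have S: "?S \<noteq> 0" using refl z1 by (auto simp: Gamma_eq_zero_iff)
  have "((\<lambda>z. Gamma z * Gamma (1 - z)) has_field_derivative
     Gamma z * Digamma z * Gamma (1 - z) + Gamma z * (Gamma (1 - z) * Digamma (1 - z) * (- 1))) (at z)"
    using z1 by (auto intro!: derivative_eq_intros)
  then have d1: "((\<lambda>z. of_real pi / sin (of_real pi * z)) has_field_derivative
     Gamma z * Digamma z * Gamma (1 - z) + Gamma z * (Gamma (1 - z) * Digamma (1 - z) * (- 1))) (at z)"
    unfolding Gamma_reflection_complex .
  have d2: "((\<lambda>z. of_real pi / sin (of_real pi * z)) has_field_derivative
     (- (of_real pi * of_real pi * ?C) / ?S ^ 2)) (at z)"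
    using S by (auto intro!: derivative_eq_intros simp: power2_eq_square)
  have "Gamma z * Digamma z * Gamma (1 - z) + Gamma z * (Gamma (1 - z) * Digamma (1 - z) * (- 1))
      = - (of_real pi * of_real pi * ?C) / ?S ^ 2"
    by (rule DERIV_unique[OF d1 d2])
  then have "(Gamma z * Gamma (1 - z)) * (Digamma (1 - z) - Digamma z) = of_real pi * of_real pi * ?C / ?S ^ 2"
    by (simp add: algebra_simps)
  then have eq: "of_real pi / ?S * (Digamma (1 - z) - Digamma z) = of_real pi * of_real pi * ?C / ?S ^ 2"
    unfolding refl .
  have "Digamma (1 - z) - Digamma z = ?S / of_real pi * (of_real pi / ?S * (Digamma (1 - z) - Digamma z))"
    using S by simp
  also have "\<dots> = ?S / of_real pi * (of_real pi * of_real pi * ?C / ?S ^ 2)" unfolding eq ..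
  also have "\<dots> = of_real pi * ?C / ?S" using S by (simp add: power2_eq_square)
  finally show ?thesis .
qed

text \<open>The sum is \<open>coth (x / 2) / 2 - 1 / x\<close>.\<close>
lemma coth_partial_fractions:
  fixes x :: real
  assumes x: "x > 0"
  shows "(\<lambda>k. 2 * x / (x\<^sup>2 + (2 * pi * real (Suc k))\<^sup>2)) sums (1 / (exp x - 1) + 1 / 2 - 1 / x)"
proof -
  let ?u = "\<lambda>k. 2 * x / (x\<^sup>2 + (2 * pi * real (Suc k))\<^sup>2)"
  \<comment> \<open>Chosen so that \<open>- w\<^sup>2 = (x / (2 * pi))\<^sup>2\<close>: the Digamma
    series at \<open>1 + w\<close> and \<open>1 - w\<close> then differ by a series proportional to
    the wanted one, and the cotangent of \<open>pi * w\<close> becomes a hyperbolic one.\<close>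
  define w where "w = \<i> * of_real (x / (2 * pi))"
  have Imw: "Im w \<noteq> 0" using x by (simp add: w_def)
  then have wZ: "w \<notin> \<int>" by (auto elim!: Ints_cases)
  have ne: "w \<noteq> 0" "1 + w \<noteq> 0" "1 - w \<noteq> 0"
    using Imw by (auto simp: complex_eq_iff)
  have nek: "of_nat (Suc k) + w \<noteq> 0" "of_nat (Suc k) - w \<noteq> 0" for k
    using Imw by (auto simp: complex_eq_iff)
  have S1: "(\<lambda>k. inverse (of_nat (Suc k)) - inverse (1 + w + of_nat k)) sums (Digamma (1 + w) + euler_mascheroni)"
    using summable_sums[OF summable_Digamma[OF ne(2)]] by (simp add: Digamma_def)
  have S2: "(\<lambda>k. inverse (of_nat (Suc k)) - inverse (1 - w + of_nat k)) sums (Digamma (1 - w) + euler_mascheroni)"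
    using summable_sums[OF summable_Digamma[OF ne(3)]] by (simp add: Digamma_def)
  have "Digamma (1 + w) = Digamma w + 1 / w" using Digamma_plus1[OF ne(1)] by (simp add: add.commute)
  then have lim: "Digamma (1 + w) - Digamma (1 - w) = 1 / w - of_real pi * cos (of_real pi * w) / sin (of_real pi * w)"
    using Digamma_reflection_complex[OF wZ] by (simp add: algebra_simps)
  have D: "(\<lambda>k. inverse (1 - w + of_nat k) - inverse (1 + w + of_nat k)) sums
      (1 / w - of_real pi * cos (of_real pi * w) / sin (of_real pi * w))"
    using sums_diff[OF S1 S2] lim by simp
  define q where "q = exp (- x / 2)"
  have q: "0 < q" "q < 1" using x by (auto simp: q_def)
  have eq: "exp (\<i> * (of_real pi * w)) = of_real q" "exp (- (\<i> * (of_real pi * w))) = of_real (1 / q)"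
  proof -
    have "\<i> * (of_real pi * w) = of_real (- x / 2)" by (simp add: w_def)
    then show "exp (\<i> * (of_real pi * w)) = of_real q" by (simp only: q_def exp_of_real)
    then show "exp (- (\<i> * (of_real pi * w))) = of_real (1 / q)" by (simp only: exp_minus) (simp add: inverse_eq_divide)
  qed
  have cot: "of_real pi * cos (of_real pi * w) / sin (of_real pi * w) = \<i> * of_real (pi * (q\<^sup>2 + 1) / (q\<^sup>2 - 1))"
  proof -
    define A B where "A = (q + 1 / q) / 2" and "B = (q - 1 / q) / 2"
    have c: "cos (of_real pi * w) = of_real A" unfolding cos_exp_eq eq by (simp add: A_def)
    have s: "sin (of_real pi * w) = - \<i> * of_real B" unfolding sin_exp_eq eq
      by (subst nonzero_divide_eq_eq) (simp_all add: complex_eq_iff B_def)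
    have AB: "A = (q\<^sup>2 + 1) / (2 * q)" "B = (q\<^sup>2 - 1) / (2 * q)"
      using q by (auto simp: A_def B_def field_simps power2_eq_square)
    have "q\<^sup>2 - 1 \<noteq> 0" using q by (simp add: power2_eq_1_iff)
    then have B: "B \<noteq> 0" and ratio: "A / B = (q\<^sup>2 + 1) / (q\<^sup>2 - 1)" using q unfolding AB by simp_all
    have "of_real pi * of_real A = \<i> * of_real (pi * (A / B)) * (- \<i> * of_real B)"
      using B by (simp add: complex_eq_iff)
    then have "of_real pi * of_real A / (- \<i> * of_real B) = \<i> * of_real (pi * (A / B))"
      using B by (subst nonzero_divide_eq_eq) auto
    then show ?thesis unfolding c s ratio by simp
  qed
  have iw: "1 / w = - \<i> * of_real (2 * pi / x)"
  proof -
    have "w * (- \<i> * of_real (2 * pi / x)) = 1" using x by (simp add: w_def)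
    then show ?thesis using ne(1) by (simp add: field_simps)
  qed
  have trm: "inverse (1 - w + of_nat k) - inverse (1 + w + of_nat k) = 2 * of_real pi * \<i> * of_real (?u k)" for k
  proof -
    define m where "m = real (Suc k)"
    have m: "m > 0" by (simp add: m_def)
    have e: "1 - w + of_nat k = of_real m - w" "1 + w + of_nat k = of_real m + w" by (simp_all add: m_def)
    have ne': "of_real m - w \<noteq> 0" "of_real m + w \<noteq> 0" using nek[of k] by (simp_all add: m_def)
    have "inverse (of_real m - w) - inverse (of_real m + w) = 2 * w / ((of_real m - w) * (of_real m + w))"
      using ne' by (simp add: field_simps)
    also have "(of_real m - w) * (of_real m + w) = of_real (m\<^sup>2 + (x / (2 * pi))\<^sup>2)"
      by (simp add: w_def algebra_simps power2_eq_square)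
    also have "2 * w / of_real (m\<^sup>2 + (x / (2 * pi))\<^sup>2) = \<i> * of_real (2 * (x / (2 * pi)) / (m\<^sup>2 + (x / (2 * pi))\<^sup>2))"
      by (simp add: w_def)
    also have "2 * (x / (2 * pi)) / (m\<^sup>2 + (x / (2 * pi))\<^sup>2) = 2 * pi * (2 * x / (x\<^sup>2 + (2 * pi * m)\<^sup>2))"
    proof -
      have "m\<^sup>2 + (x / (2 * pi))\<^sup>2 = (x\<^sup>2 + (2 * pi * m)\<^sup>2) / (2 * pi)\<^sup>2"
        by (simp add: field_simps power2_eq_square)
      then show ?thesis by (simp add: power2_eq_square)
    qed
    finally show ?thesis by (simp only: e m_def[symmetric]) simp
  qed
  have "(\<lambda>k. 2 * of_real pi * \<i> * of_real (?u k)) sums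
      (- \<i> * of_real (2 * pi / x) - \<i> * of_real (pi * (q\<^sup>2 + 1) / (q\<^sup>2 - 1)))"
    using D unfolding trm cot iw .
  then have "(\<lambda>k. Im (2 * of_real pi * \<i> * of_real (?u k))) sums
      Im (- \<i> * of_real (2 * pi / x) - \<i> * of_real (pi * (q\<^sup>2 + 1) / (q\<^sup>2 - 1)))"
    by (rule sums_Im)
  then have "(\<lambda>k. 2 * pi * (?u k)) sums (- (2 * pi / x) - pi * (q\<^sup>2 + 1) / (q\<^sup>2 - 1))"
    by (simp del: of_nat_Suc)
  then have "(\<lambda>k. (1 / (2 * pi)) * (2 * pi * (?u k))) sums
      ((1 / (2 * pi)) * (- (2 * pi / x) - pi * (q\<^sup>2 + 1) / (q\<^sup>2 - 1)))"
    by (rule sums_mult)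
  also have "(\<lambda>k. (1 / (2 * pi)) * (2 * pi * (?u k)))
      = (\<lambda>k. ?u k)"
    by (simp del: of_nat_Suc)
  also have "(1 / (2 * pi)) * (- (2 * pi / x) - pi * (q\<^sup>2 + 1) / (q\<^sup>2 - 1)) = 1 / (exp x - 1) + 1 / 2 - 1 / x"
  proof -
    have "exp x * q\<^sup>2 = exp (x + (- x / 2 + - x / 2))" unfolding exp_add q_def power2_eq_square ..
    then have E: "exp x * q\<^sup>2 = 1" by simp
    have E1: "exp x - 1 > 0" using x by simp
    have "(q\<^sup>2 + 1) * (exp x - 1) = - (exp x + 1) * (q\<^sup>2 - 1)" using E by (simp add: algebra_simps)
    moreover have "q\<^sup>2 - 1 \<noteq> 0" using q by (simp add: power2_eq_1_iff)
    ultimately have "(q\<^sup>2 + 1) / (q\<^sup>2 - 1) = - (exp x + 1) / (exp x - 1)"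
      using E1 by (subst frac_eq_eq) auto
    then have "(1 / (2 * pi)) * (- (2 * pi / x) - pi * (q\<^sup>2 + 1) / (q\<^sup>2 - 1))
      = (1 / (2 * pi)) * (- (2 * pi / x) - pi * (- (exp x + 1) / (exp x - 1)))"
      by (metis times_divide_eq_right)
    also have "\<dots> = (exp x + 1) / (2 * (exp x - 1)) - 1 / x" using x by (simp add: field_simps)
    also have "(exp x + 1) / (2 * (exp x - 1)) = 1 / (exp x - 1) + 1 / 2" using E1 by (simp add: field_simps)
    finally show ?thesis by simp
  qed
  finally show ?thesis .
qed

text \<open>The substitution on compact intervals passes to the half line by monotone convergence,
  the interval up to \<open>N\<^sup>2\<close> on one side matching the interval up to
  \<open>N\<close> on the other.\<close>

lemma nn_integral_substitution_square:
  fixes f :: "real \<Rightarrow> real"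
  assumes [measurable]: "f \<in> borel_measurable borel"
  shows "(\<integral>\<^sup>+x\<in>{0..}. ennreal (f x) \<partial>lborel) = (\<integral>\<^sup>+x\<in>{0..}. ennreal (f (x\<^sup>2) * (2 * x)) \<partial>lborel)"
proof (rule LIMSEQ_unique)
  have eq: "(\<integral>\<^sup>+x\<in>{0..(real N)\<^sup>2}. ennreal (f x) \<partial>lborel)
      = (\<integral>\<^sup>+x\<in>{0..real N}. ennreal (f (x\<^sup>2) * (2 * x)) \<partial>lborel)" for N
  proof -
    have "(\<integral>\<^sup>+x. ennreal (f x * indicator {0\<^sup>2..(real N)\<^sup>2} x) \<partial>lborel)
        = (\<integral>\<^sup>+x. ennreal (f (x\<^sup>2) * (2 * x) * indicator {0..real N} x) \<partial>lborel)"
      by (rule nn_integral_substitution) (auto intro!: derivative_eq_intros continuous_intros simp: set_borel_measurable_def)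
    then show ?thesis unfolding nn_integral_set_ennreal by simp
  qed
  have lim: "\<forall>\<^sub>F N in sequentially. y \<le> real N" "\<forall>\<^sub>F N in sequentially. y \<le> (real N)\<^sup>2" for y
  proof -
    show 1: "\<forall>\<^sub>F N in sequentially. y \<le> real N"
      using filterlim_real_sequentially by (simp add: filterlim_at_top)
    show "\<forall>\<^sub>F N in sequentially. y \<le> (real N)\<^sup>2"
      using 1 eventually_ge_at_top[of 1]
    proof eventually_elim
      case (elim N)
      have "real N \<le> (real N)\<^sup>2" using elim(2) by (intro self_le_power) auto
      then show ?case using elim(1) by linarith
    qed
  qed
  show "(\<lambda>N. \<integral>\<^sup>+x. ennreal (f x) * indicator {0..(real N)\<^sup>2} x \<partial>lborel) \<longlonglongrightarrow> (\<integral>\<^sup>+x\<in>{0..}. ennreal (f x) \<partial>lborel)"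
  proof (rule nn_integral_LIMSEQ)
    show "incseq (\<lambda>N x. ennreal (f x) * indicator {0..(real N)\<^sup>2} x)"
    proof (rule incseq_SucI, rule le_funI)
      fix N x
      have le: "(real N)\<^sup>2 \<le> (real (Suc N))\<^sup>2" by (intro power_mono) auto
      have "indicator A x \<le> (indicator B x :: ennreal)" if "A \<subseteq> B" for A B :: "real set"
        using that by (auto simp: indicator_def)
      moreover have "{0..(real N)\<^sup>2} \<subseteq> {0..(real (Suc N))\<^sup>2}"
        by (rule atLeastatMost_subset_iff[THEN iffD2], rule disjI2, rule conjI[OF order.refl le])
      ultimately show "ennreal (f x) * indicator {0..(real N)\<^sup>2} x \<le> ennreal (f x) * indicator {0..(real (Suc N))\<^sup>2} x"
        by (intro mult_left_mono zero_le)
    qed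
    show "(\<lambda>N. ennreal (f x) * indicator {0..(real N)\<^sup>2} x) \<longlonglongrightarrow> ennreal (f x) * indicator {0..} x" for x
      by (rule tendsto_eventually, rule eventually_mono[OF lim(2)[of x]]) (auto simp: indicator_def)
  qed measurable
  show "(\<lambda>N. \<integral>\<^sup>+x. ennreal (f x) * indicator {0..(real N)\<^sup>2} x \<partial>lborel) \<longlonglongrightarrow> (\<integral>\<^sup>+x\<in>{0..}. ennreal (f (x\<^sup>2) * (2 * x)) \<partial>lborel)"
    unfolding eq
  proof (rule nn_integral_LIMSEQ)
    show "incseq (\<lambda>N x. ennreal (f (x\<^sup>2) * (2 * x)) * indicator {0..real N} x)"
      by (rule incseq_SucI, rule le_funI, rule mult_left_mono) (auto simp: indicator_def)
    show "(\<lambda>N. ennreal (f (x\<^sup>2) * (2 * x)) * indicator {0..real N} x) \<longlonglongrightarrow> ennreal (f (x\<^sup>2) * (2 * x)) * indicator {0..} x" for x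
      by (rule tendsto_eventually, rule eventually_mono[OF lim(1)[of x]]) (auto simp: indicator_def)
  qed measurable
qed

lemma nn_integral_powr_gaussian:
  fixes s y :: real
  assumes s: "- 1 < s" and y: "y > 0"
  shows "(\<integral>\<^sup>+x\<in>{0<..}. ennreal (x powr s * exp (- (x\<^sup>2 * y))) \<partial>lborel)
     = ennreal (Gamma ((s + 1) / 2) / 2 * y powr - ((s + 1) / 2))"
proof -
  define a where "a = (s + 1) / 2"
  have a: "a > 0" using s by (simp add: a_def)
  let ?f = "\<lambda>t. 1 / 2 * (t powr (a - 1) * exp (- (t * y)))"
  have "(\<integral>\<^sup>+x\<in>{0<..}. ennreal (x powr s * exp (- (x\<^sup>2 * y))) \<partial>lborel)
      = (\<integral>\<^sup>+x\<in>{0..}. ennreal (?f (x\<^sup>2) * (2 * x)) \<partial>lborel)"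
  proof (rule nn_integral_cong)
    fix x :: real
    show "ennreal (x powr s * exp (- (x\<^sup>2 * y))) * indicator {0<..} x = ennreal (?f (x\<^sup>2) * (2 * x)) * indicator {0..} x"
    proof (cases "x > 0")
      case True
      have "(x\<^sup>2) powr (a - 1) * x = (x powr 2) powr (a - 1) * x powr 1" using True by simp
      also have "\<dots> = x powr (2 * (a - 1) + 1)" by (simp only: powr_powr powr_add)
      also have "2 * (a - 1) + 1 = s" by (simp add: a_def field_simps)
      finally have "x powr s = (x\<^sup>2) powr (a - 1) * x" ..
      then show ?thesis using True by (simp add: mult_ac)
    next
      case False
      then show ?thesis by (cases "x = 0") auto
    qed
  qed
  also have "\<dots> = (\<integral>\<^sup>+x\<in>{0..}. ennreal (?f x) \<partial>lborel)"
    by (rule nn_integral_substitution_square[symmetric]) measurable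
  also have "\<dots> = (\<integral>\<^sup>+x. ennreal (1 / 2) * (ennreal (x powr (a - 1) * exp (- (x * y))) * indicator {0<..} x) \<partial>lborel)"
  proof (rule nn_integral_cong)
    fix x :: real
    have h: "0 \<le> (1 / 2 :: real)" by simp
    show "ennreal (?f x) * indicator {0..} x = ennreal (1 / 2) * (ennreal (x powr (a - 1) * exp (- (x * y))) * indicator {0<..} x)"
      unfolding ennreal_mult'[OF h] by (cases "x = 0") (auto simp: indicator_def mult.assoc)
  qed
  also have "\<dots> = ennreal (1 / 2) * ennreal (Gamma a * y powr - a)"
    by (subst nn_integral_cmult) (simp_all only: nn_integral_Gamma_scaled[OF a y], measurable)
  also have "\<dots> = ennreal (1 / 2 * (Gamma a * y powr - a))" by (rule ennreal_mult'[symmetric]) simp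
  finally show ?thesis by (simp add: a_def)
qed

lemma Gamma_reflection_half:
  fixes s :: real
  assumes "- 1 < s" "s < 1"
  shows "Gamma ((s + 1) / 2) * Gamma (1 - (s + 1) / 2) = pi / cos (pi * s / 2)"
proof -
  define a where "a = (s + 1) / 2"
  have "complex_of_real (Gamma a * Gamma (1 - a)) = Gamma (of_real a) * Gamma (1 - of_real a)"
    using Gamma_complex_of_real[of a] Gamma_complex_of_real[of "1 - a"] by simp
  also have "\<dots> = of_real pi / sin (of_real pi * of_real a)" by (rule Gamma_reflection_complex)
  also have "\<dots> = of_real (pi / sin (pi * a))" by (simp flip: sin_of_real)
  finally have "Gamma a * Gamma (1 - a) = pi / sin (pi * a)" by (simp only: of_real_eq_iff)
  also have "pi * a = pi * s / 2 + pi / 2" by (simp add: a_def field_simps)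
  also have "sin (pi * s / 2 + pi / 2) = cos (pi * s / 2)" by (simp add: sin_add)
  finally show ?thesis by (simp add: a_def)
qed

text \<open>\<open>1 / (x\<^sup>2 + c\<^sup>2)\<close> is the integral of
  \<open>exp (- y (x\<^sup>2 + c\<^sup>2))\<close> over \<open>y > 0\<close>. After the exchange of
  integrals the Gaussian integral in \<open>x\<close> and the Gamma integral in \<open>y\<close>
  give \<open>Gamma a * Gamma (1 - a)\<close> with \<open>a = (s + 1) / 2\<close>, which reflection
  turns into the cosine.\<close>

lemma nn_integral_powr_Cauchy:
  fixes s c :: real
  assumes s: "- 1 < s" "s < 1" and c: "c > 0"
  shows "(\<integral>\<^sup>+x\<in>{0<..}. ennreal (x powr s / (x\<^sup>2 + c\<^sup>2)) \<partial>lborel)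
     = ennreal (c powr (s - 1) * (pi / (2 * cos (pi * s / 2))))"
proof -
  define a where "a = (s + 1) / 2"
  have a: "0 < a" "a < 1" using s by (simp_all add: a_def)
  let ?h = "\<lambda>(y::real) (x::real). ennreal (x powr s * exp (- (y * (x\<^sup>2 + c\<^sup>2)))) * indicator {0<..} y * indicator {0<..} x"
  have 1: "ennreal (x powr s / (x\<^sup>2 + c\<^sup>2)) * indicator {0<..} x = (\<integral>\<^sup>+y. ?h y x \<partial>lborel)" for x
  proof -
    have pos: "x\<^sup>2 + c\<^sup>2 > 0" using c by (simp add: add_nonneg_pos)
    have nn: "0 \<le> x powr s" by simp
    have "(\<integral>\<^sup>+y. ?h y x \<partial>lborel)
       = (\<integral>\<^sup>+y. (ennreal (x powr s) * indicator {0<..} x) * (ennreal (y powr (1 - 1) * exp (- (y * (x\<^sup>2 + c\<^sup>2)))) * indicator {0<..} y) \<partial>lborel)"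
    proof (rule nn_integral_cong)
      fix y :: real
      show "?h y x = (ennreal (x powr s) * indicator {0<..} x) * (ennreal (y powr (1 - 1) * exp (- (y * (x\<^sup>2 + c\<^sup>2)))) * indicator {0<..} y)"
        by (cases "y > 0") (simp_all add: ennreal_mult'[OF nn] mult_ac)
    qed
    also have "\<dots> = (ennreal (x powr s) * indicator {0<..} x) * ennreal (Gamma 1 * (x\<^sup>2 + c\<^sup>2) powr - 1)"
      by (subst nn_integral_cmult) (simp_all only: nn_integral_Gamma_scaled[OF zero_less_one pos], measurable)
    also have "Gamma 1 * (x\<^sup>2 + c\<^sup>2) powr - 1 = 1 / (x\<^sup>2 + c\<^sup>2)"
      using pos by (simp add: powr_minus_divide)
    also have "(ennreal (x powr s) * indicator {0<..} x) * ennreal (1 / (x\<^sup>2 + c\<^sup>2)) = ennreal (x powr s * (1 / (x\<^sup>2 + c\<^sup>2))) * indicator {0<..} x"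
      unfolding ennreal_mult'[OF nn] by (simp only: mult_ac)
    finally show ?thesis by simp
  qed
  have 2: "(\<integral>\<^sup>+x. ?h y x \<partial>lborel) = ennreal (Gamma a / 2) * (ennreal (y powr (1 - a - 1) * exp (- (y * c\<^sup>2))) * indicator {0<..} y)" for y
  proof (cases "y > 0")
    case True
    have nn: "0 \<le> exp (- (y * c\<^sup>2))" by simp
    have nn2: "0 \<le> Gamma a / 2" using a by (simp add: Gamma_real_pos less_imp_le)
    have "(\<integral>\<^sup>+x. ?h y x \<partial>lborel) = (\<integral>\<^sup>+x. ennreal (exp (- (y * c\<^sup>2))) * (ennreal (x powr s * exp (- (x\<^sup>2 * y))) * indicator {0<..} x) \<partial>lborel)"
    proof (rule nn_integral_cong)
      fix x :: real
      have "exp (- (y * (x\<^sup>2 + c\<^sup>2))) = exp (- (y * c\<^sup>2)) * exp (- (x\<^sup>2 * y))"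
        by (simp add: exp_add[symmetric] algebra_simps)
      then have "x powr s * exp (- (y * (x\<^sup>2 + c\<^sup>2))) = exp (- (y * c\<^sup>2)) * (x powr s * exp (- (x\<^sup>2 * y)))" by simp
      then show "?h y x = ennreal (exp (- (y * c\<^sup>2))) * (ennreal (x powr s * exp (- (x\<^sup>2 * y))) * indicator {0<..} x)"
        using True by (simp only: ennreal_mult'[OF nn]) (simp add: mult_ac)
    qed
    also have "\<dots> = ennreal (exp (- (y * c\<^sup>2))) * ennreal (Gamma a / 2 * y powr - a)"
      unfolding a_def using s True by (subst nn_integral_cmult) (simp_all only: nn_integral_powr_gaussian, measurable)
    also have "\<dots> = ennreal (Gamma a / 2) * ennreal (y powr - a * exp (- (y * c\<^sup>2)))"
      by (simp only: ennreal_mult'[OF nn, symmetric] ennreal_mult'[OF nn2, symmetric]) (simp only: mult_ac)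
    finally show ?thesis using True by simp
  qed simp
  have nn2: "0 \<le> Gamma a / 2" using a by (simp add: Gamma_real_pos less_imp_le)
  have "(\<integral>\<^sup>+x\<in>{0<..}. ennreal (x powr s / (x\<^sup>2 + c\<^sup>2)) \<partial>lborel) = (\<integral>\<^sup>+x. \<integral>\<^sup>+y. ?h y x \<partial>lborel \<partial>lborel)"
    unfolding 1 ..
  also have "\<dots> = (\<integral>\<^sup>+y. \<integral>\<^sup>+x. ?h y x \<partial>lborel \<partial>lborel)"
    by (rule lborel_pair.Fubini') measurable
  also have "\<dots> = ennreal (Gamma a / 2) * ennreal (Gamma (1 - a) * (c\<^sup>2) powr - (1 - a))"
    unfolding 2 by (subst nn_integral_cmult) (use a c in \<open>simp_all only: nn_integral_Gamma_scaled diff_gt_0_iff_gt zero_less_power\<close>, measurable)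
  also have "\<dots> = ennreal (Gamma a / 2 * (Gamma (1 - a) * (c\<^sup>2) powr - (1 - a)))"
    by (rule ennreal_mult'[symmetric, OF nn2])
  also have "Gamma a / 2 * (Gamma (1 - a) * (c\<^sup>2) powr - (1 - a)) = c powr (s - 1) * (pi / (2 * cos (pi * s / 2)))"
  proof -
    have "(c\<^sup>2) powr - (1 - a) = (c powr 2) powr - (1 - a)" using c by simp
    also have "\<dots> = c powr (2 * - (1 - a))" by (rule powr_powr)
    also have "2 * - (1 - a) = s - 1" by (simp add: a_def field_simps)
    finally have cp: "(c\<^sup>2) powr - (1 - a) = c powr (s - 1)" .
    have "Gamma a / 2 * (Gamma (1 - a) * c powr (s - 1)) = (Gamma a * Gamma (1 - a)) * c powr (s - 1) / 2" by simp
    also have "Gamma a * Gamma (1 - a) = pi / cos (pi * s / 2)"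
      unfolding a_def by (rule Gamma_reflection_half[OF s])
    finally show ?thesis unfolding cp by (simp add: mult_ac)
  qed
  finally show ?thesis .
qed


lemma cos_pi_half_pos:
  fixes s :: real
  assumes s: "- 1 < s" "s < 1"
  shows "cos (pi * s / 2) > 0"
proof (rule cos_gt_zero_pi)
  have "pi * (- 1) < pi * s" "pi * s < pi * 1" using s by (intro mult_strict_left_mono; simp)+
  then show "- (pi / 2) < pi * s / 2" "pi * s / 2 < pi / 2" by simp_all
qed

text \<open>The integral of \<open>x powr (s - 1)\<close> against the common value of
  \<open>bracket_sums\<close> and \<open>coth_partial_fractions\<close> is computed termwise in both
  ways with values in \<open>ennreal\<close>. The partial fraction side is finite, and this yields
  the convergence of the other side as well.\<close>

lemma trapezoid_real_sums:
  fixes s :: real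
  assumes s: "- 1 < s" "s < 0"
  shows "(\<lambda>n. Gamma s * trapezoid_real n s) sums
    ((2 * pi) powr (s - 1) * (pi / cos (pi * s / 2)) * (\<Sum>k. real (Suc k) powr (s - 1)))"
proof -
  let ?R = "(2 * pi) powr (s - 1) * (pi / cos (pi * s / 2)) * (\<Sum>k. real (Suc k) powr (s - 1))"
  let ?a = "\<lambda>n. Gamma s * trapezoid_real n s"
  let ?c = "\<lambda>k x. x powr s / (x\<^sup>2 + (2 * pi * real (Suc k))\<^sup>2)"
  let ?K = "\<lambda>k. 2 * pi * real (Suc k)"
  let ?t = "\<lambda>k. 2 * ((?K k) powr (s - 1) * (pi / (2 * cos (pi * s / 2))))"
  have cpos: "cos (pi * s / 2) > 0" using s by (intro cos_pi_half_pos) auto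
  \<comment> \<open>In this range \<open>Gamma s\<close> is negative and
    \<open>trapezoid_real n s\<close> is not positive, so the sign of the product is right although
    that of its factors is not.\<close>
  have a_nn: "0 \<le> ?a n" for n
  proof -
    have "0 \<le> trapezoid_real n s / (s * (s + 1))"
      by (rule has_integral_nonneg[OF has_integral_trapezoid_real[OF s]]) auto
    moreover have "0 \<le> Gamma (s + 2)" using s by (simp add: Gamma_real_pos less_imp_le)
    ultimately have "0 \<le> Gamma (s + 2) * (trapezoid_real n s / (s * (s + 1)))" by (rule mult_nonneg_nonneg[rotated])
    also have "Gamma (s + 2) * (trapezoid_real n s / (s * (s + 1))) = ?a n"
      unfolding Gamma_plus_2_real[OF s] using s by simp
    finally show ?thesis .
  qed
  have t_nn: "0 \<le> ?t k" for k using cpos by simp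
  have "(\<Sum>n. ennreal (?a n))
      = (\<Sum>n. \<integral>\<^sup>+x. ennreal (x powr (s - 1) * bracket n x) * indicator {0<..} x \<partial>lborel)"
    by (simp only: nn_integral_powr_bracket[OF s])
  also have "\<dots> = (\<integral>\<^sup>+x. (\<Sum>n. ennreal (x powr (s - 1) * bracket n x) * indicator {0<..} x) \<partial>lborel)"
    unfolding bracket_def by (rule nn_integral_suminf[symmetric]) measurable
  also have "\<dots> = (\<integral>\<^sup>+x. (\<Sum>k. ennreal (2 * ?c k x) * indicator {0<..} x) \<partial>lborel)"
  proof (rule nn_integral_cong)
    fix x :: real
    show "(\<Sum>n. ennreal (x powr (s - 1) * bracket n x) * indicator {0<..} x)
        = (\<Sum>k. ennreal (2 * ?c k x) * indicator {0<..} x)"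
    proof (cases "x > 0")
      case True
      let ?g = "1 / (exp x - 1) + 1 / 2 - 1 / x"
      have "x powr ((s - 1) + 1) = x powr (s - 1) * x powr 1" by (rule powr_add)
      then have px: "x powr s = x powr (s - 1) * x" using True by simp
      have 1: "(\<Sum>n. ennreal (x powr (s - 1) * bracket n x)) = ennreal (x powr (s - 1) * ?g)"
        by (rule suminf_ennreal_eq[OF _ sums_mult[OF bracket_sums[OF True]]]) (use bracket_nonneg[OF True] in simp)
      have 2: "(\<Sum>k. ennreal (x powr (s - 1) * (2 * x / (x\<^sup>2 + (?K k)\<^sup>2)))) = ennreal (x powr (s - 1) * ?g)"
        by (rule suminf_ennreal_eq[OF _ sums_mult[OF coth_partial_fractions[OF True]]]) (use True in simp)
      have 3: "x powr (s - 1) * (2 * x / (x\<^sup>2 + (?K k)\<^sup>2)) = 2 * ?c k x" for k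
        unfolding px by simp
      show ?thesis using 1 2 True unfolding 3 by simp
    qed simp
  qed
  also have "\<dots> = (\<Sum>k. \<integral>\<^sup>+x. ennreal (2 * ?c k x) * indicator {0<..} x \<partial>lborel)"
    by (rule nn_integral_suminf) measurable
  also have "\<dots> = (\<Sum>k. ennreal (?t k))"
  proof (rule suminf_cong)
    fix k
    have two: "0 \<le> (2::real)" by simp
    have K: "?K k > 0" by simp
    have "(\<integral>\<^sup>+x\<in>{0<..}. ennreal (2 * ?c k x) \<partial>lborel)
      = (\<integral>\<^sup>+x. ennreal 2 * (ennreal (?c k x) * indicator {0<..} x) \<partial>lborel)"
      by (simp only: ennreal_mult'[OF two] mult.assoc)
    also have "\<dots> = ennreal 2 * (\<integral>\<^sup>+x. (ennreal (?c k x) * indicator {0<..} x) \<partial>lborel)"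
      by (rule nn_integral_cmult) measurable
    also have "\<dots> = ennreal 2 * ennreal ((?K k) powr (s - 1) * (pi / (2 * cos (pi * s / 2))))"
      using s by (subst nn_integral_powr_Cauchy[OF _ _ K]) auto
    also have "\<dots> = ennreal (?t k)" by (rule ennreal_mult'[symmetric, OF two])
    finally show "(\<integral>\<^sup>+x\<in>{0<..}. ennreal (2 * ?c k x) \<partial>lborel) = ennreal (?t k)" .
  qed
  also have "\<dots> = ennreal ?R"
  proof (rule suminf_ennreal_eq[OF t_nn])
    have "(\<lambda>k. (2 * pi) powr (s - 1) * (pi / cos (pi * s / 2)) * real (Suc k) powr (s - 1)) sums
       ?R"
      by (intro sums_mult summable_sums summable_Suc_powr) (use s in auto)
    also have "(\<lambda>k. (2 * pi) powr (s - 1) * (pi / cos (pi * s / 2)) * real (Suc k) powr (s - 1)) = ?t"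
      by (rule ext) (simp add: powr_mult del: of_nat_Suc)
    finally show "?t sums ?R" .
  qed
  finally have eq: "(\<Sum>n. ennreal (?a n))
      = ennreal ?R" .
  have R: "0 \<le> ?R" using cpos by (intro mult_nonneg_nonneg suminf_nonneg summable_Suc_powr) (use s in auto)
  have top: "(\<Sum>n. ennreal (?a n)) \<noteq> Orderings.top" unfolding eq by simp
  have sm: "summable ?a" by (rule summable_suminf_not_top[OF a_nn top])
  moreover have "(\<Sum>n. ?a n) = ?R"
  proof -
    have "ennreal (\<Sum>n. ?a n) = ennreal ?R"
      using suminf_ennreal[OF a_nn top] eq by (simp only:)
    moreover have "0 \<le> (\<Sum>n. ?a n)"
      by (rule suminf_nonneg[OF sm a_nn])
    ultimately show ?thesis using R by (simp only: ennreal_inj)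
  qed
  ultimately show ?thesis by (simp add: sums_iff)
qed

text \<open>Multiplication by \<open>s - 1\<close> turns the terms of
  \<open>trapezoid_real_sums\<close> into those of \<open>zeta_reg\<close>. A further factor
  \<open>s\<close> makes \<open>Gamma (1 + s)\<close> out of \<open>Gamma s\<close>, and the cosine
  is cleared, so that both sides are holomorphic on the strip \<open>-1 < Re s < 1\<close> across
  \<open>s = 0\<close>.\<close>

lemma zeta_reg_functional_equation_real:
  fixes s :: real
  assumes s: "- 1 < s" "s < 0"
  shows "Gamma (1 + of_real s) * cos (of_real (pi * s / 2)) * zeta_reg (of_real s)
    = (1 - of_real s) * of_real pi * of_real (2 * pi) powr (of_real s - 1) * zeta_reg (1 - of_real s)"
proof -
  let ?S = "\<Sum>k. real (Suc k) powr (s - 1)"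
  have cpos: "cos (pi * s / 2) > 0" using s by (intro cos_pi_half_pos) auto
  have G: "Gamma (1 + s) = s * Gamma s"
  proof -
    have "s \<notin> \<int>\<^sub>\<le>\<^sub>0" using s by (rule not_nonpos_Int)
    then show ?thesis using Gamma_plus1[of s] by (simp add: add.commute)
  qed
  have smZ: "summable (\<lambda>k. trapezoid_term (Suc k) (of_real s))"
    by (rule summable_trapezoid_term) (use s in simp)
  have tr: "of_real (trapezoid_real (Suc k) s) * (of_real s - 1) = trapezoid_term (Suc k) (of_real s)" for k
  proof -
    have "trapezoid_real (Suc k) s * (s - 1) = (s - 1) * (real (Suc k) powr - s + real (Suc (Suc k)) powr - s) / 2
       - (real (Suc k) powr (1 - s) - real (Suc (Suc k)) powr (1 - s))"
    proof -
      have e: "real (Suc k) + 1 = real (Suc (Suc k))" by simp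
      have "1 - s \<noteq> 0" using s by simp
      then show ?thesis unfolding trapezoid_real_def e by (simp add: field_simps del: of_nat_Suc)
    qed
    then have "complex_of_real (trapezoid_real (Suc k) s * (s - 1)) = of_real ((s - 1) * (real (Suc k) powr - s + real (Suc (Suc k)) powr - s) / 2
       - (real (Suc k) powr (1 - s) - real (Suc (Suc k)) powr (1 - s)))" by (simp only:)
    then show ?thesis
      using of_nat_powr_of_real[of k "- s"] of_nat_powr_of_real[of "Suc k" "- s"]
        of_nat_powr_of_real[of k "1 - s"] of_nat_powr_of_real[of "Suc k" "1 - s"]
      by (simp add: trapezoid_term_def del: of_nat_Suc)
  qed
  \<comment> \<open>The term of index 0 supplies precisely the part of \<open>zeta_reg\<close> that
    stands outside its series.\<close>
  have t0: "trapezoid_real 0 s * (s - 1) = 1 + (s - 1) / 2"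
    using s by (simp add: trapezoid_real_def field_simps)
  let ?R = "(2 * pi) powr (s - 1) * (pi / cos (pi * s / 2)) * ?S"
  have "(\<lambda>n. Gamma s * trapezoid_real n s * (s - 1)) sums (?R * (s - 1))"
    by (rule sums_mult2[OF trapezoid_real_sums[OF s]])
  then have "(\<lambda>k. Gamma s * trapezoid_real (Suc k) s * (s - 1)) sums (?R * (s - 1) - Gamma s * trapezoid_real 0 s * (s - 1))"
    by (subst sums_Suc_iff) simp
  then have A: "(\<lambda>k. of_real (Gamma s * trapezoid_real (Suc k) s * (s - 1))) sums (of_real (?R * (s - 1) - Gamma s * trapezoid_real 0 s * (s - 1)) :: complex)"
    by (rule sums_of_real)
  have B: "(\<lambda>k. of_real (Gamma s) * trapezoid_term (Suc k) (of_real s)) sums (of_real (Gamma s) * (\<Sum>k. trapezoid_term (Suc k) (of_real s)))"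
    by (intro sums_mult summable_sums smZ)
  have "(\<lambda>k. of_real (Gamma s * trapezoid_real (Suc k) s * (s - 1))) = (\<lambda>k. of_real (Gamma s) * trapezoid_term (Suc k) (of_real s))"
    by (simp add: fun_eq_iff tr[symmetric])
  then have "of_real (Gamma s) * (\<Sum>k. trapezoid_term (Suc k) (of_real s)) = of_real (?R * (s - 1) - Gamma s * trapezoid_real 0 s * (s - 1))"
    using sums_unique2[OF B] A by metis
  also have "Gamma s * trapezoid_real 0 s * (s - 1) = Gamma s * (1 + (s - 1) / 2)"
    using t0 by (simp only: mult.assoc)
  finally have "of_real (Gamma s) * zeta_reg (of_real s) = of_real (?R * (s - 1))"
    by (simp add: zeta_reg_def ring_distribs)
  then have "of_real s * (of_real (Gamma s) * zeta_reg (of_real s)) * of_real (cos (pi * s / 2)) = of_real s * of_real (?R * (s - 1)) * of_real (cos (pi * s / 2))"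
    by (simp only:)
  also have "\<dots> = of_real (s * (?R * (s - 1)) * cos (pi * s / 2))" by (simp only: of_real_mult)
  also have "s * (?R * (s - 1)) * cos (pi * s / 2) = (1 - s) * pi * (2 * pi) powr (s - 1) * (- s * ?S)"
  proof -
    have "s * (P * (pi / c) * S * (s - 1)) * c = (pi / c * c) * (s * P * S * (s - 1))" for P S c :: real
      by (simp only: mult_ac)
    moreover have "pi / cos (pi * s / 2) * cos (pi * s / 2) = pi" using cpos by simp
    ultimately have "s * (?R * (s - 1)) * cos (pi * s / 2) = pi * (s * (2 * pi) powr (s - 1) * ?S * (s - 1))"
      by (simp only:)
    then show ?thesis by (simp only: algebra_simps minus_mult_left[symmetric] minus_mult_right[symmetric])
  qed
  finally have 1: "of_real s * (of_real (Gamma s) * zeta_reg (of_real s)) * of_real (cos (pi * s / 2))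
     = complex_of_real ((1 - s) * pi * (2 * pi) powr (s - 1) * (- s * ?S))" .
  have 2: "zeta_reg (1 - of_real s) = of_real (- s * ?S)"
  proof -
    have "zeta_reg (1 - of_real s) = (1 - of_real s - 1) * (\<Sum>k. of_nat (Suc k) powr - (1 - of_real s))"
      by (rule zeta_reg_eq_dirichlet_series) (use s in simp)
    also have "(\<lambda>k. of_nat (Suc k) powr - (1 - of_real s)) = (\<lambda>k. complex_of_real (real (Suc k) powr (s - 1)))"
      using of_nat_powr_of_real[of _ "s - 1"] by (simp add: fun_eq_iff del: of_nat_Suc)
    also have "(\<Sum>k. complex_of_real (real (Suc k) powr (s - 1))) = of_real ?S"
      by (rule suminf_of_real[symmetric]) (intro summable_Suc_powr, use s in simp)
    finally show ?thesis by simp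
  qed
  have 3: "of_real (2 * pi) powr (of_real s - 1) = complex_of_real ((2 * pi) powr (s - 1))"
    by (simp flip: powr_of_real)
  have 4: "Gamma (1 + of_real s) = complex_of_real (s * Gamma s)"
    unfolding G[symmetric] by (simp flip: Gamma_complex_of_real)
  have 5: "cos (of_real (pi * s / 2)) = complex_of_real (cos (pi * s / 2))" by (rule cos_of_real)
  show ?thesis
    unfolding 2 3 4 5 using 1 by (simp add: mult_ac del: of_nat_Suc)
qed

section \<open>Complex functional equation and continuation to the whole plane\<close>

lemma convex_vertical_strip: "convex {s. a < Re s \<and> Re s < b}"
  using convex_Int[OF convex_halfspace_Re_gt[of a] convex_halfspace_Re_lt[of b]]
  by (simp add: Collect_conj_eq)

lemma open_vertical_strip: "open {s. a < Re s \<and> Re s < b}"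
  using open_Int[OF open_halfspace_Re_gt[of a] open_halfspace_Re_lt[of b]]
  by (simp add: Collect_conj_eq)

lemma Re_pos_not_nonpos_Int: "Re s > 0 \<Longrightarrow> s \<notin> \<int>\<^sub>\<le>\<^sub>0"
  by (auto elim!: nonpos_Ints_cases)

lemma holomorphic_zeta_reg_reflect: "(\<lambda>s. zeta_reg (1 - s)) holomorphic_on {s. Re s < 2}"
proof -
  have "(zeta_reg \<circ> (\<lambda>s. 1 - s)) holomorphic_on {s. Re s < 2}"
    by (rule holomorphic_on_compose_gen[OF _ holomorphic_zeta_reg]) (auto intro!: holomorphic_intros)
  then show ?thesis by (simp add: o_def)
qed

lemma zeta_reg_functional_equation:
  assumes s: "- 1 < Re s" "Re s < 1"
  shows "Gamma (1 + s) * cos (of_real pi * s / 2) * zeta_reg s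
    = (1 - s) * of_real pi * of_real (2 * pi) powr (s - 1) * zeta_reg (1 - s)"
proof -
  let ?S = "{s. - 1 < Re s \<and> Re s < 1}"
  let ?f = "\<lambda>s. Gamma (1 + s) * cos (of_real pi * s / 2) * zeta_reg s
    - (1 - s) * of_real pi * of_real (2 * pi) powr (s - 1) * zeta_reg (1 - s)"
  have "?f s = 0"
  proof (rule analytic_continuation[of ?f ?S "of_real ` {- 1<..<0}" "- 1 / 2"])
    have 1: "zeta_reg holomorphic_on ?S"
      by (rule holomorphic_on_subset[OF holomorphic_zeta_reg]) auto
    have 2: "(\<lambda>s. zeta_reg (1 - s)) holomorphic_on ?S"
      by (rule holomorphic_on_subset[OF holomorphic_zeta_reg_reflect]) auto
    show "?f holomorphic_on ?S"
      by (intro holomorphic_intros 1 2) (auto intro!: Re_pos_not_nonpos_Int)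
    show "s \<in> ?S" using s by simp
    show "open ?S" by (rule open_vertical_strip)
    show "connected ?S" by (rule convex_connected[OF convex_vertical_strip])
    show "of_real ` {- 1<..<0} \<subseteq> ?S" by auto
    show "- 1 / 2 \<in> ?S" by auto
    show "(- 1 / 2 :: complex) islimpt of_real ` {- 1<..<0}"
    proof (rule islimpt_approachable[THEN iffD2], intro allI impI)
      fix e :: real assume e: "e > 0"
      define d where "d = min (e / 2) (1 / 4)"
      have d: "0 < d" "d < e" "d \<le> 1 / 4" using e by (auto simp: d_def)
      have "of_real (- 1 / 2 + d) \<noteq> (- 1 / 2 :: complex)" using d(1) by (auto simp: complex_eq_iff)
      moreover have "dist (of_real (- 1 / 2 + d)) (- 1 / 2 :: complex) = d"
        using d(1) by (simp add: dist_norm)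
      ultimately show "\<exists>x'\<in>of_real ` {- 1<..<0}. x' \<noteq> (- 1 / 2 :: complex) \<and> dist x' (- 1 / 2) < e"
        using d by (intro bexI[of _ "of_real (- 1 / 2 + d)"] conjI imageI) auto
    qed
    fix z :: complex assume "z \<in> of_real ` {- 1<..<0}"
    then obtain x where x: "z = of_real x" "- 1 < x" "x < 0" by auto
    show "?f z = 0"
      using zeta_reg_functional_equation_real[OF x(2,3)] unfolding x(1) by simp
  qed
  then show ?thesis by simp
qed

text \<open>The functional equation solved for \<open>zeta_reg s\<close>. The reflection formula for
  Gamma trades division by \<open>Gamma (1 + s)\<close> and the cosine for the factors
  \<open>Gamma (- s)\<close> and the sine, which are holomorphic on all of \<open>Re s < 0\<close>,
  so the formula carries on to the left of -1.\<close>

abbreviation zeta_reg_reflected :: "complex \<Rightarrow> complex" where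
  "zeta_reg_reflected s \<equiv>
     - 2 * (1 - s) * of_real (2 * pi) powr (s - 1) * Gamma (- s) * sin (of_real pi * s / 2) * zeta_reg (1 - s)"

definition zeta_reg_ext :: "complex \<Rightarrow> complex" where
  "zeta_reg_ext s = (if Re s > - 1 then zeta_reg s
     else zeta_reg_reflected s)"

lemma zeta_reg_eq_reflected:
  assumes s: "- 1 < Re s" "Re s < 0"
  shows "zeta_reg s = zeta_reg_reflected s"
proof -
  define c d where "c = cos (of_real pi * s / 2)" and "d = sin (of_real pi * s / 2)"
  define P where "P = of_real (2 * pi) powr (s - 1)"
  have G0: "Gamma (1 + s) \<noteq> 0" "Gamma (- s) \<noteq> 0"
    using s by (auto simp: Gamma_eq_zero_iff intro!: Re_pos_not_nonpos_Int)
  have refl: "Gamma (- s) * Gamma (1 + s) = - of_real pi / (2 * d * c)"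
  proof -
    have "sin (of_real pi * - s) = - sin (2 * (of_real pi * s / 2))" by simp
    also have "\<dots> = - (2 * d * c)" unfolding sin_double by (simp add: c_def d_def)
    finally have "Gamma (- s) * Gamma (1 - - s) = of_real pi / - (2 * d * c)"
      using Gamma_reflection_complex[of "- s"] by simp
    then show ?thesis by simp
  qed
  have cd: "c \<noteq> 0" "d \<noteq> 0" using refl G0 by auto
  have "Gamma (1 + s) * c * (- 2 * (1 - s) * P * Gamma (- s) * d * zeta_reg (1 - s))
      = (Gamma (- s) * Gamma (1 + s)) * (- 2 * c * d) * ((1 - s) * P * zeta_reg (1 - s))"
    by (simp add: algebra_simps)
  also have "\<dots> = (1 - s) * of_real pi * P * zeta_reg (1 - s)" unfolding refl using cd by simp
  also have "\<dots> = Gamma (1 + s) * c * zeta_reg s"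
    using zeta_reg_functional_equation[of s] s by (simp add: c_def P_def)
  finally have "- 2 * (1 - s) * P * Gamma (- s) * d * zeta_reg (1 - s) = zeta_reg s"
    using G0 cd by simp
  then show ?thesis by (simp add: d_def P_def)
qed

text \<open>Two overlapping open half planes cover the plane, and
  \<open>zeta_reg_eq_reflected\<close> shows that the two formulas agree on the overlap.\<close>

lemma holomorphic_zeta_reg_ext: "zeta_reg_ext holomorphic_on UNIV"
proof -
  have "zeta_reg_ext holomorphic_on {s. Re s > - 1}"
    by (rule holomorphic_transform[OF holomorphic_zeta_reg]) (auto simp: zeta_reg_ext_def)
  moreover have "zeta_reg_ext holomorphic_on {s. Re s < 0}"
  proof (rule holomorphic_transform)
    have 1: "(\<lambda>s. zeta_reg (1 - s)) holomorphic_on {s. Re s < 0}"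
      by (rule holomorphic_on_subset[OF holomorphic_zeta_reg_reflect]) auto
    show "(\<lambda>s. zeta_reg_reflected s) holomorphic_on {s. Re s < 0}"
      by (intro holomorphic_intros 1) (auto intro!: Re_pos_not_nonpos_Int)
    fix s assume "s \<in> {s. Re s < 0}"
    then show "zeta_reg_reflected s = zeta_reg_ext s"
      using zeta_reg_eq_reflected[of s] by (simp add: zeta_reg_ext_def)
  qed
  ultimately have "zeta_reg_ext holomorphic_on ({s. Re s > - 1} \<union> {s. Re s < 0})"
    by (intro holomorphic_on_Un open_halfspace_Re_gt open_halfspace_Re_lt)
  moreover have "{s. Re s > - 1} \<union> {s. Re s < 0} = UNIV" by auto
  ultimately show ?thesis by simp
qed

text \<open>At the pole \<open>s = 1\<close> the division by zero yields the conventional value \<open>0\<close>.\<close>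
lemma zeta_eq: "zeta = (\<lambda>s. zeta_reg_ext s / (s - 1))"
  unfolding zeta_def
proof (rule the_equality)
  have sums: "(\<lambda>k. 1 / (of_nat (Suc k)) powr s) sums (zeta_reg_ext s / (s - 1))" if s: "1 < Re s" for s :: complex
  proof -
    have "zeta_reg_ext s / (s - 1) = (\<Sum>k. of_nat (Suc k) powr - s)"
      using s zeta_reg_eq_dirichlet_series[OF s] by (auto simp: zeta_reg_ext_def)
    moreover have "(\<lambda>k. of_nat (Suc k) powr - s) sums (\<Sum>k. of_nat (Suc k) powr - s)"
      by (rule summable_sums[OF summable_norm_cancel[OF summable_norm_Suc_powr[OF s]]])
    ultimately show ?thesis by (simp add: powr_minus_divide del: of_nat_Suc)
  qed
  have hol: "(\<lambda>s. zeta_reg_ext s / (s - 1)) holomorphic_on - {1}"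
    by (intro holomorphic_intros holomorphic_on_subset[OF holomorphic_zeta_reg_ext]) auto
  show "(\<lambda>s. zeta_reg_ext s / (s - 1)) holomorphic_on - {1} \<and> zeta_reg_ext 1 / (1 - 1) = 0 \<and>
     (\<forall>s. 1 < Re s \<longrightarrow> (\<lambda>k. 1 / of_nat (Suc k) powr s) sums (zeta_reg_ext s / (s - 1)))"
    using sums hol by simp
  fix f assume f: "f holomorphic_on - {1} \<and> f 1 = 0 \<and>
     (\<forall>s. 1 < Re s \<longrightarrow> (\<lambda>k. 1 / of_nat (Suc k) powr s) sums f s)"
  show "f = (\<lambda>s. zeta_reg_ext s / (s - 1))"
  proof
    fix s
    show "f s = zeta_reg_ext s / (s - 1)"
    proof (cases "s = 1")
      case True
      then show ?thesis using f by simp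
    next
      case False
      \<comment> \<open>Uniqueness, the other half of the description: any candidate has the same
        series on \<open>Re s > 1\<close>, and the plane without 1 is connected.\<close>
      show ?thesis
      proof (rule analytic_continuation_open[of "{s. 1 < Re s}" "- {1}" f "\<lambda>s. zeta_reg_ext s / (s - 1)" s])
        show "open {s. 1 < Re s}" by (rule open_halfspace_Re_gt)
        have "(2::complex) \<in> {s. 1 < Re s}" by simp
        then show "{s. 1 < Re s} \<noteq> {}" by blast
        have "connected (UNIV - {1::complex})" by (rule connected_open_delete) auto
        then show "connected (- {1::complex})" by (simp add: Compl_eq_Diff_UNIV)
        show "f z = zeta_reg_ext z / (z - 1)" if "z \<in> {s. 1 < Re s}" for z
          using sums_unique2 f sums that by blast
      qed (use f hol False in auto)
    qed
  qed
qed

lemma zeta_eq_zeta_reg: "Re s > - 1 \<Longrightarrow> zeta s = zeta_reg s / (s - 1)"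
  by (simp add: zeta_eq zeta_reg_ext_def)

lemma zeta_has_sum:
  assumes s: "Re s > 1"
  shows "((\<lambda>k. 1 * of_nat k powr - s) has_sum zeta s) {1..}"
proof -
  have "zeta s = (\<Sum>k. of_nat (Suc k) powr - s)"
    using s zeta_reg_eq_dirichlet_series[OF s] by (auto simp: zeta_eq_zeta_reg)
  then have "(\<lambda>k. of_nat (Suc k) powr - s) sums zeta s"
    using summable_sums[OF summable_norm_cancel[OF summable_norm_Suc_powr[OF s]]] by simp
  then have "((\<lambda>k. of_nat (Suc k) powr - s) has_sum zeta s) UNIV"
    by (rule norm_summable_imp_has_sum[OF summable_norm_Suc_powr[OF s]])
  then have "((\<lambda>k. of_nat k powr - s) has_sum zeta s) {1..}"
    by (rule has_sum_reindex_bij_betw[THEN iffD1, rotated]) (rule bij_betwI[where g = "\<lambda>n. n - 1"], auto)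
  then show ?thesis by simp
qed

lemma inverse_zeta_eq_mobius_series:
  assumes s: "Re s > 1"
  shows "zeta s * (\<Sum>\<^sub>\<infinity>k\<in>{1..}. of_int (mobius_mu k) * of_nat k powr - s) = 1"
  by (rule zeta_series_mult_mobius_mu[OF s zeta_has_sum[OF s]])

lemma zeta_reg_nonzero_Re_gt_1:
  assumes s: "Re s > 1"
  shows "zeta_reg s \<noteq> 0"
  using inverse_zeta_eq_mobius_series[OF s] s by (auto simp: zeta_eq_zeta_reg)

section \<open>Zero-free regions\<close>

text \<open>The reciprocal is the Moebius series, whose coefficients are at most 1 in modulus. The
  bound depends on \<open>Re s\<close> only, so it is uniform on vertical lines; it is applied on
  \<open>Re s = 3/2\<close>, the reflection of the left side.\<close>

lemma norm_inverse_zeta_le: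
  assumes a: "a > 1" and s: "Re s = a"
  shows "norm (inverse (zeta s)) \<le> (\<Sum>\<^sub>\<infinity>k\<in>{1::nat..}. norm (complex_of_nat k powr - of_real a))"
proof -
  let ?f = "\<lambda>k. of_int (mobius_mu k) * of_nat k powr - s :: complex"
  have s1: "Re s > 1" using a s by simp
  have mu: "norm (of_int (mobius_mu k) :: complex) \<le> 1" for k
    using abs_mobius_mu_le_1[of k] by (simp only: norm_of_int of_int_le_1_iff flip: of_int_abs)
  have sm: "(\<lambda>k. norm (?f k)) summable_on {1..}"
    by (rule summable_on_bounded_dirichlet[OF s1, where C = 1]) (use mu in blast)
  have sm1: "(\<lambda>k. norm (1 * complex_of_nat k powr - of_real a)) summable_on {1..}"
    by (rule summable_on_bounded_dirichlet[where C = 1]) (use a in auto)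
  have "inverse (zeta s) = (\<Sum>\<^sub>\<infinity>k\<in>{1..}. ?f k)"
    using inverse_zeta_eq_mobius_series[OF s1] by (rule inverse_unique)
  also have "norm \<dots> \<le> (\<Sum>\<^sub>\<infinity>k\<in>{1..}. norm (?f k))" by (rule norm_infsum_bound[OF sm])
  also have "\<dots> \<le> (\<Sum>\<^sub>\<infinity>k\<in>{1..}. norm (1 * complex_of_nat k powr - of_real a))"
  proof (rule infsum_mono[OF sm sm1])
    fix k :: nat assume k: "k \<in> {1..}"
    have "norm (complex_of_nat k powr - s) = norm (complex_of_nat k powr - of_real a)"
      using k s by (simp add: norm_powr_real_powr)
    then show "norm (?f k) \<le> norm (1 * complex_of_nat k powr - of_real a)"
      using mult_right_mono[OF mu[of k] norm_ge_zero[of "complex_of_nat k powr - s"]] by (simp add: norm_mult)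
  qed
  finally show ?thesis by simp
qed

section \<open>Logarithmic derivative and non-vanishing on \<open>Re s = 1\<close>\<close>

lemma dirichlet_series_ln:
  assumes s: "Re s > 1"
  shows "((\<lambda>k. of_real (ln (real k)) * of_nat k powr - s) has_sum - deriv zeta s) {1..}"
proof -
  let ?S = "{s. Re s > 1}"
  let ?f = "\<lambda>k s. of_nat (Suc k) powr - s :: complex"
  let ?f' = "\<lambda>k s. - (of_real (ln (real (Suc k))) * of_nat (Suc k) powr - s) :: complex"
  have "\<exists>g g'. \<forall>x \<in> ?S. ((\<lambda>n. ?f n x) sums g x) \<and> ((\<lambda>n. ?f' n x) sums g' x) \<and> (g has_field_derivative g' x) (at x)"
  proof (rule series_and_derivative_comparison_local)
    show "open ?S" by (rule open_halfspace_Re_gt)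
    show "(?f n has_field_derivative ?f' n x) (at x)" for n x
    proof -
      have L: "Ln (of_nat (Suc n)) = complex_of_real (ln (real (Suc n)))"
        by (metis Ln_of_real of_nat_0_less_iff of_real_of_nat_eq zero_less_Suc)
      have "((\<lambda>z. of_nat (Suc n) powr z) has_field_derivative Ln (of_nat (Suc n)) * of_nat (Suc n) powr - x) (at (- x))"
        by (rule has_field_derivative_powr_right) (rule of_nat_neq_0)
      from DERIV_chain2[OF this DERIV_minus[OF DERIV_ident]]
      show ?thesis unfolding L by simp
    qed
    fix x assume "x \<in> ?S"
    then have x: "Re x > 1" by simp
    define d where "d = (Re x - 1) / 2"
    have d: "d > 0" "Re x - d > 1" using x by (simp_all add: d_def field_simps)
    have "norm (?f n y) \<le> real (Suc n) powr (- (Re x - d))" if "y \<in> ball x d" for n y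
    proof -
      have "\<bar>Re (x - y)\<bar> \<le> norm (x - y)" by (rule abs_Re_le_cmod)
      then have "Re y \<ge> Re x - d" using that by (auto simp: dist_norm)
      then show ?thesis by (auto simp: norm_powr_real_powr simp del: of_nat_Suc intro!: powr_mono)
    qed
    moreover have "summable (\<lambda>n. real (Suc n) powr (- (Re x - d)))"
      by (rule summable_Suc_powr) (use d in simp)
    ultimately show "\<exists>d h. 0 < d \<and> summable h \<and> (\<forall>\<^sub>F n in sequentially. \<forall>y\<in>ball x d \<inter> ?S. norm (?f n y) \<le> h n)"
      using d(1) by (intro exI[of _ d] exI[of _ "\<lambda>n. real (Suc n) powr (- (Re x - d))"] conjI always_eventually) auto
  qed
  then obtain g g' where g: "\<And>x. x \<in> ?S \<Longrightarrow> (\<lambda>n. ?f n x) sums g x"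
    and g': "\<And>x. x \<in> ?S \<Longrightarrow> (\<lambda>n. ?f' n x) sums g' x"
    and D: "\<And>x. x \<in> ?S \<Longrightarrow> (g has_field_derivative g' x) (at x)" by blast
  have gz: "g x = zeta x" if "x \<in> ?S" for x
  proof -
    have "zeta x = (\<Sum>k. of_nat (Suc k) powr - x)"
      using that zeta_reg_eq_dirichlet_series[of x] by (auto simp: zeta_eq_zeta_reg)
    then show ?thesis using sums_unique[OF g[OF that]] by simp
  qed
  have "(zeta has_field_derivative g' s) (at s)"
    by (rule has_field_derivative_transform_within_open[OF D open_halfspace_Re_gt[of 1]]) (use s gz in auto)
  then have dz: "deriv zeta s = g' s" by (rule DERIV_imp_deriv)
  have "(\<lambda>n. - ?f' n s) sums - g' s" by (rule sums_minus[OF g']) (use s in simp)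
  then have sums: "(\<lambda>n. of_real (ln (real (Suc n))) * of_nat (Suc n) powr - s) sums - deriv zeta s"
    by (simp add: dz del: of_nat_Suc)
  \<comment> \<open>Absolute convergence at \<open>s\<close>: up to sign, the terms at the real
    point \<open>Re s\<close> are the norms of the terms at \<open>s\<close>, and convergence there
    is already known.\<close>
  have "summable (\<lambda>n. ?f' n (of_real (Re s)))"
    by (rule sums_summable[OF g']) (use s in simp)
  then have "summable (\<lambda>n. - Re (?f' n (of_real (Re s))))" by (rule summable_minus[OF summable_Re])
  also have "(\<lambda>n. - Re (?f' n (of_real (Re s)))) = (\<lambda>n. norm (of_real (ln (real (Suc n))) * of_nat (Suc n) powr - s :: complex))"
  proof
    fix n
    have "of_nat (Suc n) powr - complex_of_real (Re s) = of_real (real (Suc n) powr - Re s)"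
      using of_nat_powr_of_real[of n "- Re s"] by simp
    then show "- Re (?f' n (of_real (Re s))) = norm (of_real (ln (real (Suc n))) * of_nat (Suc n) powr - s :: complex)"
      by (simp add: norm_mult norm_powr_real_powr ln_ge_zero del: of_nat_Suc) 
  qed
  finally have "((\<lambda>n. of_real (ln (real (Suc n))) * of_nat (Suc n) powr - s) has_sum - deriv zeta s) UNIV"
    by (rule norm_summable_imp_has_sum[OF _ sums])
  then show ?thesis
    by (rule has_sum_reindex_bij_betw[THEN iffD1, rotated]) (rule bij_betwI[where g = "\<lambda>n. n - 1"], auto)
qed

text \<open>The divisor sums of \<open>mangoldt\<close> are \<open>ln\<close>, so the product of its
  series with that of zeta is the series of \<open>- deriv zeta\<close>.\<close>

lemma mangoldt_has_sum:
  assumes s: "Re s > 1"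
  shows "((\<lambda>k. mangoldt k * of_nat k powr - s) has_sum - deriv zeta s / zeta s) {1..}"
proof -
  have "(\<lambda>k. norm (of_real (ln (real k)) * of_nat k powr - s)) summable_on {1..}"
    by (rule summable_on_iff_abs_summable_on_complex[THEN iffD1, OF has_sum_imp_summable[OF dirichlet_series_ln[OF s]]])
  then have "(\<lambda>k. norm (mangoldt k * of_nat k powr - s)) summable_on {1..}"
  proof (rule Infinite_Sum.abs_summable_on_comparison_test)
    fix k :: nat assume k: "k \<in> {1..}"
    then have "mangoldt k \<le> ln (real k)" by (intro mangoldt_le) auto
    moreover have "0 \<le> ln (real k)" using k by simp
    ultimately show "norm (mangoldt k * of_nat k powr - s) \<le> norm (of_real (ln (real k)) * of_nat k powr - s)"
      by (simp add: norm_mult mult_right_mono)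
  qed
  then have M: "((\<lambda>k. mangoldt k * of_nat k powr - s) has_sum (\<Sum>\<^sub>\<infinity>k\<in>{1..}. mangoldt k * of_nat k powr - s)) {1..}"
    (is "(_ has_sum ?M) _")
    by (rule has_sum_infsum[OF Infinite_Sum.abs_summable_summable])
  have "((\<lambda>k. (\<Sum>d | d dvd k. mangoldt d * 1) * of_nat k powr - s) has_sum ?M * zeta s) {1..}"
    by (rule has_sum_dirichlet_product[OF M zeta_has_sum[OF s]])
  also have "?this \<longleftrightarrow> ((\<lambda>k. of_real (ln (real k)) * of_nat k powr - s) has_sum ?M * zeta s) {1..}"
    by (rule has_sum_cong) (simp add: mangoldt_sum Suc_le_eq)
  finally have "?M * zeta s = - deriv zeta s"
    using dirichlet_series_ln[OF s] by (rule has_sum_unique)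
  moreover have "zeta s \<noteq> 0" using inverse_zeta_eq_mobius_series[OF s] by auto
  ultimately have "?M = - deriv zeta s / zeta s" by (simp add: field_simps)
  then show ?thesis using M by simp
qed

lemma three_four_one_nonneg:
  assumes \<sigma>: "\<sigma> > (1::real)"
  shows "0 \<le> Re (3 * (- deriv zeta (of_real \<sigma>) / zeta (of_real \<sigma>))
      + 4 * (- deriv zeta (Complex \<sigma> t) / zeta (Complex \<sigma> t))
      + (- deriv zeta (Complex \<sigma> (2 * t)) / zeta (Complex \<sigma> (2 * t))))"
proof (rule has_sum_nonneg)
  let ?D = "\<lambda>s. - deriv zeta s / zeta s"
  let ?g = "\<lambda>k s. mangoldt k * of_nat k powr - s :: complex"
  have "((\<lambda>k. 3 * ?g k (of_real \<sigma>) + 4 * ?g k (Complex \<sigma> t) + ?g k (Complex \<sigma> (2 * t))) has_sum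
     (3 * ?D (of_real \<sigma>)
      + 4 * ?D (Complex \<sigma> t)
      + ?D (Complex \<sigma> (2 * t)))) {1..}"
    by (intro has_sum_add has_sum_cmult_right mangoldt_has_sum) (use \<sigma> in auto)
  then show "((\<lambda>k. Re (3 * ?g k (of_real \<sigma>) + 4 * ?g k (Complex \<sigma> t) + ?g k (Complex \<sigma> (2 * t)))) has_sum
     Re (3 * ?D (of_real \<sigma>)
      + 4 * ?D (Complex \<sigma> t)
      + ?D (Complex \<sigma> (2 * t)))) {1..}"
    by (rule has_sum_Re)
  fix k :: nat assume k: "k \<in> {1..}"
  have Rep: "Re (?g k (Complex \<sigma> u)) = mangoldt k * real k powr - \<sigma> * cos (u * ln (real k))" for u
  proof -
    have L: "Ln (of_nat k) = complex_of_real (ln (real k))"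
      using k by (metis Ln_of_real atLeast_iff of_nat_0_less_iff of_real_of_nat_eq less_le_trans zero_less_one)
    have "of_nat k powr - Complex \<sigma> u = exp (- Complex \<sigma> u * of_real (ln (real k)))"
      using k by (simp add: powr_def L)
    then have "Re (of_nat k powr - Complex \<sigma> u) = exp (- \<sigma> * ln (real k)) * cos (u * ln (real k))"
      by (simp add: Re_exp)
    also have "exp (- \<sigma> * ln (real k)) = real k powr - \<sigma>" using k by (simp add: powr_def)
    finally have R: "Re (of_nat k powr - Complex \<sigma> u) = real k powr - \<sigma> * cos (u * ln (real k))" .
    have "Re (?g k (Complex \<sigma> u)) = mangoldt k * Re (of_nat k powr - Complex \<sigma> u)" by simp
    then show ?thesis unfolding R by simp
  qed
  define \<theta> where "\<theta> = t * ln (real k)"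
  have "of_real \<sigma> = Complex \<sigma> 0" by (simp add: complex_eq_iff)
  then have "Re (3 * ?g k (of_real \<sigma>) + 4 * ?g k (Complex \<sigma> t) + ?g k (Complex \<sigma> (2 * t)))
    = 3 * Re (?g k (Complex \<sigma> 0)) + 4 * Re (?g k (Complex \<sigma> t)) + Re (?g k (Complex \<sigma> (2 * t)))"
    by simp
  also have "\<dots> = mangoldt k * real k powr - \<sigma> * (3 + 4 * cos \<theta> + cos (2 * \<theta>))"
    unfolding Rep by (simp add: \<theta>_def algebra_simps)
  also have "3 + 4 * cos \<theta> + cos (2 * \<theta>) = 2 * (1 + cos \<theta>)\<^sup>2"
    unfolding cos_double_cos by (simp add: power2_eq_square algebra_simps)
  finally show "0 \<le> Re (3 * ?g k (of_real \<sigma>) + 4 * ?g k (Complex \<sigma> t) + ?g k (Complex \<sigma> (2 * t)))"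
    by (simp add: mangoldt_nonneg)
qed

text \<open>\<open>k\<close> is the order of the zero of \<open>f\<close> at \<open>a\<close>, with
  \<open>k = 0\<close> if there is none: write \<open>f\<close> as \<open>(w - a) ^ k * g\<close>
  with \<open>g\<close> free of zeros near \<open>a\<close>. The point \<open>b\<close> rules out
  that \<open>f\<close> vanishes identically.\<close>

lemma logderiv_scaled_limit:
  assumes f: "f holomorphic_on S" "open S" "connected S" and a: "a \<in> S" and b: "b \<in> S" "f b \<noteq> 0"
  obtains k :: nat where "f a = 0 \<Longrightarrow> k > 0"
    "((\<lambda>\<epsilon>. of_real \<epsilon> * (deriv f (a + of_real \<epsilon>) / f (a + of_real \<epsilon>))) \<longlongrightarrow> of_nat k) (at_right (0::real))"
proof -
  let ?q = "\<lambda>f w. deriv f w / f w :: complex"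
  have "\<exists>(k::nat) r g. (f a = 0 \<longrightarrow> k > 0) \<and> r > 0 \<and> g holomorphic_on ball a r \<and>
      (\<forall>w\<in>ball a r. f w = (w - a) ^ k * g w \<and> g w \<noteq> 0)"
  proof (cases "f a = 0")
    case True
    have "\<not> f constant_on S" using a b True unfolding constant_on_def by metis
    from holomorphic_factor_zero_nonconstant[OF f a True this] obtain g r n where
      "0 < n" "0 < r" "g holomorphic_on ball a r"
      "\<And>w. w \<in> ball a r \<Longrightarrow> f w = (w - a) ^ n * g w" "\<And>w. w \<in> ball a r \<Longrightarrow> g w \<noteq> 0" by metis
    then show ?thesis by blast
  next
    case False
    have "continuous_on S f" by (rule holomorphic_on_imp_continuous_on[OF f(1)])
    then have "open (S \<inter> f -` (- {0}))" using f(2) by (intro continuous_open_preimage) auto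
    moreover have "a \<in> S \<inter> f -` (- {0})" using a False by simp
    ultimately obtain r where r: "r > 0" "ball a r \<subseteq> S \<inter> f -` (- {0})"
      by (meson open_contains_ball)
    then have "f holomorphic_on ball a r" using holomorphic_on_subset[OF f(1)] by blast
    then show ?thesis using False r by (intro exI[of _ 0] exI[of _ r] exI[of _ f]) auto
  qed
  then obtain k :: nat and r g where k: "f a = 0 \<Longrightarrow> k > 0" and r: "r > 0" and g: "g holomorphic_on ball a r"
    and fg: "\<And>w. w \<in> ball a r \<Longrightarrow> f w = (w - a) ^ k * g w" and g0: "\<And>w. w \<in> ball a r \<Longrightarrow> g w \<noteq> 0"
    by blast
  have eq: "of_real \<epsilon> * ?q f (a + of_real \<epsilon>) = of_nat k + of_real \<epsilon> * ?q g (a + of_real \<epsilon>)"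
    if \<epsilon>: "\<epsilon> \<in> {0<..<r}" for \<epsilon> :: real
  proof -
    define w where "w = a + of_real \<epsilon>"
    have w: "w \<in> ball a r" "w - a = of_real \<epsilon>" using \<epsilon> by (auto simp: w_def dist_norm)
    have e0: "of_real \<epsilon> \<noteq> (0::complex)" using \<epsilon> by simp
    have dg: "(g has_field_derivative deriv g w) (at w)"
      by (rule holomorphic_derivI[OF g open_ball w(1)])
    have "((\<lambda>w. (w - a) ^ k * g w) has_field_derivative of_nat k * (w - a) ^ (k - 1) * g w + (w - a) ^ k * deriv g w) (at w)"
      by (rule derivative_eq_intros dg refl | simp)+
    then have "(f has_field_derivative of_nat k * (w - a) ^ (k - 1) * g w + (w - a) ^ k * deriv g w) (at w)"
      by (rule has_field_derivative_transform_within_open[OF _ open_ball w(1)]) (simp add: fg)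
    then have d: "deriv f w = of_nat k * (w - a) ^ (k - 1) * g w + (w - a) ^ k * deriv g w"
      by (rule DERIV_imp_deriv)
    have p: "of_real \<epsilon> * (of_nat k * of_real \<epsilon> ^ (k - 1)) = (of_nat k * of_real \<epsilon> ^ k :: complex)"
      by (cases k) auto
    have "of_real \<epsilon> * deriv f w = of_real \<epsilon> * (of_nat k * of_real \<epsilon> ^ (k - 1)) * g w + of_real \<epsilon> * of_real \<epsilon> ^ k * deriv g w"
      unfolding d w(2) by (simp add: algebra_simps)
    also have "\<dots> = (of_nat k + of_real \<epsilon> * ?q g w) * f w"
      unfolding p fg[OF w(1)] w(2) using g0[OF w(1)] by (simp add: field_simps)
    finally have "of_real \<epsilon> * deriv f w = (of_nat k + of_real \<epsilon> * ?q g w) * f w" .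
    moreover have "f w \<noteq> 0" unfolding fg[OF w(1)] w(2) using g0[OF w(1)] e0 by simp
    ultimately have "of_real \<epsilon> * (deriv f w / f w) = of_nat k + of_real \<epsilon> * ?q g w"
      by (simp add: field_simps)
    then show ?thesis unfolding w_def .
  qed
  have "deriv g holomorphic_on ball a r" by (rule holomorphic_deriv[OF g open_ball])
  then have cont: "isCont (\<lambda>w. deriv g w / g w) a"
    using r g g0 by (intro continuous_divide) (auto intro: holomorphic_on_imp_continuous_on
        continuous_on_interior[of "ball a r"])
  have "((\<lambda>\<epsilon>. a + of_real \<epsilon>) \<longlongrightarrow> a + of_real 0) (at_right (0::real))"
    by (intro tendsto_intros)
  then have "((\<lambda>\<epsilon>. a + of_real \<epsilon>) \<longlongrightarrow> a) (at_right (0::real))" by simp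
  from isCont_tendsto_compose[OF cont this]
  have "((\<lambda>\<epsilon>. ?q g (a + of_real \<epsilon>)) \<longlongrightarrow> deriv g a / g a) (at_right (0::real))" .
  then have "((\<lambda>\<epsilon>. of_nat k + of_real \<epsilon> * ?q g (a + of_real \<epsilon>)) \<longlongrightarrow> of_nat k + of_real 0 * (deriv g a / g a)) (at_right (0::real))"
    by (intro tendsto_add tendsto_mult tendsto_const tendsto_of_real tendsto_ident_at)
  moreover have "\<forall>\<^sub>F \<epsilon> in at_right (0::real). of_nat k + of_real \<epsilon> * ?q g (a + of_real \<epsilon>)
     = of_real \<epsilon> * ?q f (a + of_real \<epsilon>)"
    using eventually_at_right_less[of "0::real"] eventually_at_right_real[OF r]
    by eventually_elim (rule eq[symmetric], simp)
  ultimately have "((\<lambda>\<epsilon>. of_real \<epsilon> * ?q f (a + of_real \<epsilon>)) \<longlongrightarrow> of_nat k + of_real 0 * (deriv g a / g a)) (at_right (0::real))"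
    by (rule Lim_transform_eventually)
  moreover have "of_nat k + of_real 0 * (deriv g a / g a) = of_nat k" by simp
  ultimately have "((\<lambda>\<epsilon>. of_real \<epsilon> * ?q f (a + of_real \<epsilon>)) \<longlongrightarrow> of_nat k) (at_right (0::real))"
    by (simp only:)
  with that k show thesis by blast
qed


text \<open>Multiplied by \<epsilon>, the inequality \<open>three_four_one_nonneg\<close> at
  \<open>1 + \<epsilon>\<close> tends to \<open>3 - 4 * k1 - k2 \<ge> 0\<close>, where the 3 is due
  to the pole of zeta at 1 and \<open>k1\<close>, \<open>k2\<close> are the orders of the zeros at
  \<open>1 + i t\<close> and \<open>1 + 2 i t\<close>. A zero at \<open>1 + i t\<close> means
  \<open>k1 \<ge> 1\<close>, which is a contradiction.\<close>

lemma zeta_reg_nonzero_Re_1: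
  "zeta_reg (Complex 1 t) \<noteq> 0"
proof (cases "t = 0")
  case True
  then have "Complex 1 t = 1" by (simp add: complex_eq_iff)
  then show ?thesis by (simp add: zeta_reg_1)
next
  case t: False
  let ?P = "\<lambda>u \<epsilon>. 1 / (Complex 1 u + of_real \<epsilon> - 1) :: complex"
  let ?Q = "\<lambda>s. deriv zeta_reg s / zeta_reg s"
  let ?S = "{s. Re s > - 1}"
  have S: "open ?S" "connected ?S"
    by (rule open_Re_gt_minus_1) (rule convex_connected[OF convex_halfspace_Re_gt])
  have two: "(2::complex) \<in> ?S" "zeta_reg 2 \<noteq> 0" by (auto intro!: zeta_reg_nonzero_Re_gt_1)
  \<comment> \<open>The pole is split off, so that the scaled limits concern only
    \<open>zeta_reg\<close>, which is holomorphic at 1.\<close>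
  have M: "- deriv zeta s / zeta s = 1 / (s - 1) - deriv zeta_reg s / zeta_reg s" if s: "Re s > 1" for s
  proof -
    have "(zeta_reg has_field_derivative deriv zeta_reg s) (at s)"
      by (rule holomorphic_derivI[OF holomorphic_zeta_reg S(1)]) (use s in simp)
    then have "((\<lambda>s. zeta_reg s / (s - 1)) has_field_derivative
        (deriv zeta_reg s * (s - 1) - zeta_reg s) / (s - 1)\<^sup>2) (at s)"
      using s by (auto intro!: derivative_eq_intros simp: power2_eq_square)
    then have "(zeta has_field_derivative (deriv zeta_reg s * (s - 1) - zeta_reg s) / (s - 1)\<^sup>2) (at s)"
      by (rule has_field_derivative_transform_within_open[OF _ S(1)]) (use s in \<open>auto simp: zeta_eq_zeta_reg\<close>)
    then have d: "deriv zeta s = (deriv zeta_reg s * (s - 1) - zeta_reg s) / (s - 1)\<^sup>2" by (rule DERIV_imp_deriv)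
    have z: "zeta s = zeta_reg s / (s - 1)" using s by (simp add: zeta_eq_zeta_reg)
    have "s - 1 \<noteq> 0" "zeta_reg s \<noteq> 0" using s zeta_reg_nonzero_Re_gt_1[OF s] by auto
    moreover have "- ((D * a - Z) / a\<^sup>2) / (Z / a) = 1 / a - D / Z" if "a \<noteq> 0" "Z \<noteq> 0" for a D Z :: complex
      using that by (simp add: field_simps power2_eq_square)
    ultimately show ?thesis unfolding d z by blast
  qed
  show ?thesis
  proof
    assume zero: "zeta_reg (Complex 1 t) = 0"
    let ?L = "\<lambda>a \<epsilon>. of_real \<epsilon> * (deriv zeta_reg (a + of_real \<epsilon>) / zeta_reg (a + of_real \<epsilon>)) :: complex"
    obtain k0 :: nat where k0: "(?L 1 \<longlongrightarrow> of_nat k0) (at_right (0::real))"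
      using logderiv_scaled_limit[OF holomorphic_zeta_reg S, of 1 2] two by auto
    obtain k1 :: nat where k1: "k1 > 0" "(?L (Complex 1 t) \<longlongrightarrow> of_nat k1) (at_right (0::real))"
      using logderiv_scaled_limit[OF holomorphic_zeta_reg S, of "Complex 1 t" 2] two zero by auto
    obtain k2 :: nat where k2: "(?L (Complex 1 (2 * t)) \<longlongrightarrow> of_nat k2) (at_right (0::real))"
      using logderiv_scaled_limit[OF holomorphic_zeta_reg S, of "Complex 1 (2 * t)" 2] two by auto
    have pole: "((\<lambda>\<epsilon>. of_real \<epsilon> * ?P u \<epsilon>) \<longlongrightarrow> 0) (at_right (0::real))" if u: "u \<noteq> 0" for u
    proof -
      have "((\<lambda>\<epsilon>. of_real \<epsilon> * ?P u \<epsilon>) \<longlongrightarrow> of_real 0 * (1 / (Complex 1 u + of_real 0 - 1))) (at_right (0::real))"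
        by (intro tendsto_intros) (use u in \<open>auto simp: complex_eq_iff\<close>)
      then show ?thesis by simp
    qed
    let ?F = "\<lambda>\<epsilon>. 3 * (1 - ?L 1 \<epsilon>) + 4 * (of_real \<epsilon> * ?P t \<epsilon> - ?L (Complex 1 t) \<epsilon>)
        + (of_real \<epsilon> * ?P (2 * t) \<epsilon> - ?L (Complex 1 (2 * t)) \<epsilon>)"
    have "(?F \<longlongrightarrow> 3 * (1 - of_nat k0) + 4 * (0 - of_nat k1) + (0 - of_nat k2)) (at_right (0::real))"
      by (intro tendsto_intros k0 k1 k2 pole) (use t in auto)
    then have lim: "((\<lambda>\<epsilon>. Re (?F \<epsilon>)) \<longlongrightarrow> Re (3 * (1 - of_nat k0) + 4 * (0 - of_nat k1) + (0 - of_nat k2))) (at_right (0::real))"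
      by (rule tendsto_Re)
    have k0z: "k0 = 0"
    proof -
      have "((\<lambda>\<epsilon>. 1 + of_real \<epsilon>) \<longlongrightarrow> (1::complex) + of_real 0) (at_right (0::real))" by (intro tendsto_intros)
      then have t1: "((\<lambda>\<epsilon>. 1 + of_real \<epsilon>) \<longlongrightarrow> (1::complex)) (at_right (0::real))" by simp
      have 1: "(1::complex) \<in> interior ?S" using S(1) by (simp add: interior_open)
      have "isCont zeta_reg 1"
        using holomorphic_on_imp_continuous_on[OF holomorphic_zeta_reg] 1 by (rule continuous_on_interior)
      moreover have "isCont (deriv zeta_reg) 1"
        using holomorphic_on_imp_continuous_on[OF holomorphic_deriv[OF holomorphic_zeta_reg S(1)]] 1 by (rule continuous_on_interior)
      ultimately have c: "isCont (\<lambda>w. deriv zeta_reg w / zeta_reg w) 1"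
        by (intro continuous_divide) (auto simp: zeta_reg_1)
      have "(?L 1 \<longlongrightarrow> of_real 0 * (deriv zeta_reg 1 / zeta_reg 1)) (at_right (0::real))"
        by (intro tendsto_mult tendsto_of_real tendsto_ident_at isCont_tendsto_compose[OF c t1])
      then have "(?L 1 \<longlongrightarrow> 0) (at_right (0::real))" by simp
      from tendsto_unique[OF _ k0 this] show ?thesis by simp
    qed
    have ge: "\<forall>\<^sub>F \<epsilon> in at_right (0::real). 0 \<le> Re (?F \<epsilon>)"
      using eventually_at_right_less[of "0::real"]
    proof eventually_elim
      case (elim \<epsilon>)
      have c: "Complex (1 + \<epsilon>) u = Complex 1 u + of_real \<epsilon>" "of_real (1 + \<epsilon>) = (1::complex) + of_real \<epsilon>" for u
        by (simp_all add: complex_eq_iff)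
      have M': "- deriv zeta (Complex 1 u + of_real \<epsilon>) / zeta (Complex 1 u + of_real \<epsilon>)
          = ?P u \<epsilon> - ?Q (Complex 1 u + of_real \<epsilon>)" for u
        by (rule M) (use elim in simp)
      have M1: "- deriv zeta (1 + of_real \<epsilon>) / zeta (1 + of_real \<epsilon>)
          = 1 / of_real \<epsilon> - ?Q (1 + of_real \<epsilon>)"
        using M[of "1 + of_real \<epsilon>"] elim by simp
      have "0 \<le> \<epsilon> * Re (3 * (- deriv zeta (of_real (1 + \<epsilon>)) / zeta (of_real (1 + \<epsilon>)))
        + 4 * (- deriv zeta (Complex (1 + \<epsilon>) t) / zeta (Complex (1 + \<epsilon>) t))
        + (- deriv zeta (Complex (1 + \<epsilon>) (2 * t)) / zeta (Complex (1 + \<epsilon>) (2 * t))))"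
        using elim by (intro mult_nonneg_nonneg three_four_one_nonneg) auto
      also have "\<dots> = Re (of_real \<epsilon> * (3 * (1 / of_real \<epsilon> - ?Q (1 + of_real \<epsilon>))
        + 4 * (?P t \<epsilon> - ?Q (Complex 1 t + of_real \<epsilon>))
        + (?P (2 * t) \<epsilon> - ?Q (Complex 1 (2 * t) + of_real \<epsilon>))))"
      proof -
        have "e * Re X = Re (of_real e * X)" for e X by simp
        then show ?thesis unfolding c M' M1 .
      qed
      also have "of_real \<epsilon> * (3 * (1 / of_real \<epsilon> - ?Q (1 + of_real \<epsilon>))
        + 4 * (?P t \<epsilon> - ?Q (Complex 1 t + of_real \<epsilon>))
        + (?P (2 * t) \<epsilon> - ?Q (Complex 1 (2 * t) + of_real \<epsilon>))) = ?F \<epsilon>"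
      proof -
        have "e * (3 * (1 / e - A) + 4 * (B - C) + (D - E)) = 3 * (1 - e * A) + 4 * (e * B - e * C) + (e * D - e * E)"
          if "e \<noteq> 0" for e A B C D E :: complex
          using that by (simp add: algebra_simps)
        from this[of "of_real \<epsilon>"] show ?thesis using elim by (simp only: of_real_eq_0_iff)
      qed
      finally show ?case .
    qed
    have "0 \<le> Re (3 * (1 - of_nat k0) + 4 * (0 - of_nat k1) + (0 - of_nat k2))"
      by (rule tendsto_lowerbound[OF lim ge]) simp
    then show False using k1(1) k0z by simp
  qed
qed

text \<open>By the functional equation a zero at \<open>s\<close> with \<open>Re s < 1\<close>
  entails one at \<open>1 - s\<close>, which for \<open>Re s \<le> 0\<close> lies in the region
  already cleared. Non-reality matters because the lower side of the rectangle is on the real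
  axis.\<close>

lemma zeta_reg_zeros:
  assumes s: "Re s > - 1" and z: "zeta_reg s = 0"
  shows "0 < Re s" "Re s < 1" "Im s \<noteq> 0"
proof -
  show lt1: "Re s < 1"
  proof (rule ccontr)
    assume "\<not> Re s < 1"
    then consider "Re s > 1" | "Re s = 1" by linarith
    then show False
    proof cases
      case 1
      then show ?thesis using zeta_reg_nonzero_Re_gt_1 z by blast
    next
      case 2
      then have "s = Complex 1 (Im s)" by (simp add: complex_eq_iff)
      then show ?thesis using zeta_reg_nonzero_Re_1[of "Im s"] z by simp
    qed
  qed
  have ne: "1 - s \<noteq> 0" using lt1 by auto
  have refl: "zeta_reg (1 - s) = 0"
    using zeta_reg_functional_equation[OF s lt1] ne by (simp add: z)
  show gt0: "0 < Re s"
  proof (rule ccontr)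
    assume "\<not> 0 < Re s"
    then consider "Re s < 0" | "Re s = 0" by linarith
    then show False
    proof cases
      case 1
      then show ?thesis using zeta_reg_nonzero_Re_gt_1[of "1 - s"] refl by simp
    next
      case 2
      then have "1 - s = Complex 1 (- Im s)" by (simp add: complex_eq_iff)
      then show ?thesis using zeta_reg_nonzero_Re_1[of "- Im s"] refl by simp
    qed
  qed
  show "Im s \<noteq> 0"
  proof
    assume "Im s = 0"
    then have "s = of_real (Re s)" by (simp add: complex_eq_iff)
    then show False using zeta_reg_real_nonzero[OF gt0 lt1] z by simp
  qed
qed

text \<open>For \<open>z = 1 + s\<close> on this line the conjugate of \<open>z\<close> is
  \<open>1 - z\<close>, so the reflection formula evaluates the squared modulus of
  \<open>Gamma z\<close>, and \<open>Gamma z * cos u\<close> turns out to have the constant modulus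
  \<open>sqrt (pi / 2)\<close>. The functional equation then leaves only
  \<open>1 / zeta (1 - s)\<close> on \<open>Re = 3/2\<close> and the factor
  \<open>1 / norm s \<le> 2\<close>.\<close>

lemma inverse_zeta_bounded_left_line:
  obtains C where "\<And>s. Re s = - 1 / 2 \<Longrightarrow> norm (inverse (zeta s)) \<le> C"
proof
  define K where "K = (\<Sum>\<^sub>\<infinity>k\<in>{1::nat..}. norm (complex_of_nat k powr - of_real (3 / 2)))"
  fix s :: complex assume s: "Re s = - 1 / 2"
  define z where "z = 1 + s"
  define u where "u = of_real pi * s / 2"
  have cnjz: "cnj z = 1 - z" using s by (simp add: z_def complex_eq_iff)
  have G0: "Gamma z \<noteq> 0" using s by (auto simp: z_def Gamma_eq_zero_iff intro!: Re_pos_not_nonpos_Int)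
  have sin: "sin (of_real pi * z) = cos (of_real (pi * Im s) * \<i>)"
  proof -
    have "of_real pi * z = of_real (pi * Im s) * \<i> + of_real (pi / 2)"
      using s by (simp add: z_def complex_eq_iff field_simps)
    then have "sin (of_real pi * z) = sin (of_real (pi * Im s) * \<i> + of_real (pi / 2))" by simp
    also have "\<dots> = cos (of_real (pi * Im s) * \<i>)" unfolding sin_add sin_of_real cos_of_real by simp
    finally show ?thesis .
  qed
  have GG: "Gamma z * cnj (Gamma z) = of_real pi / cos (of_real (pi * Im s) * \<i>)"
    using Gamma_reflection_complex[of z] by (simp add: cnj_Gamma cnjz sin)
  have c0: "cos (of_real (pi * Im s) * \<i>) \<noteq> 0" using GG G0 by auto
  \<comment> \<open>In the product formula for cosines the term with \<open>u + cnj u\<close> drops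
    out, because on this line it is the cosine of \<open>- pi / 2\<close>.\<close>
  have cc: "cos u * cnj (cos u) = cos (of_real (pi * Im s) * \<i>) / 2"
  proof -
    have "u - cnj u = of_real (pi * Im s) * \<i>" "u + cnj u = of_real (- (pi / 2))"
      using s by (auto simp: u_def complex_eq_iff)
    moreover have "cos (of_real (- (pi / 2)) :: complex) = 0" unfolding cos_of_real by simp
    ultimately show ?thesis by (simp add: cnj_cos cos_times_cos)
  qed
  have "(Gamma z * cos u) * cnj (Gamma z * cos u) = (Gamma z * cnj (Gamma z)) * (cos u * cnj (cos u))" by simp
  also have "\<dots> = of_real (pi / 2)" unfolding GG cc using c0 by simp
  finally have "complex_of_real ((norm (Gamma z * cos u))\<^sup>2) = of_real (pi / 2)" by (simp only: complex_norm_square)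
  then have "(norm (Gamma z * cos u))\<^sup>2 = pi / 2" by (simp only: of_real_eq_iff)
  then have N: "norm (Gamma z * cos u) = sqrt (pi / 2)" by (metis norm_ge_zero real_sqrt_unique)
  have z1: "zeta_reg (1 - s) = - s * zeta (1 - s)"
    using s by (simp add: zeta_eq_zeta_reg complex_eq_iff)
  have z0: "zeta_reg s = (s - 1) * zeta s" using s by (auto simp: zeta_eq_zeta_reg)
  define P where "P = of_real (2 * pi) powr (s - 1)"
  have "Gamma z * cos u * ((s - 1) * zeta s) = (1 - s) * of_real pi * P * (- s * zeta (1 - s))"
    using zeta_reg_functional_equation[of s] s by (simp add: z_def u_def P_def z0 z1)
  then have "(s - 1) * (Gamma z * cos u * zeta s) = (s - 1) * (of_real pi * P * s * zeta (1 - s))"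
    by (simp add: algebra_simps)
  moreover have "s - 1 \<noteq> 0" using s by auto
  ultimately have E: "Gamma z * cos u * zeta s = of_real pi * P * s * zeta (1 - s)" by simp
  have P: "norm P = (2 * pi) powr (- 3 / 2)"
    unfolding P_def using s by (subst norm_powr_real_powr) auto
  have "norm (inverse (zeta (1 - s))) \<le> K"
    unfolding K_def by (rule norm_inverse_zeta_le) (use s in auto)
  moreover have zn: "zeta (1 - s) \<noteq> 0"
    using inverse_zeta_eq_mobius_series[of "1 - s"] s by auto
  ultimately have inv: "1 / norm (zeta (1 - s)) \<le> K" by (simp add: norm_inverse divide_inverse)
  have sn: "norm s \<ge> 1 / 2" using abs_Re_le_cmod[of s] s by simp
  have EN: "sqrt (pi / 2) * norm (zeta s) = pi * (2 * pi) powr (- 3 / 2) * norm s * norm (zeta (1 - s))"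
    using arg_cong[OF E, of norm] by (simp add: norm_mult N[unfolded norm_mult] P)
  define Q where "Q = pi * (2 * pi) powr (- 3 / 2)"
  have Q: "Q > 0" by (simp add: Q_def)
  have sq: "sqrt (pi / 2) > 0" by simp
  have nz: "norm (zeta s) = Q * norm s * norm (zeta (1 - s)) / sqrt (pi / 2)"
    using EN sq by (simp add: Q_def field_simps)
  have "norm (inverse (zeta s)) = sqrt (pi / 2) / Q * (1 / norm s) * (1 / norm (zeta (1 - s)))"
    unfolding norm_inverse nz by (simp add: field_simps)
  also have "\<dots> \<le> sqrt (pi / 2) / Q * 2 * K"
  proof (intro mult_mono inv)
    have "0 < norm s" using sn by linarith
    then show "1 / norm s \<le> 2" using sn by (simp add: divide_le_eq)
  qed (use Q in auto)
  finally show "norm (inverse (zeta s)) \<le> sqrt (pi / 2) / Q * 2 * K" .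
qed

section \<open>The meromorphic series\<close>

definition cq_poles :: "nat \<Rightarrow> nat \<Rightarrow> complex set" where
  "cq_poles \<beta> n = {of_real (ln (real q)) |q. q \<ge> 1 \<and> cq \<beta> q n \<noteq> 0}"

definition cq_term :: "nat \<Rightarrow> nat \<Rightarrow> nat \<Rightarrow> complex \<Rightarrow> complex" where
  "cq_term \<beta> n k z = cq \<beta> (Suc k) n / (of_real (real (Suc k) powr (3/2)) * (z - of_real (ln (real (Suc k)))))"

lemma cq_series_eq: "cq_series \<beta> n z = (\<Sum>k. cq_term \<beta> n k z)"
  by (simp add: cq_series_def cq_term_def)

context
  fixes \<beta> n :: nat and C :: real
  assumes C: "C \<ge> 0" "\<And>q. q \<ge> 1 \<Longrightarrow> norm (cq \<beta> q n) \<le> C"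
begin

lemma norm_cq_term_le:
  assumes d: "d > 0" "norm (z - of_real (ln (real (Suc k)))) \<ge> d"
  shows "norm (cq_term \<beta> n k z) \<le> C / d * real (Suc k) powr (- 3 / 2)"
proof -
  have "norm (cq_term \<beta> n k z) = norm (cq \<beta> (Suc k) n) / (real (Suc k) powr (3 / 2) * norm (z - of_real (ln (real (Suc k)))))"
    by (simp add: cq_term_def norm_divide norm_mult del: of_nat_Suc)
  also have "\<dots> \<le> C / (real (Suc k) powr (3 / 2) * d)"
    by (intro frac_le mult_left_mono mult_pos_pos d C) auto
  also have "\<dots> = C / d * real (Suc k) powr (- 3 / 2)"
  proof -
    have "real (Suc k) powr (- 3 / 2) = 1 / real (Suc k) powr (3 / 2)"
      using powr_minus_divide[of "real (Suc k)" "3 / 2"] by simp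
    then show ?thesis by (simp del: of_nat_Suc)
  qed
  finally show ?thesis .
qed

text \<open>The points \<open>ln q\<close> tend to infinity, so only finitely many terms can be
  singular near \<open>p\<close>.\<close>

lemma cq_term_far:
  fixes p :: complex
  obtains N where "\<And>k z. z \<in> cball p 1 \<Longrightarrow> k \<ge> N \<Longrightarrow> norm (z - of_real (ln (real (Suc k)))) \<ge> 1"
proof
  fix k z assume z: "z \<in> cball p 1" and k: "k \<ge> nat \<lceil>exp (norm p + 2)\<rceil>"
  have "exp (norm p + 2) \<le> real k" using k by linarith
  also have "\<dots> \<le> real (Suc k)" by simp
  finally have "norm p + 2 \<le> ln (real (Suc k))" by (subst ln_ge_iff) auto
  also have "\<dots> \<le> norm (complex_of_real (ln (real (Suc k))))" by simp
  also have "\<dots> \<le> norm (z - of_real (ln (real (Suc k)))) + norm z"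
    using norm_triangle_ineq4[of "z - of_real (ln (real (Suc k)))" z] by (simp add: norm_minus_commute)
  also have "norm z \<le> norm p + 1"
    using z norm_triangle_ineq2[of z p] by (auto simp: dist_norm norm_minus_commute)
  finally show "norm (z - of_real (ln (real (Suc k)))) \<ge> 1" by simp
qed

text \<open>At a point \<open>ln q\<close> the singular term has the value 0 by division by zero,
  and all but finitely many terms are at most \<open>C\<close> times
  \<open>real (Suc k) powr (- 3 / 2)\<close>.\<close>

lemma summable_cq_term: "summable (\<lambda>k. cq_term \<beta> n k z)"
proof -
  obtain N where N: "\<And>k w. w \<in> cball z 1 \<Longrightarrow> k \<ge> N \<Longrightarrow> norm (w - of_real (ln (real (Suc k)))) \<ge> 1"
    using cq_term_far by blast
  have "norm (cq_term \<beta> n k z) \<le> C / 1 * real (Suc k) powr (- 3 / 2)" if "k \<ge> N" for k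
    by (rule norm_cq_term_le[OF zero_less_one N]) (use that in auto)
  then show ?thesis
    by (intro summable_comparison_test[OF _ summable_mult[OF summable_Suc_powr]]) auto
qed

lemma cq_series_split:
  "cq_series \<beta> n z = (\<Sum>k. cq_term \<beta> n (k + N) z) + (\<Sum>k<N. cq_term \<beta> n k z)"
  unfolding cq_series_eq by (rule suminf_split_initial_segment[OF summable_cq_term])

lemma holomorphic_cq_term:
  assumes "cq \<beta> (Suc k) n = 0 \<or> of_real (ln (real (Suc k))) \<notin> A"
  shows "cq_term \<beta> n k holomorphic_on A"
proof (cases "cq \<beta> (Suc k) n = 0")
  case True
  then have "cq_term \<beta> n k = (\<lambda>_. 0)" by (simp add: cq_term_def fun_eq_iff)
  then show ?thesis by simp
next
  case False
  then have "of_real (ln (real (Suc k))) \<notin> A" using assms by simp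
  then show ?thesis unfolding cq_term_def by (intro holomorphic_intros) (auto simp del: of_nat_Suc)
qed

text \<open>The offset \<open>M\<close> lets the caller place a chosen index, that of the polar
  term, among the finitely many terms that are split off.\<close>

lemma holomorphic_cq_tail:
  obtains N where "(\<lambda>z. \<Sum>k. cq_term \<beta> n (k + M + N) z) holomorphic_on ball p 1"
proof -
  obtain N where N: "\<And>k w. w \<in> cball p 1 \<Longrightarrow> k \<ge> N \<Longrightarrow> norm (w - of_real (ln (real (Suc k)))) \<ge> 1"
    using cq_term_far by blast
  have "(\<lambda>z. \<Sum>k. cq_term \<beta> n (k + M + N) z) holomorphic_on ball p 1"
  proof (rule holomorphic_on_suminf_local[OF open_ball])
    show "cq_term \<beta> n (k + M + N) holomorphic_on ball p 1" for k
    proof (rule holomorphic_cq_term, rule disjI2, rule notI)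
      assume "complex_of_real (ln (real (Suc (k + M + N)))) \<in> ball p 1"
      then show False using N[of "complex_of_real (ln (real (Suc (k + M + N))))" "k + M + N"] by auto
    qed
    fix x assume "x \<in> ball p 1"
    then obtain d where d: "d > 0" "cball x d \<subseteq> ball p 1" using open_ball[of p 1] unfolding open_contains_cball by blast
    have "norm (cq_term \<beta> n (k + M + N) y) \<le> C / 1 * real (Suc (k + (M + N))) powr (- 3 / 2)" if "y \<in> cball x d" for k y
    proof -
      have "y \<in> cball p 1" using that d(2) by (auto simp: less_imp_le)
      then show ?thesis using norm_cq_term_le[OF zero_less_one N[of y "k + M + N"]] by (simp add: add.assoc)
    qed
    moreover have "summable (\<lambda>k. C / 1 * real (Suc (k + (M + N))) powr (- 3 / 2))"
      by (rule summable_ignore_initial_segment[OF summable_mult[OF summable_Suc_powr]]) simp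
    ultimately show "\<exists>d>0. \<exists>M'. cball x d \<subseteq> ball p 1 \<and> summable M' \<and>
        (\<forall>k. \<forall>y\<in>cball x d. norm (cq_term \<beta> n (k + M + N) y) \<le> M' k)"
      using d by blast
  qed
  then show thesis by (rule that)
qed

lemma cq_poles_not_islimpt: "\<not> p islimpt cq_poles \<beta> n"
proof
  assume "p islimpt cq_poles \<beta> n"
  then have inf: "infinite (cq_poles \<beta> n \<inter> ball p 1)" by (simp add: islimpt_eq_infinite_ball)
  obtain N where N: "\<And>k w. w \<in> cball p 1 \<Longrightarrow> k \<ge> N \<Longrightarrow> norm (w - of_real (ln (real (Suc k)))) \<ge> 1"
    using cq_term_far by blast
  have "cq_poles \<beta> n \<inter> ball p 1 \<subseteq> (\<lambda>k. of_real (ln (real (Suc k)))) ` {..<N}"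
  proof
    fix w assume w: "w \<in> cq_poles \<beta> n \<inter> ball p 1"
    then obtain q where q: "w = of_real (ln (real q))" "q \<ge> 1" by (auto simp: cq_poles_def)
    then obtain k where k: "q = Suc k" by (cases q) auto
    have "\<not> k \<ge> N" using N[of w k] w q(1) k by auto
    then show "w \<in> (\<lambda>k. of_real (ln (real (Suc k)))) ` {..<N}" using q(1) k by auto
  qed
  then show False using inf finite_subset by blast
qed

lemma open_minus_cq_poles: "open (- cq_poles \<beta> n)"
  using cq_poles_not_islimpt closed_limpt[of "cq_poles \<beta> n"] by (auto simp: open_Compl)

lemma holomorphic_cq_series: "cq_series \<beta> n holomorphic_on - cq_poles \<beta> n"
  unfolding holomorphic_on_open[OF open_minus_cq_poles] 
proof
  fix p assume p: "p \<in> - cq_poles \<beta> n"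
  obtain N where N: "(\<lambda>z. \<Sum>k. cq_term \<beta> n (k + 0 + N) z) holomorphic_on ball p 1"
    using holomorphic_cq_tail by blast
  have "cq_term \<beta> n k holomorphic_on (ball p 1 \<inter> - cq_poles \<beta> n)" for k
  proof (rule holomorphic_cq_term)
    show "cq \<beta> (Suc k) n = 0 \<or> of_real (ln (real (Suc k))) \<notin> ball p 1 \<inter> - cq_poles \<beta> n"
      unfolding cq_poles_def by (cases "cq \<beta> (Suc k) n = 0") (auto simp del: of_nat_Suc)
  qed
  then have "(\<lambda>z. (\<Sum>k. cq_term \<beta> n (k + 0 + N) z) + (\<Sum>k<N. cq_term \<beta> n k z)) holomorphic_on (ball p 1 \<inter> - cq_poles \<beta> n)"
    by (intro holomorphic_intros holomorphic_on_subset[OF N]) auto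
  then have "cq_series \<beta> n holomorphic_on (ball p 1 \<inter> - cq_poles \<beta> n)"
    by (rule holomorphic_transform) (simp add: cq_series_split[of _ N])
  moreover have "open (ball p 1 \<inter> - cq_poles \<beta> n)" using open_minus_cq_poles by blast
  moreover have "p \<in> ball p 1 \<inter> - cq_poles \<beta> n" using p by simp
  ultimately show "\<exists>f'. (cq_series \<beta> n has_field_derivative f') (at p)"
    using holomorphic_derivI by blast
qed

lemma cq_series_pole:
  assumes p: "p \<in> cq_poles \<beta> n"
  shows "filterlim (\<lambda>z. exp (3 * z / 2) * cq_series \<beta> n z) at_infinity (at p)"
proof -
  obtain q where q: "p = of_real (ln (real q))" "q \<ge> 1" "cq \<beta> q n \<noteq> 0" using p by (auto simp: cq_poles_def)
  then obtain j where j: "q = Suc j" by (cases q) auto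
  obtain N where N: "(\<lambda>z. \<Sum>k. cq_term \<beta> n (k + Suc j + N) z) holomorphic_on ball p 1"
    using holomorphic_cq_tail by blast
  let ?N = "Suc j + N"
  \<comment> \<open>Everything except the term of index \<open>j\<close>. It is continuous at
    \<open>p\<close> because \<open>ln\<close> is injective, so no other term can cancel the
    pole.\<close>
  let ?rest = "\<lambda>z. (\<Sum>k. cq_term \<beta> n (k + ?N) z) + (\<Sum>k\<in>{..<?N} - {j}. cq_term \<beta> n k z)"
  have eq: "cq_series \<beta> n z = ?rest z + cq_term \<beta> n j z" for z
    unfolding cq_series_split[of z ?N] by (subst sum.remove[of "{..<?N}" j]) auto
  have "isCont (\<lambda>z. \<Sum>k. cq_term \<beta> n (k + ?N) z) p"
    using continuous_on_interior[OF holomorphic_on_imp_continuous_on[OF N], of p] by (simp add: add.assoc)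
  moreover have "isCont (cq_term \<beta> n k) p" if "k \<noteq> j" for k
  proof -
    have "ln (real (Suc k)) \<noteq> ln (real (Suc j))" using that by simp
    then have "p - of_real (ln (real (Suc k))) \<noteq> 0" unfolding q(1) j by (simp del: of_nat_Suc)
    then show ?thesis unfolding cq_term_def by (intro continuous_intros) (auto simp del: of_nat_Suc)
  qed
  ultimately have "isCont ?rest p" by (intro continuous_intros) auto
  then have rest: "(?rest \<longlongrightarrow> ?rest p) (at p)" by (simp add: isCont_def)
  have "filterlim (\<lambda>z. cq \<beta> q n / of_real (real q powr (3 / 2)) / (z - p)) at_infinity (at p)"
  proof (rule filterlim_divide_at_infinity[OF tendsto_const])
    have "((\<lambda>z. z - p) \<longlongrightarrow> p - p) (at p)" by (intro tendsto_intros)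
    then show "filterlim (\<lambda>z. z - p) (at 0) (at p)"
      by (auto simp: filterlim_at eventually_at_filter)
    show "cq \<beta> q n / of_real (real q powr (3 / 2)) \<noteq> 0" using q by simp
  qed
  also have "(\<lambda>z. cq \<beta> q n / of_real (real q powr (3 / 2)) / (z - p)) = cq_term \<beta> n j"
    unfolding cq_term_def q(1) j by (simp add: fun_eq_iff del: of_nat_Suc)
  finally have "filterlim (cq_term \<beta> n j) at_infinity (at p)" .
  then have "filterlim (\<lambda>z. ?rest z + cq_term \<beta> n j z) at_infinity (at p)"
    by (rule tendsto_add_filterlim_at_infinity[OF rest])
  then have inf: "filterlim (cq_series \<beta> n) at_infinity (at p)" by (simp only: eq[symmetric])
  have "((\<lambda>z. exp (3 * z / 2)) \<longlongrightarrow> exp (3 * p / 2)) (at p)" by (intro tendsto_intros) auto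
  then show ?thesis by (rule tendsto_mult_filterlim_at_infinity[OF _ _ inf]) simp
qed

lemma meromorphic_cq_series:
  "meromorphic_with_poles (\<lambda>z. exp (3 * z / 2) * cq_series \<beta> n z) (cq_poles \<beta> n)"
  unfolding meromorphic_with_poles_def
  using cq_poles_not_islimpt cq_series_pole by (auto intro!: holomorphic_intros holomorphic_cq_series)

end

section \<open>Integrals over half lines and parameter integrals\<close>

lemma continuous_on_imp_integrable_Ici:
  fixes f :: "real \<Rightarrow> complex"
  assumes f: "continuous_on {a..} f" and y: "y > 0"
    and bd: "\<And>t. t \<ge> a \<Longrightarrow> norm (f t) \<le> K * exp (- y * t)"
  shows "f integrable_on {a..}" "norm (integral {a..} f) \<le> K * (exp (- y * a) / y)"
proof -
  have S: "{a..} \<in> sets lebesgue" by simp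
  have m: "f \<in> borel_measurable (lebesgue_on {a..})" by (rule continuous_imp_measurable_on_sets_lebesgue[OF f S])
  have g: "((\<lambda>t. K * exp (- y * t)) has_integral K * (exp (- y * a) / y)) {a..}"
    by (rule has_integral_mult_right[OF has_integral_exp_minus_to_infinity[OF y]])
  show "f integrable_on {a..}"
    by (rule measurable_bounded_by_integrable_imp_integrable[OF m has_integral_integrable[OF g] _ S]) (use bd in auto)
  show "norm (integral {a..} f) \<le> K * (exp (- y * a) / y)"
    by (rule integral_norm_bound_integral'[OF _ m S g]) (use bd in auto)
qed

lemma norm_integral_Ici_diff_le:
  fixes f :: "real \<Rightarrow> complex"
  assumes f: "continuous_on {0..} f" and y: "y > 0" and T: "T \<ge> 0"
    and bd: "\<And>t. t \<ge> 0 \<Longrightarrow> norm (f t) \<le> K * exp (- y * t)"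
  shows "norm (integral {0..} f - integral {0..T} f) \<le> K * (exp (- y * T) / y)"
proof -
  have fT: "continuous_on {T..} f" by (rule continuous_on_subset[OF f]) (use T in auto)
  have bT: "\<And>t. t \<ge> T \<Longrightarrow> norm (f t) \<le> K * exp (- y * t)" using bd T by auto
  note tail = continuous_on_imp_integrable_Ici[OF fT y bT]
  have "f integrable_on {0..T}"
    by (rule integrable_continuous_interval[OF continuous_on_subset[OF f]]) auto
  then have "(f has_integral (integral {0..T} f + integral {T..} f)) ({0..T} \<union> {T..})"
    using tail(1) by (intro has_integral_Un integrable_integral) (auto simp: Int_atLeastAtMostR1 T)
  moreover have "{0..T} \<union> {T..} = {0..}" using T by auto
  ultimately have "integral {0..} f = integral {0..T} f + integral {T..} f" by (simp add: integral_unique)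
  then show ?thesis using tail(2) by simp
qed

lemma holomorphic_integral_exp:
  fixes h g :: "real \<Rightarrow> complex"
  assumes h: "continuous_on {a..b} h" and g: "continuous_on {a..b} g"
  shows "(\<lambda>z. integral {a..b} (\<lambda>t. h t * exp (g t * z))) holomorphic_on UNIV"
proof -
  have h': "continuous_on (UNIV \<times> cbox a b) (\<lambda>x. h (snd x))" "continuous_on (UNIV \<times> cbox a b) (\<lambda>x. g (snd x))"
    using h g by (auto intro!: continuous_on_compose2[OF _ continuous_on_snd] continuous_on_id simp: cbox_interval)
  have "(\<lambda>z. integral (cbox a b) (\<lambda>t. h t * exp (g t * z))) holomorphic_on UNIV"
  proof (rule leibniz_rule_holomorphic)
    show "((\<lambda>z. h t * exp (g t * z)) has_field_derivative h t * (exp (g t * z) * g t)) (at z within UNIV)" for z t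
      by (auto intro!: derivative_eq_intros)
    show "(\<lambda>t. h t * exp (g t * z)) integrable_on cbox a b" for z
      using h g by (intro integrable_continuous continuous_intros) (auto simp: cbox_interval)
    show "continuous_on (UNIV \<times> cbox a b) (\<lambda>(z, t). h t * (exp (g t * z) * g t))"
      unfolding case_prod_unfold by (intro continuous_intros h' continuous_on_fst)
  qed simp
  then show ?thesis by (simp add: cbox_interval)
qed

lemma contour_integral_vertical_linepath:
  assumes T: "T > 0"
  shows "contour_integral (linepath a (a + \<i> * of_real T)) f = \<i> * integral {0..T} (\<lambda>t. f (a + \<i> * of_real t))"
proof -
  have "contour_integral (linepath a (a + \<i> * of_real T)) f
      = contour_integral (linepath 0 (of_real T)) (\<lambda>w. \<i> * f (a + \<i> * w))"
  proof -
    have e: "linepath a (a + \<i> * of_real T) x = a + \<i> * linepath 0 (of_real T) x" for x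
      by (simp add: linepath_def algebra_simps)
    show ?thesis unfolding contour_integral_integral e by (simp add: mult_ac)
  qed
  also have "\<dots> = integral {0..T} (\<lambda>t. \<i> * f (a + \<i> * of_real t))"
    using T by (subst contour_integral_linepath_Reals_eq) auto
  finally show ?thesis by simp
qed

section \<open>The contour integral\<close>

text \<open>The case \<open>f z = 0\<close> has to be covered: the numerator \<open>sigmab\<close>
  is a Dirichlet polynomial and may itself vanish at a zero of zeta.\<close>

lemma residue_quotient_simple_zero:
  assumes f: "f holomorphic_on S" and g: "g holomorphic_on S"
    and S: "open S" "connected S" "z \<in> S"
    and g': "(g has_field_derivative g') (at z)" "g z = 0" "g' \<noteq> 0"
  shows "residue (\<lambda>w. f w / g w) z = f z / g'"
proof (cases "f z = 0")
  case False
  then show ?thesis using residue_simple_pole_deriv[OF f g S g'(1)] g' by blast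
next
  case True
  \<comment> \<open>A point where \<open>g\<close> does not vanish; it is required for the isolation
    of the zero at \<open>z\<close>.\<close>
  obtain b where b: "b \<in> S" "g b \<noteq> 0"
  proof (rule ccontr)
    assume "\<not> thesis"
    then have z0: "g w = 0" if "w \<in> S" for w using that \<open>\<And>b. b \<in> S \<Longrightarrow> g b \<noteq> 0 \<Longrightarrow> thesis\<close> by blast
    have "((\<lambda>_. 0) has_field_derivative g') (at z)"
      by (rule has_field_derivative_transform_within_open[OF g'(1) S(1,3) z0])
    then have "g' = 0" using DERIV_unique[OF _ DERIV_const] by blast
    then show False using g'(3) by simp
  qed
  obtain r where r: "0 < r" "ball z r \<subseteq> S" "\<And>w. w \<in> ball z r - {z} \<Longrightarrow> g w \<noteq> 0"
    using isolated_zeros[OF g S g'(2) b] by blast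
  have fr: "f holomorphic_on ball z r - {z}"
    by (rule holomorphic_on_subset[OF f]) (use r(2) in auto)
  have gr: "g holomorphic_on ball z r - {z}"
    by (rule holomorphic_on_subset[OF g]) (use r(2) in auto)
  have h1: "(\<lambda>w. (f w + 1) / g w) holomorphic_on ball z r - {z}"
    by (rule holomorphic_on_divide[OF holomorphic_on_add[OF fr holomorphic_on_const] gr r(3)])
  have h2: "(\<lambda>w. 1 / g w) holomorphic_on ball z r - {z}"
    by (rule holomorphic_on_divide[OF holomorphic_on_const gr r(3)])
  \<comment> \<open>The library lemma needs a numerator that does not vanish at \<open>z\<close>.\<close>
  have "residue (\<lambda>w. (f w + 1) / g w - 1 / g w) z = residue (\<lambda>w. (f w + 1) / g w) z - residue (\<lambda>w. 1 / g w) z"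
    by (rule residue_diff[OF open_ball _ h1 h2]) (use r(1) in simp)
  also have "residue (\<lambda>w. (f w + 1) / g w) z = (f z + 1) / g'"
    by (rule residue_simple_pole_deriv[OF holomorphic_on_add[OF f holomorphic_on_const] g S g'(1) _ g'(2,3)]) (simp add: True)
  also have "residue (\<lambda>w. 1 / g w) z = 1 / g'"
    by (rule residue_simple_pole_deriv[OF holomorphic_on_const g S g'(1) _ g'(2,3)]) simp
  also have "(\<lambda>w. (f w + 1) / g w - 1 / g w) = (\<lambda>w. f w / g w)"
    by (simp add: fun_eq_iff add_divide_distrib)
  finally show ?thesis by (simp add: add_divide_distrib)
qed

abbreviation "left_pt t \<equiv> - 1 / 2 + \<i> * complex_of_real t"
abbreviation "top_side t \<equiv> linepath (3 / 2 + \<i> * complex_of_real t) (- 1 / 2 + \<i> * complex_of_real t)"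
abbreviation "right_side t \<equiv> linepath (3 / 2) (3 / 2 + \<i> * complex_of_real t)"
abbreviation "zeta_reg_support \<equiv> {s. Re s > - 1} - {s. zeta_reg s = 0}"

context
  fixes \<beta> n :: nat
  assumes \<beta>: "\<beta> \<ge> 1" and n: "n \<ge> 1"
begin

lemma holomorphic_sigmab: "(\<lambda>s. sigmab \<beta> (1 - s / of_nat \<beta>) n) holomorphic_on A"
  unfolding sigmab_def using \<beta> by (intro holomorphic_intros) auto

lemma norm_sigmab_le:
  assumes s: "Re s \<ge> - 1"
  shows "norm (sigmab \<beta> (1 - s / of_nat \<beta>) n) \<le> (\<Sum>d | 1 \<le> d \<and> d ^ \<beta> dvd n. real d powr (real \<beta> + 1))"
  unfolding sigmab_def
proof (rule sum_norm_le)
  fix d assume d: "d \<in> {d. 1 \<le> d \<and> d ^ \<beta> dvd n}"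
  have "of_nat \<beta> * (1 - s / of_nat \<beta>) = of_nat \<beta> - s" using \<beta> by (simp add: field_simps)
  then have "norm ((of_nat d :: complex) powr (of_nat \<beta> * (1 - s / of_nat \<beta>))) = real d powr (real \<beta> - Re s)"
    using d by (simp add: norm_powr_real_powr)
  also have "\<dots> \<le> real d powr (real \<beta> + 1)" using d s by (intro powr_mono) auto
  finally show "norm ((of_nat d :: complex) powr (of_nat \<beta> * (1 - s / of_nat \<beta>))) \<le> real d powr (real \<beta> + 1)" .
qed

text \<open>No exception is needed at \<open>s = 1\<close>: \<open>1 / zeta 1 = 1 / 0 = 0\<close> is the value of \<open>1/\<zeta>\<close> at the pole.\<close>
lemma holomorphic_sigmab_over_zeta:
  "(\<lambda>s. sigmab \<beta> (1 - s / of_nat \<beta>) n / zeta s) holomorphic_on zeta_reg_support"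
proof (rule holomorphic_transform)
  show "(\<lambda>s. sigmab \<beta> (1 - s / of_nat \<beta>) n * (s - 1) / zeta_reg s) holomorphic_on zeta_reg_support"
    by (intro holomorphic_intros holomorphic_sigmab holomorphic_on_subset[OF holomorphic_zeta_reg]) auto
qed (auto simp: zeta_eq_zeta_reg)

lemma holomorphic_integrand:
  "integrand \<beta> n z holomorphic_on zeta_reg_support"
proof -
  have "(\<lambda>s. sigmab \<beta> (1 - s / of_nat \<beta>) n / zeta s * exp (s * z)) holomorphic_on zeta_reg_support"
    by (intro holomorphic_on_mult holomorphic_sigmab_over_zeta) (intro holomorphic_intros)
  then show ?thesis by (rule holomorphic_transform) (simp add: integrand_def)
qed

lemma cq_dirichlet_sums:
  assumes s: "Re s > 1"
  shows "(\<lambda>k. cq \<beta> (Suc k) n * of_nat (Suc k) powr - s) sums (sigmab \<beta> (1 - s / of_nat \<beta>) n / zeta s)"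
proof -
  obtain C where C: "C \<ge> 0" "\<And>q. q \<ge> 1 \<Longrightarrow> norm (cq \<beta> q n) \<le> C" using cq_bounded[OF \<beta> n] by blast
  let ?B = "\<Sum>\<^sub>\<infinity>k\<in>{1..}. cq \<beta> k n * of_nat k powr - s"
  have "((\<lambda>k. cq \<beta> k n * of_nat k powr - s) has_sum ?B) {1..}"
    by (rule has_sum_infsum[OF Infinite_Sum.abs_summable_summable[OF summable_on_bounded_dirichlet[OF s C(2)]]])
  then have sums: "((\<lambda>k. cq \<beta> (Suc k) n * of_nat (Suc k) powr - s) has_sum ?B) UNIV"
    by (rule has_sum_reindex_bij_betw[THEN iffD2, rotated]) (rule bij_betwI[where g = "\<lambda>n. n - 1"], auto)
  moreover have "zeta s * ?B = sigmab \<beta> (1 - s / of_nat \<beta>) n"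
    by (rule zeta_series_mult_cq[OF s zeta_has_sum[OF s] \<beta> n])
  moreover have "zeta s \<noteq> 0" using inverse_zeta_eq_mobius_series[OF s] by auto
  ultimately have "?B = sigmab \<beta> (1 - s / of_nat \<beta>) n / zeta s" by (simp add: nonzero_eq_divide_eq mult.commute)
  then show ?thesis using has_sum_imp_sums[OF sums] by (simp only:)
qed

text \<open>On \<open>Re s > 1\<close> the integrand is a generalised Dirichlet series, which is integrated termwise.\<close>
lemma integrand_primitive:
  assumes z: "Im z > 0"
  obtains G K where "\<And>s. Re s > 1 \<Longrightarrow> (G has_field_derivative integrand \<beta> n z s) (at s)"
    "G (3 / 2) = exp (3 * z / 2) * cq_series \<beta> n z"
    "\<And>t. norm (G (3 / 2 + \<i> * of_real t)) \<le> K * exp (- Im z * t)"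
proof -
  obtain C where C: "C \<ge> 0" "\<And>q. q \<ge> 1 \<Longrightarrow> norm (cq \<beta> q n) \<le> C" using cq_bounded[OF \<beta> n] by blast
  let ?L = "\<lambda>k. complex_of_real (ln (real (Suc k)))"
  let ?S = "{s. Re s > 1}"
  let ?g = "\<lambda>k s. cq \<beta> (Suc k) n / (z - ?L k) * exp (s * (z - ?L k))"
  let ?g' = "\<lambda>k s. cq \<beta> (Suc k) n * exp (s * (z - ?L k))"
  \<comment> \<open>All \<open>ln q\<close> are real, so a point of the upper half plane keeps the
    distance \<open>Im z\<close> from every one of them. This makes the bounds on the primitives
    uniform in \<open>k\<close>.\<close>
  have zL: "Im z \<le> norm (z - ?L k)" for k
    using abs_Im_le_cmod[of "z - ?L k"] by simp
  have ne: "z - ?L k \<noteq> 0" for k using zL[of k] z by auto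
  have expL: "exp (s * (z - ?L k)) = exp (s * z) * of_nat (Suc k) powr - s" for s k
  proof -
    have "Ln (of_nat (Suc k)) = ?L k" by (metis Ln_of_real of_nat_0_less_iff of_real_of_nat_eq zero_less_Suc)
    moreover have "of_nat (Suc k) \<noteq> (0::complex)" by (rule of_nat_neq_0)
    ultimately have "of_nat (Suc k) powr - s = exp (- s * ?L k)" by (simp only: powr_def if_False)
    moreover have "s * (z - ?L k) = s * z + - s * ?L k" by (simp add: algebra_simps)
    ultimately show ?thesis by (simp only: exp_add)
  qed
  have normg: "norm (?g k s) \<le> C / Im z * exp (Re (s * z)) * real (Suc k) powr - Re s" for k s
  proof -
    have "norm (?g k s) = norm (cq \<beta> (Suc k) n) / norm (z - ?L k) * (exp (Re (s * z)) * real (Suc k) powr - Re s)"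
      unfolding expL by (simp add: norm_mult norm_divide norm_exp_eq_Re norm_powr_real_powr del: of_nat_Suc)
    also have "\<dots> \<le> C / Im z * (exp (Re (s * z)) * real (Suc k) powr - Re s)"
      by (intro mult_right_mono frac_le C zL z) auto
    finally show ?thesis by (simp add: mult.assoc)
  qed
  have "\<exists>G G'. \<forall>s\<in>?S. (\<lambda>k. ?g k s) sums G s \<and> (\<lambda>k. ?g' k s) sums G' s \<and> (G has_field_derivative G' s) (at s)"
  proof (rule series_and_derivative_comparison_local)
    show "open ?S" by (rule open_halfspace_Re_gt)
    show "(?g k has_field_derivative ?g' k s) (at s)" for k s
      using ne[of k] by (auto intro!: derivative_eq_intros)
    fix x assume "x \<in> ?S"
    then have x: "Re x > 1" by simp
    define d where "d = (Re x - 1) / 2"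
    have d: "d > 0" "Re x - d > 1" using x by (simp_all add: d_def field_simps)
    let ?h = "\<lambda>k. C / Im z * exp ((norm x + d) * norm z) * real (Suc k) powr - (Re x - d)"
    have "norm (?g k y) \<le> ?h k" if y: "y \<in> ball x d" for k y
    proof -
      have "\<bar>Re (x - y)\<bar> \<le> norm (x - y)" by (rule abs_Re_le_cmod)
      then have Rey: "Re y \<ge> Re x - d" using y by (auto simp: dist_norm)
      have "norm y \<le> norm x + d"
        using y norm_triangle_ineq2[of y x] by (auto simp: dist_norm norm_minus_commute)
      then have "norm y * norm z \<le> (norm x + d) * norm z" by (intro mult_right_mono) auto
      then have "Re (y * z) \<le> (norm x + d) * norm z"
        using complex_Re_le_cmod[of "y * z"] by (simp add: norm_mult)
      then have "C / Im z * exp (Re (y * z)) * real (Suc k) powr - Re y \<le> ?h k"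
        by (intro mult_mono powr_mono) (use Rey C z in auto)
      then show ?thesis using normg[of k y] by linarith
    qed
    moreover have "summable ?h" by (rule summable_mult[OF summable_Suc_powr]) (use d in simp)
    ultimately show "\<exists>d h. 0 < d \<and> summable h \<and> (\<forall>\<^sub>F k in sequentially. \<forall>y\<in>ball x d \<inter> ?S. norm (?g k y) \<le> h k)"
      using d(1) by (intro exI[of _ d] exI[of _ ?h] conjI always_eventually) auto
  qed
  then obtain G G' where G: "\<And>s. Re s > 1 \<Longrightarrow> (\<lambda>k. ?g k s) sums G s"
    and G': "\<And>s. Re s > 1 \<Longrightarrow> (\<lambda>k. ?g' k s) sums G' s"
    and D: "\<And>s. Re s > 1 \<Longrightarrow> (G has_field_derivative G' s) (at s)" by blast
  have G'_eq: "G' s = integrand \<beta> n z s" if s: "Re s > 1" for s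
  proof -
    have "(\<lambda>k. exp (s * z) * (cq \<beta> (Suc k) n * of_nat (Suc k) powr - s)) sums (exp (s * z) * (sigmab \<beta> (1 - s / of_nat \<beta>) n / zeta s))"
      by (rule sums_mult[OF cq_dirichlet_sums[OF s]])
    also have "(\<lambda>k. exp (s * z) * (cq \<beta> (Suc k) n * of_nat (Suc k) powr - s)) = (\<lambda>k. ?g' k s)"
      unfolding expL by (simp only: mult_ac)
    finally have "G' s = exp (s * z) * (sigmab \<beta> (1 - s / of_nat \<beta>) n / zeta s)"
      by (rule sums_unique2[OF G'[OF s]])
    then show ?thesis by (simp add: integrand_def)
  qed
  show thesis
  proof (rule that)
    show "(G has_field_derivative integrand \<beta> n z s) (at s)" if "Re s > 1" for s
      using D[OF that] G'_eq[OF that] by simp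
    \<comment> \<open>The factor \<open>exp (- (3 / 2) * ln q)\<close> of the primitive is the
      source of the denominator \<open>q powr (3 / 2)\<close> in \<open>cq_series\<close>.\<close>
    have "?g k (3 / 2) = exp (3 * z / 2) * cq_term \<beta> n k z" for k
    proof -
      have "(of_nat (Suc k) :: complex) powr - (3 / 2) = of_real (real (Suc k) powr - (3 / 2))"
        using of_nat_powr_of_real[of k "- (3 / 2)"] by simp
      also have "\<dots> = 1 / of_real (real (Suc k) powr (3 / 2))"
        by (simp add: powr_minus_divide del: of_nat_Suc)
      finally have p: "(of_nat (Suc k) :: complex) powr - (3 / 2) = 1 / of_real (real (Suc k) powr (3 / 2))" .
      have "3 / 2 * z = 3 * z / 2" by simp
      then show ?thesis unfolding expL p cq_term_def by (simp add: mult_ac del: of_nat_Suc)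
    qed
    then have "(\<lambda>k. exp (3 * z / 2) * cq_term \<beta> n k z) sums G (3 / 2)"
      using G[of "3 / 2"] by simp
    moreover have "(\<lambda>k. exp (3 * z / 2) * cq_term \<beta> n k z) sums (exp (3 * z / 2) * cq_series \<beta> n z)"
      unfolding cq_series_eq by (intro sums_mult summable_sums summable_cq_term[OF C])
    ultimately show "G (3 / 2) = exp (3 * z / 2) * cq_series \<beta> n z" by (rule sums_unique2)
    fix t :: real
    let ?s = "3 / 2 + \<i> * of_real t"
    have Re: "Re (?s * z) = 3 / 2 * Re z + - Im z * t" by simp
    have "norm (G ?s) = norm (\<Sum>k. ?g k ?s)"
      using sums_unique[OF G[of ?s]] by simp
    also have "\<dots> \<le> (\<Sum>k. C / Im z * exp (Re (?s * z)) * real (Suc k) powr - Re ?s)"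
      by (rule norm_suminf_le[OF normg summable_mult[OF summable_Suc_powr]]) simp
    also have "\<dots> = C / Im z * exp (Re (?s * z)) * (\<Sum>k. real (Suc k) powr - Re ?s)"
      by (rule suminf_mult[OF summable_Suc_powr]) simp
    also have "\<dots> = C / Im z * exp (3 / 2 * Re z) * (\<Sum>k. real (Suc k) powr - (3 / 2)) * exp (- Im z * t)"
      unfolding Re exp_add by simp
    finally show "norm (G ?s) \<le> C / Im z * exp (3 / 2 * Re z) * (\<Sum>k. real (Suc k) powr - (3 / 2)) * exp (- Im z * t)" .
  qed
qed

section \<open>The left side and the functions \<open>varpi1\<close> and
  \<open>varpi2\<close>\<close>

lemma continuous_on_left_line:
  "continuous_on A (\<lambda>t::real. sigmab \<beta> (1 - (left_pt t) / of_nat \<beta>) n / zeta (left_pt t))"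
proof (rule continuous_on_compose2[OF holomorphic_on_imp_continuous_on[OF holomorphic_sigmab_over_zeta]])
  show "continuous_on A (\<lambda>t::real. left_pt t)" by (intro continuous_intros)
  show "(\<lambda>t::real. left_pt t) ` A \<subseteq> zeta_reg_support"
  proof
    fix s assume "s \<in> (\<lambda>t::real. left_pt t) ` A"
    then have "Re s = - 1 / 2" by auto
    then show "s \<in> zeta_reg_support" using zeta_reg_zeros[of s] by auto
  qed
qed

lemma continuous_on_integrand_left_line:
  "continuous_on A (\<lambda>t::real. integrand \<beta> n z (left_pt t))"
  unfolding integrand_def by (intro continuous_on_mult continuous_on_left_line continuous_intros)

text \<open>One constant \<open>M\<close> serves all \<open>z\<close> and \<open>t\<close>, because
  \<open>sigmab\<close> and \<open>1 / zeta\<close> are bounded on the line and do not involve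
  \<open>z\<close>. This is what later gives tails that are small locally uniformly in
  \<open>z\<close>.\<close>

lemma norm_integrand_left_line_le:
  obtains M where "M \<ge> 0"
    "\<And>z t. norm (integrand \<beta> n z (left_pt t)) \<le> M * exp (- Re z / 2) * exp (- Im z * t)"
proof -
  obtain C where C: "\<And>s. Re s = - 1 / 2 \<Longrightarrow> norm (inverse (zeta s)) \<le> C" using inverse_zeta_bounded_left_line by blast
  define Sb where "Sb = (\<Sum>d | 1 \<le> d \<and> d ^ \<beta> dvd n. real d powr (real \<beta> + 1))"
  have C0: "0 \<le> C" using order_trans[OF norm_ge_zero C[of "- 1 / 2"]] by simp
  have Sb0: "0 \<le> Sb" unfolding Sb_def by (rule sum_nonneg) simp
  show thesis
  proof (rule that[of "Sb * C"])
    show "0 \<le> Sb * C" using C0 Sb0 by simp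
    fix z :: complex and t :: real
    let ?s = "left_pt t"
    have "Re (?s * z) = - Re z / 2 + - Im z * t" by (simp add: algebra_simps)
    then have e: "norm (exp (?s * z)) = exp (- Re z / 2) * exp (- Im z * t)"
      by (simp only: norm_exp_eq_Re exp_add)
    have div: "u / v * w = u * inverse v * w" for u v w :: complex by (simp add: divide_inverse)
    have "norm (integrand \<beta> n z ?s) = norm (sigmab \<beta> (1 - ?s / of_nat \<beta>) n) * norm (inverse (zeta ?s)) * (exp (- Re z / 2) * exp (- Im z * t))"
      by (simp only: integrand_def div norm_mult e)
    also have "\<dots> \<le> Sb * C * (exp (- Re z / 2) * exp (- Im z * t))"
    proof (rule mult_right_mono[OF mult_mono[OF _ _ Sb0 norm_ge_zero]])
      show "norm (sigmab \<beta> (1 - ?s / of_nat \<beta>) n) \<le> Sb" unfolding Sb_def by (rule norm_sigmab_le) simp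
      show "norm (inverse (zeta ?s)) \<le> C" by (rule C) simp
    qed simp
    finally show "norm (integrand \<beta> n z ?s) \<le> Sb * C * exp (- Re z / 2) * exp (- Im z * t)" by (simp add: mult.assoc)
  qed
qed

lemma integrable_integrand_left_line:
  assumes z: "Im z > 0"
  shows "(\<lambda>t::real. integrand \<beta> n z (left_pt t)) integrable_on {0..}"
proof -
  obtain M where "M \<ge> 0"
    "\<And>z t. norm (integrand \<beta> n z (left_pt t)) \<le> M * exp (- Re z / 2) * exp (- Im z * t)"
    using norm_integrand_left_line_le by blast
  then show ?thesis by (intro continuous_on_imp_integrable_Ici(1)[OF continuous_on_integrand_left_line z]) auto
qed

lemma varpi1_limit:
  assumes z: "Im z > 0" and T: "filterlim T at_top sequentially"
  shows "(\<lambda>m. - (\<i> * integral {0..T m} (\<lambda>t::real. integrand \<beta> n z (left_pt t)))) \<longlonglongrightarrow> varpi1 \<beta> n z"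
proof -
  let ?f = "\<lambda>t::real. integrand \<beta> n z (left_pt t)"
  obtain M where M: "M \<ge> 0"
    "\<And>z t. norm (integrand \<beta> n z (left_pt t)) \<le> M * exp (- Re z / 2) * exp (- Im z * t)"
    using norm_integrand_left_line_le by blast
  have "((\<lambda>T::real. M * exp (- Re z / 2) * (exp (- Im z * T) / Im z)) \<longlongrightarrow> 0) at_top"
    using z by real_asymp
  then have lim0: "(\<lambda>m. M * exp (- Re z / 2) * (exp (- Im z * T m) / Im z)) \<longlonglongrightarrow> 0"
    by (rule filterlim_compose[OF _ T])
  have "(\<lambda>m. integral {0..} ?f - integral {0..T m} ?f) \<longlonglongrightarrow> 0"
  proof (rule Lim_null_comparison[OF _ lim0])
    have "\<forall>\<^sub>F m in sequentially. T m \<ge> 0" using T by (simp add: filterlim_at_top)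
    then show "\<forall>\<^sub>F m in sequentially. norm (integral {0..} ?f - integral {0..T m} ?f) \<le> M * exp (- Re z / 2) * (exp (- Im z * T m) / Im z)"
      by eventually_elim (rule norm_integral_Ici_diff_le[OF continuous_on_integrand_left_line z], use M in auto)
  qed
  then have "(\<lambda>m. integral {0..} ?f - (integral {0..} ?f - integral {0..T m} ?f)) \<longlonglongrightarrow> integral {0..} ?f - 0"
    by (intro tendsto_intros)
  then have "(\<lambda>m. integral {0..T m} ?f) \<longlonglongrightarrow> integral {0..} ?f" by simp
  then show ?thesis unfolding varpi1_def by (intro tendsto_intros)
qed

lemma holomorphic_varpi1: "varpi1 \<beta> n holomorphic_on {z. 0 < Im z}"
proof -
  let ?f = "\<lambda>z t. integrand \<beta> n z (left_pt t)"
  obtain M where M: "M \<ge> 0"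
    "\<And>z t. norm (?f z t) \<le> M * exp (- Re z / 2) * exp (- Im z * t)"
    using norm_integrand_left_line_le by blast
  have hol: "(\<lambda>z. integral {0..} (?f z)) holomorphic_on {z. 0 < Im z}"
  proof (rule holomorphic_uniform_sequence[OF open_halfspace_Im_gt])
    show "(\<lambda>z. integral {0..real m} (?f z)) holomorphic_on {z. 0 < Im z}" for m :: nat
      unfolding integrand_def
      by (rule holomorphic_on_subset[OF holomorphic_integral_exp[OF continuous_on_left_line]]) (auto intro!: continuous_intros)
    fix z0 assume z0: "z0 \<in> {z. 0 < Im z}"
    \<comment> \<open>With this radius \<open>Im z \<ge> d\<close> on the whole ball, so all tails
      there obey one exponential bound.\<close>
    define d where "d = Im z0 / 2"
    have d: "d > 0" using z0 by (simp add: d_def)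
    define K where "K = M * exp ((\<bar>Re z0\<bar> + d) / 2)"
    have near: "Im z \<ge> d" "- Re z \<le> \<bar>Re z0\<bar> + d" if "z \<in> cball z0 d" for z
      using that abs_Im_le_cmod[of "z0 - z"] abs_Re_le_cmod[of "z0 - z"] by (auto simp: dist_norm d_def)
    have bd: "norm (?f z t) \<le> K * exp (- d * t)" if z: "z \<in> cball z0 d" and t: "t \<ge> 0" for z t
    proof -
      have "d * t \<le> Im z * t" using near(1)[OF z] t by (rule mult_right_mono)
      then have "M * exp (- Re z / 2) * exp (- Im z * t) \<le> M * exp ((\<bar>Re z0\<bar> + d) / 2) * exp (- d * t)"
        by (intro mult_mono) (use near(2)[OF z] M(1) in auto)
      then show ?thesis using M(2)[of z t] by (simp add: K_def)
    qed
    have "uniform_limit (cball z0 d) (\<lambda>m z. integral {0..real m} (?f z)) (\<lambda>z. integral {0..} (?f z)) sequentially"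
    proof (rule uniform_limitI)
      fix e :: real assume e: "e > 0"
      have "((\<lambda>T::real. K * (exp (- d * T) / d)) \<longlongrightarrow> 0) at_top" using d by real_asymp
      then have "(\<lambda>m. K * (exp (- d * real m) / d)) \<longlonglongrightarrow> 0"
        by (rule filterlim_compose[OF _ filterlim_real_sequentially])
      then have "\<forall>\<^sub>F m in sequentially. K * (exp (- d * real m) / d) < e" using e by (rule order_tendstoD(2))
      then show "\<forall>\<^sub>F m in sequentially. \<forall>z\<in>cball z0 d. dist (integral {0..real m} (?f z)) (integral {0..} (?f z)) < e"
      proof eventually_elim
        case (elim m)
        show ?case
        proof
          fix z assume z: "z \<in> cball z0 d"
          have "norm (integral {0..} (?f z) - integral {0..real m} (?f z)) \<le> K * (exp (- d * real m) / d)"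
            by (rule norm_integral_Ici_diff_le[OF continuous_on_integrand_left_line d _ bd[OF z]]) auto
          then show "dist (integral {0..real m} (?f z)) (integral {0..} (?f z)) < e"
            using elim by (simp add: dist_norm norm_minus_commute)
        qed
      qed
    qed
    moreover have "cball z0 d \<subseteq> {z. 0 < Im z}" using near(1) d by (auto intro: less_le_trans)
    ultimately show "\<exists>d>0. cball z0 d \<subseteq> {z. 0 < Im z} \<and>
       uniform_limit (cball z0 d) (\<lambda>m z. integral {0..real m} (?f z)) (\<lambda>z. integral {0..} (?f z)) sequentially"
      using d by (intro exI[of _ d] conjI)
  qed
  have "(\<lambda>z. - (\<i> * integral {0..} (?f z))) holomorphic_on {z. 0 < Im z}"
    by (rule holomorphic_on_minus[OF holomorphic_on_mult[OF holomorphic_on_const hol]])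
  then show ?thesis by (rule holomorphic_transform) (simp add: varpi1_def)
qed

lemma holomorphic_varpi2: "varpi2 \<beta> n holomorphic_on UNIV"
proof -
  have "continuous_on {- 1/2..3/2} (\<lambda>x::real. sigmab \<beta> (1 - of_real x / of_nat \<beta>) n / zeta (of_real x))"
  proof (rule continuous_on_compose2[OF holomorphic_on_imp_continuous_on[OF holomorphic_sigmab_over_zeta]])
    show "continuous_on {- 1/2..3/2} complex_of_real" by (intro continuous_intros)
    show "complex_of_real ` {- 1/2..3/2} \<subseteq> zeta_reg_support"
    proof
      fix s assume "s \<in> complex_of_real ` {- 1/2..3/2}"
      then have "Re s > - 1" "Im s = 0" by auto
      then show "s \<in> zeta_reg_support" using zeta_reg_zeros(3)[of s] by auto
    qed
  qed
  then have "(\<lambda>z. integral {- 1/2..3/2} (\<lambda>x::real. sigmab \<beta> (1 - of_real x / of_nat \<beta>) n / zeta (of_real x) * exp (of_real x * z))) holomorphic_on UNIV"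
    by (rule holomorphic_integral_exp) (intro continuous_intros)
  then show ?thesis by (rule holomorphic_transform) (simp add: varpi2_def integrand_def)
qed

section \<open>Residues and the rectangle\<close>

lemma nontrivial_zero_iff: "nontrivial_zero \<rho> \<longleftrightarrow> zeta_reg \<rho> = 0 \<and> Re \<rho> > - 1"
proof
  assume "nontrivial_zero \<rho>"
  then show "zeta_reg \<rho> = 0 \<and> Re \<rho> > - 1" by (auto simp: nontrivial_zero_def zeta_eq_zeta_reg)
next
  assume "zeta_reg \<rho> = 0 \<and> Re \<rho> > - 1"
  then show "nontrivial_zero \<rho>" using zeta_reg_zeros[of \<rho>] by (auto simp: nontrivial_zero_def zeta_eq_zeta_reg)
qed

lemma residue_integrand:
  assumes \<rho>: "nontrivial_zero \<rho>" and simple: "deriv zeta \<rho> \<noteq> 0"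
  shows "residue (integrand \<beta> n z) \<rho> = sigmab \<beta> (1 - \<rho> / of_nat \<beta>) n / deriv zeta \<rho> * exp (\<rho> * z)"
proof -
  let ?S = "{s. 0 < Re s \<and> Re s < 1}"
  have zeta: "zeta holomorphic_on ?S"
    unfolding zeta_eq by (intro holomorphic_intros holomorphic_on_subset[OF holomorphic_zeta_reg_ext]) auto
  have \<rho>S: "\<rho> \<in> ?S" "zeta \<rho> = 0" using \<rho> by (auto simp: nontrivial_zero_def)
  have "residue (\<lambda>s. sigmab \<beta> (1 - s / of_nat \<beta>) n * exp (s * z) / zeta s) \<rho>
      = sigmab \<beta> (1 - \<rho> / of_nat \<beta>) n * exp (\<rho> * z) / deriv zeta \<rho>"
    by (rule residue_quotient_simple_zero[OF _ zeta open_vertical_strip convex_connected[OF convex_vertical_strip] \<rho>S(1)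
          holomorphic_derivI[OF zeta open_vertical_strip \<rho>S(1)] \<rho>S(2) simple])
       (intro holomorphic_intros holomorphic_sigmab)
  then show ?thesis by (simp add: integrand_def[abs_def])
qed

text \<open>The residue theorem on the rectangle; the zeros inside it are those counted by
  \<open>varpi_partial\<close>. The second conclusion rests on the same geometric facts and is what
  the later estimate of the top side starts from.\<close>

lemma contour_identity:
  assumes simple: "\<And>\<rho>. nontrivial_zero \<rho> \<Longrightarrow> deriv zeta \<rho> \<noteq> 0"
    and T: "T > 0" and top: "\<And>\<sigma>. \<sigma> \<in> {- 1..2} \<Longrightarrow> zeta (of_real \<sigma> + \<i> * of_real T) \<noteq> 0"
  shows "2 * pi * \<i> * varpi_partial \<beta> n T z = varpi2 \<beta> n z
     + contour_integral (right_side T) (integrand \<beta> n z)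
     + contour_integral (top_side T) (integrand \<beta> n z)
     - \<i> * integral {0..T} (\<lambda>t. integrand \<beta> n z (left_pt t))"
    and "integrand \<beta> n z contour_integrable_on top_side T"
proof -
  define a1 a2 a3 a4 :: complex where "a1 = - 1 / 2" and "a2 = 3 / 2"
    and "a3 = 3 / 2 + \<i> * of_real T" and "a4 = - 1 / 2 + \<i> * of_real T"
  let ?f = "integrand \<beta> n z"
  let ?R = "rectpath a1 a3"
  \<comment> \<open>An open box with some margin around the rectangle. Its left edge
    \<open>- 3 / 4\<close> stays inside \<open>Re s > -1\<close>, and the compact version
    \<open>K\<close> makes the set of zeros finite.\<close>
  define B where "B = box (Complex (- 3 / 4) (- 1)) (Complex 2 (T + 1))"
  define K where "K = cbox (Complex (- 3 / 4) (- 1)) (Complex 2 (T + 1))"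
  define pts where "pts = {s\<in>K. zeta_reg s = 0}"
  let ?H = "{s. Re s > - 1}"
  have R: "?R = linepath a1 a2 +++ linepath a2 a3 +++ linepath a3 a4 +++ linepath a4 a1"
    by (simp add: rectpath_def Let_def a1_def a2_def a3_def a4_def complex_eq_iff
        Complex_eq[symmetric]) (simp add: Complex_eq)
  have BK: "B \<subseteq> K" unfolding B_def K_def by (rule box_subset_cbox)
  have KH: "K \<subseteq> ?H" by (auto simp: K_def in_cbox_complex_iff)
  have H: "open ?H" "connected ?H"
    by (rule open_Re_gt_minus_1) (rule convex_connected[OF convex_halfspace_Re_gt])
  have nonconst: "\<not> zeta_reg constant_on ?H"
  proof
    assume "zeta_reg constant_on ?H"
    then obtain c where "\<And>s. Re s > - 1 \<Longrightarrow> zeta_reg s = c" by (auto simp: constant_on_def)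
    from this[of 0] this[of 1] show False by (simp add: zeta_reg_0 zeta_reg_1)
  qed
  have fin: "finite pts" unfolding pts_def
    by (rule holomorphic_compact_finite_zeros[OF holomorphic_zeta_reg H _ KH nonconst]) (simp add: K_def)
  have hol: "?f holomorphic_on B - pts"
    by (rule holomorphic_on_subset[OF holomorphic_integrand]) (use BK KH in \<open>auto simp: pts_def\<close>)
  \<comment> \<open>Only the top side needs the hypothesis on \<open>T\<close>; the other three
    sides avoid all zeros by \<open>zeta_reg_zeros\<close>.\<close>
  have zeroT: "Im p \<noteq> T" if "p \<in> pts" for p
  proof
    assume p: "Im p = T"
    have z0: "zeta_reg p = 0" "Re p > - 1" using that KH by (auto simp: pts_def)
    then have "0 < Re p" "Re p < 1" using zeta_reg_zeros[of p] by auto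
    moreover have "p = of_real (Re p) + \<i> * of_real T" using p by (simp add: complex_eq_iff)
    ultimately have "zeta p \<noteq> 0" using top[of "Re p"] by simp
    then show False using z0 by (simp add: zeta_eq_zeta_reg)
  qed
  have zero_in: "0 < Re p" "Re p < 1" "Im p \<noteq> 0" if "p \<in> pts" for p
    using zeta_reg_zeros[of p] that KH by (auto simp: pts_def)
  have Re_Im: "Re a1 = - 1 / 2" "Im a1 = 0" "Re a3 = 3 / 2" "Im a3 = T"
    by (simp_all add: a1_def a3_def)
  have le: "Re a1 \<le> Re a3" "Im a1 \<le> Im a3" using T by (simp_all add: Re_Im)
  have cboxB: "cbox a1 a3 \<subseteq> B" using T by (auto simp: B_def in_cbox_complex_iff in_box_complex_iff Re_Im)
  have img: "path_image ?R \<subseteq> B - pts"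
  proof
    fix s assume s: "s \<in> path_image ?R"
    have "s \<in> B" using s path_image_rectpath_subset_cbox[OF le] cboxB by blast
    moreover have "s \<notin> pts"
    proof
      assume "s \<in> pts"
      then show False using s zeroT[of s] zero_in[of s] unfolding path_image_rectpath[OF le] Re_Im by auto
    qed
    ultimately show "s \<in> B - pts" by simp
  qed
  have segs: "closed_segment a1 a2 \<subseteq> B - pts" "closed_segment a2 a3 \<subseteq> B - pts"
    "closed_segment a3 a4 \<subseteq> B - pts" "closed_segment a4 a1 \<subseteq> B - pts"
    using img unfolding R by (auto simp: path_image_join)
  have cont: "continuous_on (closed_segment u v) ?f" if "closed_segment u v \<subseteq> B - pts" for u v
    by (rule continuous_on_subset[OF holomorphic_on_imp_continuous_on[OF hol] that])
  have int: "?f contour_integrable_on linepath u v" if "closed_segment u v \<subseteq> B - pts" for u v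
    by (rule contour_integrable_continuous_linepath[OF cont[OF that]])
  show "?f contour_integrable_on top_side T"
    using int[OF segs(3)] by (simp only: a3_def a4_def)
  have "contour_integral ?R ?f = 2 * pi * \<i> * (\<Sum>p\<in>pts. winding_number ?R p * residue ?f p)"
  proof (rule Residue_theorem[OF _ _ fin hol _ _ img])
    show "open B" unfolding B_def by (rule open_box)
    show "connected B" by (simp add: B_def convex_connected convex_box)
    show "valid_path ?R" by simp
    show "pathfinish ?R = pathstart ?R" by simp
    show "\<forall>z. z \<notin> B \<longrightarrow> winding_number ?R z = 0"
      using winding_number_rectpath_outside[OF le] cboxB by blast
  qed
  also have "(\<Sum>p\<in>pts. winding_number ?R p * residue ?f p) = varpi_partial \<beta> n T z"
    unfolding varpi_partial_def
  proof (rule sum.mono_neutral_cong_right[OF fin])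
    show "{\<rho>. nontrivial_zero \<rho> \<and> 0 < Im \<rho> \<and> Im \<rho> < T} \<subseteq> pts"
    proof
      fix p assume p: "p \<in> {\<rho>. nontrivial_zero \<rho> \<and> 0 < Im \<rho> \<and> Im \<rho> < T}"
      then have "zeta_reg p = 0" "Re p > - 1" by (auto simp: nontrivial_zero_iff)
      moreover from this have "0 < Re p" "Re p < 1" using zeta_reg_zeros[of p] by auto
      ultimately show "p \<in> pts" using p by (auto simp: pts_def K_def in_cbox_complex_iff)
    qed
    \<comment> \<open>Zeros in the margin, below the real axis or above height \<open>T\<close>, lie
      outside the rectangle and have winding number 0.\<close>
    show "\<forall>p\<in>pts - {\<rho>. nontrivial_zero \<rho> \<and> 0 < Im \<rho> \<and> Im \<rho> < T}. winding_number ?R p * residue ?f p = 0"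
    proof
      fix p assume p: "p \<in> pts - {\<rho>. nontrivial_zero \<rho> \<and> 0 < Im \<rho> \<and> Im \<rho> < T}"
      then have "nontrivial_zero p" using KH by (auto simp: nontrivial_zero_iff pts_def)
      then have "p \<notin> cbox a1 a3"
        using p zeroT[of p] zero_in[of p] by (auto simp: in_cbox_complex_iff Re_Im)
      then show "winding_number ?R p * residue ?f p = 0"
        using winding_number_rectpath_outside[OF le] by simp
    qed
    fix p assume p: "p \<in> {\<rho>. nontrivial_zero \<rho> \<and> 0 < Im \<rho> \<and> Im \<rho> < T}"
    then have "p \<in> box a1 a3" by (auto simp: nontrivial_zero_def in_box_complex_iff Re_Im)
    then have "winding_number ?R p = 1" by (rule winding_number_rectpath)
    then show "winding_number ?R p * residue ?f p = sigmab \<beta> (1 - p / of_nat \<beta>) n / deriv zeta p * exp (p * z)"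
      using p residue_integrand[of p z] simple[of p] by simp
  qed
  finally have 1: "contour_integral ?R ?f = 2 * pi * \<i> * varpi_partial \<beta> n T z" .
  have "contour_integral ?R ?f = contour_integral (linepath a1 a2) ?f + (contour_integral (linepath a2 a3) ?f
      + (contour_integral (linepath a3 a4) ?f + contour_integral (linepath a4 a1) ?f))"
    unfolding R by (simp add: int segs contour_integrable_joinI)
  moreover have "contour_integral (linepath a1 a2) ?f = varpi2 \<beta> n z"
  proof -
    have "a1 = of_real (- 1 / 2)" "a2 = of_real (3 / 2)" by (simp_all add: a1_def a2_def)
    then have a: "a1 \<in> \<real>" "a2 \<in> \<real>" and r: "Re a1 = - 1 / 2" "Re a2 = 3 / 2"
      by (simp_all only: Reals_of_real Re_complex_of_real)
    have "Re a1 < Re a2" by (simp add: r)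
    then show ?thesis by (simp only: varpi2_def contour_integral_linepath_Reals_eq[OF a] r)
  qed
  moreover have "contour_integral (linepath a4 a1) ?f = - (\<i> * integral {0..T} (\<lambda>t. ?f (left_pt t)))"
    unfolding contour_integral_reverse_linepath[OF cont[OF segs(4)]]
    using contour_integral_vertical_linepath[OF T, of "- 1 / 2" ?f] by (simp add: a1_def a4_def)
  ultimately have "2 * pi * \<i> * varpi_partial \<beta> n T z = varpi2 \<beta> n z + (contour_integral (linepath a2 a3) ?f
      + (contour_integral (linepath a3 a4) ?f + - (\<i> * integral {0..T} (\<lambda>t. ?f (left_pt t)))))"
    using 1 by (simp only:)
  then show "2 * pi * \<i> * varpi_partial \<beta> n T z = varpi2 \<beta> n z
     + contour_integral (right_side T) ?f
     + contour_integral (top_side T) ?f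
     - \<i> * integral {0..T} (\<lambda>t. ?f (left_pt t))"
    unfolding a2_def a3_def a4_def by (simp only: add.assoc diff_conv_add_uminus)
qed

text \<open>The primitive decays at the upper end, so what remains is minus its value at the lower
  end \<open>3 / 2\<close>, which is the series.\<close>

lemma right_integral_limit:
  assumes z: "Im z > 0" and T: "filterlim T at_top sequentially"
  shows "(\<lambda>m. contour_integral (right_side (T m)) (integrand \<beta> n z))
    \<longlonglongrightarrow> - (exp (3 * z / 2) * cq_series \<beta> n z)"
proof -
  obtain G K where G: "\<And>s. Re s > 1 \<Longrightarrow> (G has_field_derivative integrand \<beta> n z s) (at s)"
    "G (3 / 2) = exp (3 * z / 2) * cq_series \<beta> n z"
    "\<And>t. norm (G (3 / 2 + \<i> * of_real t)) \<le> K * exp (- Im z * t)" using integrand_primitive[OF z] by blast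
  have eq: "contour_integral (right_side t) (integrand \<beta> n z) = G (3 / 2 + \<i> * of_real t) - G (3 / 2)" for t
  proof -
    have "closed_segment (3 / 2) (3 / 2 + \<i> * of_real t) \<subseteq> {s. Re s > 1}"
      by (intro closed_segment_subset convex_halfspace_Re_gt) auto
    then have "(integrand \<beta> n z has_contour_integral (G (pathfinish (right_side t))
        - G (pathstart (right_side t)))) (right_side t)"
      by (intro contour_integral_primitive[of "{s. Re s > 1}"])
         (simp_all only: path_image_linepath valid_path_linepath mem_Collect_eq has_field_derivative_at_within[OF G(1)])
    then show ?thesis by (simp add: contour_integral_unique)
  qed
  have "((\<lambda>t::real. K * exp (- Im z * t)) \<longlongrightarrow> 0) at_top" using z by real_asymp
  then have "(\<lambda>m. K * exp (- Im z * T m)) \<longlonglongrightarrow> 0" by (rule filterlim_compose[OF _ T])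
  then have "(\<lambda>m. G (3 / 2 + \<i> * of_real (T m))) \<longlonglongrightarrow> 0"
    by (rule Lim_null_comparison[rotated]) (rule always_eventually, rule allI, rule G(3))
  then have "(\<lambda>m. G (3 / 2 + \<i> * of_real (T m)) - G (3 / 2)) \<longlonglongrightarrow> 0 - G (3 / 2)" by (intro tendsto_intros)
  then show ?thesis unfolding eq G(2) by simp
qed

lemma top_integral_limit:
  assumes z: "Im z > 0" and T: "filterlim T at_top sequentially"
    and int: "\<forall>\<^sub>F m in sequentially. integrand \<beta> n z contour_integrable_on top_side (T m)"
    and bd: "\<forall>\<^sub>F m in sequentially. \<forall>\<sigma>\<in>{- 1..2}. norm (inverse (zeta (of_real \<sigma> + \<i> * of_real (T m)))) \<le> T m powr c"
  shows "(\<lambda>m. contour_integral (top_side (T m)) (integrand \<beta> n z)) \<longlonglongrightarrow> 0"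
proof -
  define Sb where "Sb = (\<Sum>d | 1 \<le> d \<and> d ^ \<beta> dvd n. real d powr (real \<beta> + 1))"
  have Sb0: "0 \<le> Sb" unfolding Sb_def by (rule sum_nonneg) simp
  \<comment> \<open>The 2 in the exponent bounds the modulus of \<open>Re s\<close> on the range
    from -1 to 2; the last factor 2 is the length of the side.\<close>
  have "((\<lambda>t::real. Sb * t powr c * (exp (2 * \<bar>Re z\<bar>) * exp (- Im z * t)) * 2) \<longlongrightarrow> 0) at_top" using z by real_asymp
  then have lim: "(\<lambda>m. Sb * T m powr c * (exp (2 * \<bar>Re z\<bar>) * exp (- Im z * T m)) * 2) \<longlonglongrightarrow> 0"
    by (rule filterlim_compose[OF _ T])
  show ?thesis
  proof (rule Lim_null_comparison[OF _ lim])
    show "\<forall>\<^sub>F m in sequentially. norm (contour_integral (top_side (T m)) (integrand \<beta> n z))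
        \<le> Sb * T m powr c * (exp (2 * \<bar>Re z\<bar>) * exp (- Im z * T m)) * 2"
      using int bd
    proof eventually_elim
      case (elim m)
      let ?a = "3 / 2 + \<i> * complex_of_real (T m)" and ?b = "- 1 / 2 + \<i> * complex_of_real (T m)"
      have "norm (contour_integral (linepath ?a ?b) (integrand \<beta> n z))
          \<le> Sb * T m powr c * (exp (2 * \<bar>Re z\<bar>) * exp (- Im z * T m)) * norm (?b - ?a)"
      proof (rule contour_integral_bound_linepath[OF elim(1)])
        show "0 \<le> Sb * T m powr c * (exp (2 * \<bar>Re z\<bar>) * exp (- Im z * T m))" using Sb0 by simp
        fix s assume "s \<in> closed_segment ?a ?b"
        then have s: "Im s = T m" "Re s \<in> {- 1..2}"
          by (auto simp: closed_segment_same_Im closed_segment_eq_real_ivl)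
        have "s = of_real (Re s) + \<i> * of_real (T m)" using s(1) by (simp add: complex_eq_iff)
        then have inv: "norm (inverse (zeta s)) \<le> T m powr c" using elim(2) s(2) by metis
        have "\<bar>Re s\<bar> * \<bar>Re z\<bar> \<le> 2 * \<bar>Re z\<bar>" using s(2) by (intro mult_right_mono) auto
        then have "Re s * Re z \<le> 2 * \<bar>Re z\<bar>" using abs_le_D1[of "Re s * Re z" "2 * \<bar>Re z\<bar>"] by (simp add: abs_mult)
        then have "Re (s * z) \<le> 2 * \<bar>Re z\<bar> + - Im z * T m" using s(1) by (simp add: mult.commute)
        then have "norm (exp (s * z)) \<le> exp (2 * \<bar>Re z\<bar> + - Im z * T m)" by (simp only: norm_exp_eq_Re exp_le_cancel_iff)
        then have ex: "norm (exp (s * z)) \<le> exp (2 * \<bar>Re z\<bar>) * exp (- Im z * T m)" by (simp only: exp_add)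
        have div: "u / v * w = u * inverse v * w" for u v w :: complex by (simp add: divide_inverse)
        have "norm (integrand \<beta> n z s) = norm (sigmab \<beta> (1 - s / of_nat \<beta>) n) * norm (inverse (zeta s)) * norm (exp (s * z))"
          by (simp only: integrand_def div norm_mult)
        also have "\<dots> \<le> Sb * T m powr c * (exp (2 * \<bar>Re z\<bar>) * exp (- Im z * T m))"
        proof (rule mult_mono[OF mult_mono[OF _ inv Sb0 norm_ge_zero] ex])
          show "norm (sigmab \<beta> (1 - s / of_nat \<beta>) n) \<le> Sb" unfolding Sb_def by (rule norm_sigmab_le) (use s(2) in simp)
          show "0 \<le> Sb * T m powr c" using Sb0 by simp
        qed simp
        finally show "norm (integrand \<beta> n z s) \<le> Sb * T m powr c * (exp (2 * \<bar>Re z\<bar>) * exp (- Im z * T m))" .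
      qed
      also have "norm (?b - ?a) = 2" by simp
      finally show ?case .
    qed
  qed
qed

end

theorem theorem8:
  fixes \<beta> n :: nat and T :: "nat \<Rightarrow> real" and c1 :: real
  assumes simple_zeros: "\<forall>\<rho>. nontrivial_zero \<rho> \<longrightarrow> deriv zeta \<rho> \<noteq> 0"
    and T_bounds: "\<forall>m\<ge>1. real m \<le> T m \<and> T m \<le> real m + 1"
    and T_zeta: "\<forall>m\<ge>1. \<forall>\<sigma>\<in>{-1..2::real}.
        zeta (of_real \<sigma> + \<i> * of_real (T m)) \<noteq> 0 \<and>
        inverse (norm (zeta (of_real \<sigma> + \<i> * of_real (T m)))) < T m powr c1 \<and>
        zeta (of_real \<sigma> - \<i> * of_real (T m)) \<noteq> 0 \<and>
        inverse (norm (zeta (of_real \<sigma> - \<i> * of_real (T m)))) < T m powr c1"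
    and \<beta>: "\<beta> \<ge> 1" and n: "n \<ge> 1"
  shows "(\<forall>z. 0 < Im z \<longrightarrow> (\<lambda>m. varpi_partial \<beta> n (T m) z) \<longlonglongrightarrow> varpi T \<beta> n z)
    \<and> varpi T \<beta> n holomorphic_on {z. 0 < Im z}
    \<and> (\<forall>z. 0 < Im z \<longrightarrow>
         2 * pi * \<i> * varpi T \<beta> n z
           = varpi1 \<beta> n z + varpi2 \<beta> n z - exp (3 * z / 2) * cq_series \<beta> n z)
    \<and> (\<forall>z. 0 < Im z \<longrightarrow>
         (\<lambda>t::real. integrand \<beta> n z (- 1/2 + \<i> * of_real t)) integrable_on {0..})
    \<and> varpi1 \<beta> n analytic_on {z. 0 < Im z}
    \<and> varpi2 \<beta> n holomorphic_on UNIV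
    \<and> (\<forall>z. z \<notin> {of_real (ln (real q)) |q. q \<ge> 1 \<and> cq \<beta> q n \<noteq> 0} \<longrightarrow>
         summable (\<lambda>k. cq \<beta> (Suc k) n /
           (of_real (real (Suc k) powr (3/2)) * (z - of_real (ln (real (Suc k)))))))
    \<and> meromorphic_with_poles (\<lambda>z. exp (3 * z / 2) * cq_series \<beta> n z)
        {of_real (ln (real q)) |q. q \<ge> 1 \<and> cq \<beta> q n \<noteq> 0}"
proof -
  obtain C where C: "C \<ge> 0" "\<And>q. q \<ge> 1 \<Longrightarrow> norm (cq \<beta> q n) \<le> C" using cq_bounded[OF \<beta> n] by blast
  have T_top: "filterlim T at_top sequentially"
    by (rule filterlim_at_top_mono[OF filterlim_real_sequentially])
       (use T_bounds in \<open>auto intro: eventually_mono[OF eventually_ge_at_top[of 1]]\<close>)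
  \<comment> \<open>The limit is first computed as this explicit expression. The existence of
    \<open>varpi\<close> and its holomorphy are then read off from the expression, with no uniform
    convergence of the partial sums.\<close>
  let ?V = "\<lambda>z. (varpi1 \<beta> n z + varpi2 \<beta> n z - exp (3 * z / 2) * cq_series \<beta> n z) / (2 * pi * \<i>)"
  have lim: "(\<lambda>m. varpi_partial \<beta> n (T m) z) \<longlonglongrightarrow> ?V z" if z: "0 < Im z" for z
  proof -
    have T_pos: "T m > 0" if "m \<ge> 1" for m using T_bounds that by (meson less_le_trans of_nat_0_less_iff zero_less_one)
    let ?right = "\<lambda>m. contour_integral (right_side (T m)) (integrand \<beta> n z)"
    let ?top = "\<lambda>m. contour_integral (top_side (T m)) (integrand \<beta> n z)"
    let ?left = "\<lambda>m. - (\<i> * integral {0..T m} (\<lambda>t. integrand \<beta> n z (left_pt t)))"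
    have nz: "zeta (of_real \<sigma> + \<i> * of_real (T m)) \<noteq> 0" if "m \<ge> 1" "\<sigma> \<in> {- 1..2}" for m \<sigma>
      using T_zeta that by blast
    \<comment> \<open>From \<open>m = 1\<close> on only, since the hypotheses on \<open>T\<close>
      say nothing about \<open>T 0\<close>; hence the eventual statements below.\<close>
    have id: "2 * pi * \<i> * varpi_partial \<beta> n (T m) z = varpi2 \<beta> n z + ?right m + ?top m
        - \<i> * integral {0..T m} (\<lambda>t. integrand \<beta> n z (left_pt t))" if m: "m \<ge> 1" for m
      by (rule contour_identity(1)[OF \<beta> n _ T_pos[OF m] nz[OF m]]) (use simple_zeros in blast)
    have int: "integrand \<beta> n z contour_integrable_on top_side (T m)"
      if m: "m \<ge> 1" for m
      by (rule contour_identity(2)[OF \<beta> n _ T_pos[OF m] nz[OF m]]) (use simple_zeros in blast)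
    have top: "?top \<longlonglongrightarrow> 0"
    proof (rule top_integral_limit[OF \<beta> n z T_top])
      show "\<forall>\<^sub>F m in sequentially. integrand \<beta> n z contour_integrable_on top_side (T m)"
        using eventually_ge_at_top[of 1] by eventually_elim (rule int)
      show "\<forall>\<^sub>F m in sequentially. \<forall>\<sigma>\<in>{- 1..2}. norm (inverse (zeta (of_real \<sigma> + \<i> * of_real (T m)))) \<le> T m powr c1"
        using eventually_ge_at_top[of 1]
      proof eventually_elim
        case (elim m)
        then show ?case using T_zeta by (auto simp: norm_inverse intro: less_imp_le)
      qed
    qed
    have "(\<lambda>m. (varpi2 \<beta> n z + ?right m + ?top m + ?left m) / (2 * pi * \<i>)) \<longlonglongrightarrow>
        (varpi2 \<beta> n z + - (exp (3 * z / 2) * cq_series \<beta> n z) + 0 + varpi1 \<beta> n z) / (2 * pi * \<i>)"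
      by (intro tendsto_intros right_integral_limit[OF \<beta> n z T_top] top varpi1_limit[OF \<beta> n z T_top]) auto
    moreover have "\<forall>\<^sub>F m in sequentially. (varpi2 \<beta> n z + ?right m + ?top m + ?left m) / (2 * pi * \<i>) = varpi_partial \<beta> n (T m) z"
      using eventually_ge_at_top[of 1]
    proof eventually_elim
      case (elim m)
      have "varpi2 \<beta> n z + ?right m + ?top m + ?left m = 2 * pi * \<i> * varpi_partial \<beta> n (T m) z"
        using id[OF elim] by simp
      then show ?case by simp
    qed
    ultimately have "(\<lambda>m. varpi_partial \<beta> n (T m) z) \<longlonglongrightarrow>
        (varpi2 \<beta> n z + - (exp (3 * z / 2) * cq_series \<beta> n z) + 0 + varpi1 \<beta> n z) / (2 * pi * \<i>)"
      by (rule Lim_transform_eventually)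
    then show ?thesis by (simp add: algebra_simps)
  qed
  have varpi_eq: "varpi T \<beta> n z = ?V z" if "0 < Im z" for z
    unfolding varpi_def using lim[OF that] by (rule limI)
  \<comment> \<open>The poles are real.\<close>
  have "{z. 0 < Im z} \<subseteq> - cq_poles \<beta> n" by (auto simp: cq_poles_def)
  then have "?V holomorphic_on {z. 0 < Im z}"
    by (intro holomorphic_intros holomorphic_varpi1[OF \<beta> n] holomorphic_on_subset[OF holomorphic_varpi2[OF \<beta> n]]
        holomorphic_on_subset[OF holomorphic_cq_series[OF C]]) auto
  then have hol: "varpi T \<beta> n holomorphic_on {z. 0 < Im z}"
    by (rule holomorphic_transform) (use varpi_eq in auto)
  have an: "varpi1 \<beta> n analytic_on {z. 0 < Im z}"
    using holomorphic_varpi1[OF \<beta> n] by (simp add: analytic_on_open open_halfspace_Im_gt)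
  show ?thesis
    using lim varpi_eq hol an integrable_integrand_left_line[OF \<beta> n] holomorphic_varpi2[OF \<beta> n]
      meromorphic_cq_series[OF C] summable_cq_term[OF C]
    unfolding cq_poles_def cq_term_def by simp
qed

end
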